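(* Let $u$ be the global Oleinik's solution of the steady Prandtl system with outer flow $U\equiv1$ described in the context. Assume that $$|u_0(y)-1|\le C_4e^{-C_5y^2}\quad\text{and}\quad -C_6e^{-C_7y^2}\le \partial_y^2u_0(y)\le 0\qquad\text{for all } y\ge 0,$$ for some positive constants $C_4,C_5,C_6,C_7$ with $C_5>C_1$ and $C_7>C_1$, where $C_1$ is the constant in the Gaussian asymptotics of the Blasius profile. Then there exist positive constants $C,c,N$ such that for all $(x,y)\in(N,\infty)\times\mathbb{R}_+$: $$-\frac{C}{x+1}e^{-c\frac{y^2}{x+1}}\le\partial_y^2u(x,y)\le0,\qquad |\partial_y(u-\bar u)(x,y)|\le\frac{C}{(x+1)^{3/4}}\ln(x+e)e^{-c\frac{y^2}{x+1}},$$ $$|\partial_xu(x,y)|\le\frac{C}{x+1}e^{-c\frac{y^2}{x+1}},\qquad |\partial_x\partial_yu(x,y)|\le\frac{C}{(x+1)^{3/4}}e^{-c\frac{y^2}{x+1}}.$$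
   Context: Steady Prandtl system on $\mathbb{R}_+\times\mathbb{R}_+$ with zero pressure gradient (outer flow $U\equiv1$): $u\partial_xu+v\partial_yu-\partial_y^2u=0$, $\partial_xu+\partial_yv=0$, $u(0,y)=u_0(y)$, $u(x,0)=v(x,0)=0$, $\lim_{y\to\infty}u(x,y)=1$. The datum satisfies Oleinik's conditions: $u_0\in C_b^{2,\alpha}([0,\infty))$ for some $\alpha>0$, $u_0(0)=0$, $u_0'(0)>0$, $u_0(y)>0$ for $y>0$, $u_0''(y)=O(y^2)$ as $y\to0$, and $u_0(y)\to1$ as $y\to\infty$. An Oleinik's solution is the (unique) global-in-$x$ solution $u\in C^1(\mathbb{R}_+\times\mathbb{R}_+)$ such that for every $X>0$: $u$ is bounded and continuous on $[0,X]\times\mathbb{R}_+$; $u>0$ for $y>0$; $u_y,u_{yy}$ are bounded and continuous on $[0,X]\times\mathbb{R}_+$; $v,v_y,u_x$ are locally bounded and continuous there. The Blasius profile $f$ solves $\frac12ff''+f'''=0$, $f(0)=f'(0)=0$, $f'(\infty)=1$; it satisfies $0\le f'\le1$, $f''\ge0$, $f''(0)>0$, $f'''<0$ on $(0,\infty)$, and there are positive constants $C_1,C_2$ with $1-f'(\zeta)\sim\zeta^{-1}e^{-C_1\zeta^2-C_2\zeta}$, $f''(\zeta)\sim e^{-C_1\zeta^2-C_2\zeta}$ as $\zeta\to\infty$. The Blasius solution is $\bar u(x,y)=f'(y/\sqrt{x+1})$. *)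

theory Defs
  imports "HOL-Analysis.Analysis" "HOL-Library.Landau_Symbols"
begin

definition quadrant :: "(real \<times> real) set" where
  "quadrant = {0..} \<times> {0..}"

definition strip :: "real \<Rightarrow> (real \<times> real) set" where
  "strip X = {0..X} \<times> {0..}"

definition oleinik_datum ::
  "(real \<Rightarrow> real) \<Rightarrow> (real \<Rightarrow> real) \<Rightarrow> (real \<Rightarrow> real) \<Rightarrow> bool" where
  "oleinik_datum u0 u0' u0'' \<longleftrightarrow>
     (\<forall>y\<ge>0. (u0 has_real_derivative u0' y) (at y within {0..}) \<and>
             (u0' has_real_derivative u0'' y) (at y within {0..})) \<and>
     bounded (u0 ` {0..}) \<and> bounded (u0' ` {0..}) \<and> bounded (u0'' ` {0..}) \<and>
     (\<exists>\<alpha>>0. \<exists>H. \<forall>y\<ge>0. \<forall>z\<ge>0. \<bar>u0'' y - u0'' z\<bar> \<le> H * \<bar>y - z\<bar> powr \<alpha>) \<and>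
     u0 0 = 0 \<and> u0' 0 > 0 \<and> (\<forall>y>0. u0 y > 0) \<and>
     (\<exists>K \<delta>. \<delta> > 0 \<and> (\<forall>y. 0 \<le> y \<and> y \<le> \<delta> \<longrightarrow> \<bar>u0'' y\<bar> \<le> K * y\<^sup>2)) \<and>
     (u0 \<longlongrightarrow> 1) at_top"

definition oleinik_solution ::
  "(real \<Rightarrow> real) \<Rightarrow> (real \<Rightarrow> real \<Rightarrow> real) \<Rightarrow> (real \<Rightarrow> real \<Rightarrow> real) \<Rightarrow>
   (real \<Rightarrow> real \<Rightarrow> real) \<Rightarrow> (real \<Rightarrow> real \<Rightarrow> real) \<Rightarrow> (real \<Rightarrow> real \<Rightarrow> real) \<Rightarrow>
   (real \<Rightarrow> real \<Rightarrow> real) \<Rightarrow> bool" where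
  "oleinik_solution u0 u v ux uy uyy vy \<longleftrightarrow>
     \<comment> \<open>partial derivatives\<close>
     (\<forall>x\<ge>0. \<forall>y\<ge>0.
        ((\<lambda>s. u s y) has_real_derivative ux x y) (at x within {0..}) \<and>
        ((\<lambda>t. u x t) has_real_derivative uy x y) (at y within {0..}) \<and>
        ((\<lambda>t. uy x t) has_real_derivative uyy x y) (at y within {0..}) \<and>
        ((\<lambda>t. v x t) has_real_derivative vy x y) (at y within {0..})) \<and>
     \<comment> \<open>u is C^1 on the quarter plane\<close>
     continuous_on quadrant (\<lambda>(x,y). u x y) \<and>
     continuous_on quadrant (\<lambda>(x,y). ux x y) \<and>
     continuous_on quadrant (\<lambda>(x,y). uy x y) \<and>
     \<comment> \<open>the equations\<close>
     (\<forall>x>0. \<forall>y>0. u x y * ux x y + v x y * uy x y - uyy x y = 0 \<and>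
                  ux x y + vy x y = 0) \<and>
     \<comment> \<open>data and boundary conditions\<close>
     (\<forall>y\<ge>0. u 0 y = u0 y) \<and>
     (\<forall>x\<ge>0. u x 0 = 0 \<and> v x 0 = 0) \<and>
     (\<forall>x\<ge>0. ((\<lambda>y. u x y) \<longlongrightarrow> 1) at_top) \<and>
     \<comment> \<open>Oleinik's regularity class on every strip [0,X] x [0,\<infinity>)\<close>
     (\<forall>X>0.
        bounded ((\<lambda>(x,y). u x y) ` strip X) \<and> continuous_on (strip X) (\<lambda>(x,y). u x y) \<and>
        (\<forall>x\<in>{0..X}. \<forall>y>0. u x y > 0) \<and>
        bounded ((\<lambda>(x,y). uy x y) ` strip X) \<and> continuous_on (strip X) (\<lambda>(x,y). uy x y) \<and>
        bounded ((\<lambda>(x,y). uyy x y) ` strip X) \<and> continuous_on (strip X) (\<lambda>(x,y). uyy x y) \<and>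
        (\<forall>K. compact K \<and> K \<subseteq> strip X \<longrightarrow>
           bounded ((\<lambda>(x,y). v x y) ` K) \<and> bounded ((\<lambda>(x,y). vy x y) ` K) \<and>
           bounded ((\<lambda>(x,y). ux x y) ` K)) \<and>
        continuous_on (strip X) (\<lambda>(x,y). v x y) \<and>
        continuous_on (strip X) (\<lambda>(x,y). vy x y) \<and>
        continuous_on (strip X) (\<lambda>(x,y). ux x y))"

definition blasius ::
  "(real \<Rightarrow> real) \<Rightarrow> (real \<Rightarrow> real) \<Rightarrow> (real \<Rightarrow> real) \<Rightarrow> (real \<Rightarrow> real) \<Rightarrow> bool" where
  "blasius f f1 f2 f3 \<longleftrightarrow>
     (\<forall>z\<ge>0. (f has_real_derivative f1 z) (at z within {0..}) \<and>
             (f1 has_real_derivative f2 z) (at z within {0..}) \<and>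
             (f2 has_real_derivative f3 z) (at z within {0..}) \<and>
             f z * f2 z / 2 + f3 z = 0) \<and>
     f 0 = 0 \<and> f1 0 = 0 \<and> (f1 \<longlongrightarrow> 1) at_top"

end

theory Submission
  imports Defs
begin

text \<open>
  In von Mises variables \<open>t = \<integral>\<^sub>0\<^sup>y u\<close>, \<open>w = u\<^sup>2\<close>, the system becomes \<open>w\<^sub>x = sqrt w w\<^sub>t\<^sub>t\<close>, which is
  invariant under translations in \<open>x\<close> and under \<open>(x, t) \<mapsto> (\<mu> x, sqrt \<mu> t)\<close>.
  Comparison with the self-similar Blasius solution \<open>W = \<Omega> (t / sqrt x)\<close>, both unshifted and started at
  \<open>x = - s0\<close>, sandwiches \<open>u\<close> with an error \<open>O(1/x)\<close> and Gaussian weights. Comparing \<open>w\<close> with its own translates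
  and dilates gives \<open>- t w\<^sub>t / (2 x) \<le> w\<^sub>x \<le> 0\<close>, which is the bound for \<open>2 u\<^sub>y\<^sub>y\<close> and, through
  \<open>(v / u)\<^sub>y = - u\<^sub>y\<^sub>y / u\<^sup>2\<close>, for \<open>u\<^sub>x\<close>; interpolation then controls \<open>u\<^sub>y\<close> minus its Blasius value.

  The mixed derivative rests on a doubling-of-variables estimate for the slope of solutions of \<open>z\<^sub>x = a z\<^sub>t\<^sub>t + e\<close>.
  Applied to the difference quotients of \<open>w\<close> in \<open>x\<close> it makes \<open>w\<^sub>t\<close> Lipschitz in \<open>x\<close>, with the required decay.
  Applied once more to the second differences in \<open>x\<close>, which are \<open>O(k\<^bsup>3/2\<^esup>)\<close> since \<open>w\<^sub>x\<close> is Hoelder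
  continuous with exponent 1/2, it yields second differences of \<open>w\<^sub>t\<close> of order \<open>k\<^bsup>3/2\<^esup>\<close>, so that \<open>w\<^sub>t\<close> is
  differentiable in \<open>x\<close>. At the wall a concave barrier gives second differences of order \<open>k\<^bsup>9/8\<^esup>\<close> instead.
\<close>

section \<open>Maximum principles\<close>

text \<open>The solution class provides neither a third \<open>y\<close>-derivative nor a mixed
  derivative, and the diffusion coefficient \<open>sqrt w\<close> vanishes at the wall. The equation
  cannot be differentiated: derivative bounds come from comparing solutions with each other, or from
  finite differences, whose equations involve only derivatives that exist. Comparing two solutions
  leaves the term \<open>(sqrt w - sqrt w') w'_tt\<close>, which has a good sign once
  \<open>w'\<close> is concave in \<open>t\<close>. The Blasius flow and the initial profile are
  concave, but concavity of \<open>w\<close> at later \<open>x\<close> is the same as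
  \<open>w_x \<le> 0\<close>, the claim itself. So translates in \<open>x\<close> need a comparison
  principle that tolerates a coefficient of size \<open>1/t\<close> next to a degenerate diffusion.
  With concavity in hand, dilates are handled by the ordinary principle. The two barriers differ
  only by a shift of the origin in \<open>x\<close>, and such a shift changes the Blasius flow by
  \<open>O(1/x)\<close>. All rates obtained are of order \<open>1/x\<close>; the power 3/4 and the
  logarithm enter only at the very end, as a weakening.\<close>

lemma second_derivative_at_max:
  fixes f f' :: "real \<Rightarrow> real"
  assumes d: "0 < \<delta>"
    and f': "\<And>s. \<bar>s - c\<bar> < \<delta> \<Longrightarrow> (f has_real_derivative f' s) (at s)"
    and f'': "(f' has_real_derivative D) (at c)"
    and max: "\<And>s. \<bar>s - c\<bar> < \<delta> \<Longrightarrow> f s \<le> f c"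
  shows "D \<le> 0"
proof (rule ccontr)
  assume "\<not> D \<le> 0"
  then have D: "D > 0" by simp
  have zero: "f' c = 0"
    by (rule DERIV_local_max[of f "f' c" c \<delta>]) (use assms in \<open>auto simp: abs_minus_commute\<close>)
  obtain e where e: "e > 0" "\<And>h. h > 0 \<Longrightarrow> h < e \<Longrightarrow> f' c < f' (c + h)"
    using DERIV_pos_inc_right[OF f'' D] by auto
  define h where "h = min e \<delta> / 2"
  have h: "h > 0" "h < e" "h < \<delta>" using e(1) d by (auto simp: h_def min_def field_simps)
  have "f c < f (c + h)"
  proof (rule DERIV_pos_imp_increasing_open[where f = f and a = c])
    show "c < c + h" using h by simp
    show "\<exists>y. (f has_real_derivative y) (at x) \<and> 0 < y" if "c < x" "x < c + h" for x
    proof (intro exI conjI)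
      show "(f has_real_derivative f' x) (at x)" using that h by (intro f') auto
      show "0 < f' x" using e(2)[of "x - c"] that h zero by auto
    qed
    show "continuous_on {c..c + h} f"
      by (rule continuous_at_imp_continuous_on) (use h in \<open>auto intro!: DERIV_isCont f'\<close>)
  qed
  then show False using max[of "c + h"] h by auto
qed

text \<open>Only the left side is compared because a maximum over a parabolic rectangle may lie on
  its final side, where no later point is available.\<close>

lemma derivative_at_left_max:
  fixes f :: "real \<Rightarrow> real"
  assumes "0 < \<delta>" "(f has_real_derivative D) (at c)"
    and max: "\<And>s. c - \<delta> < s \<Longrightarrow> s \<le> c \<Longrightarrow> f s \<le> f c"
  shows "D \<ge> 0"
proof (rule ccontr)
  assume "\<not> D \<ge> 0"
  then have D: "D < 0" by simp
  obtain e where e: "e > 0" "\<And>h. h > 0 \<Longrightarrow> h < e \<Longrightarrow> f c < f (c - h)"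
    using DERIV_neg_dec_left[OF assms(2) D] by auto
  define h where "h = min e \<delta> / 2"
  have h: "h > 0" "h < e" "h < \<delta>" using e(1) assms(1) by (auto simp: h_def min_def field_simps)
  show False using e(2)[of h] max[of "c - h"] h by auto
qed

text \<open>At a positive maximum off the parabolic boundary, \<open>Fx\<close> is nonnegative and
  \<open>F2\<close> nonpositive. The equation enters only through \<open>op\<close>, which excludes
  these signs, so one lemma serves all barriers and all nonlinear differences.\<close>

lemma rectangle_max_principle:
  fixes F Fx F1 F2 :: "real \<Rightarrow> real \<Rightarrow> real"
  assumes cont: "continuous_on ({x1..x2} \<times> {\<alpha>..\<beta>}) (\<lambda>(x,t). F x t)"
    and init: "\<And>t. \<alpha> \<le> t \<Longrightarrow> t \<le> \<beta> \<Longrightarrow> F x1 t \<le> 0"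
    and left: "\<And>x. x1 \<le> x \<Longrightarrow> x \<le> x2 \<Longrightarrow> F x \<alpha> \<le> 0"
    and right: "\<And>x. x1 \<le> x \<Longrightarrow> x \<le> x2 \<Longrightarrow> F x \<beta> \<le> 0"
    and Dx: "\<And>x t. x1 < x \<Longrightarrow> x \<le> x2 \<Longrightarrow> \<alpha> < t \<Longrightarrow> t < \<beta> \<Longrightarrow>
               ((\<lambda>s. F s t) has_real_derivative Fx x t) (at x)"
    and D1: "\<And>x t. x1 < x \<Longrightarrow> x \<le> x2 \<Longrightarrow> \<alpha> < t \<Longrightarrow> t < \<beta> \<Longrightarrow>
               (F x has_real_derivative F1 x t) (at t)"
    and D2: "\<And>x t. x1 < x \<Longrightarrow> x \<le> x2 \<Longrightarrow> \<alpha> < t \<Longrightarrow> t < \<beta> \<Longrightarrow>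
               (F1 x has_real_derivative F2 x t) (at t)"
    and op: "\<And>x t. x1 < x \<Longrightarrow> x \<le> x2 \<Longrightarrow> \<alpha> < t \<Longrightarrow> t < \<beta> \<Longrightarrow> F x t > 0 \<Longrightarrow>
               Fx x t \<ge> 0 \<Longrightarrow> F2 x t \<le> 0 \<Longrightarrow> False"
    and x: "x1 \<le> x" "x \<le> x2" and t: "\<alpha> \<le> t" "t \<le> \<beta>"
  shows "F x t \<le> 0"
proof (rule ccontr)
  assume pos: "\<not> F x t \<le> 0"
  have "compact ({x1..x2} \<times> {\<alpha>..\<beta>})" by (intro compact_Times) auto
  moreover have "{x1..x2} \<times> {\<alpha>..\<beta>} \<noteq> {}" using x t by auto
  ultimately obtain q where q: "q \<in> {x1..x2} \<times> {\<alpha>..\<beta>}"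
    "\<And>r. r \<in> {x1..x2} \<times> {\<alpha>..\<beta>} \<Longrightarrow> (\<lambda>(x,t). F x t) r \<le> (\<lambda>(x,t). F x t) q"
    using continuous_attains_sup[OF _ _ cont] by blast
  obtain a b where ab: "q = (a, b)" by force
  have a: "x1 \<le> a" "a \<le> x2" and b: "\<alpha> \<le> b" "b \<le> \<beta>" using q(1) ab by auto
  have max: "F s r \<le> F a b" if "x1 \<le> s" "s \<le> x2" "\<alpha> \<le> r" "r \<le> \<beta>" for s r
    using q(2)[of "(s, r)"] that ab by auto
  have Fpos: "F a b > 0" using max[OF x t] pos by simp
  have a': "x1 < a" using init[OF b] Fpos a by (cases "a = x1") auto
  have b': "\<alpha> < b" "b < \<beta>" using left[OF a] right[OF a] Fpos b by (auto simp: order_less_le)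
  have "Fx a b \<ge> 0"
    by (rule derivative_at_left_max[OF _ Dx[OF a' a(2) b'], of "a - x1"])
       (use a a' b max in auto)
  moreover have "F2 a b \<le> 0"
    by (rule second_derivative_at_max[where \<delta> = "min (b - \<alpha>) (\<beta> - b)", OF _ D1[OF a' a(2)] D2[OF a' a(2) b']])
       (use a b b' max in auto)
  ultimately show False using op[OF a' a(2) b' Fpos] by simp
qed

text \<open>The doubling-of-variables (reflection coupling) argument: the test function
  \<open>L \<phi>(X - Y) + N ((X - c)\<^sup>2 + (Y - c)\<^sup>2 + a0 (x0 - x))\<close> with the concave \<open>\<phi>(\<rho>) = \<rho> - \<rho>\<^sup>2/(4r)\<close>
  dominates \<open>z x X - z x Y\<close>; the second derivative is tested along the single direction
  \<open>(sqrt (a x X), - sqrt (a x Y))\<close>, so no regularity of the coefficient is needed.\<close>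

lemma local_lipschitz_upper:
  fixes z zx z1 z2 a :: "real \<Rightarrow> real \<Rightarrow> real"
  assumes r: "r > 0" and a0: "a0 > 0" and M: "M > 0" and E: "E \<ge> 0"
    and cont: "continuous_on ({x0 - r\<^sup>2/a0..x0} \<times> {c - r..c + r}) (\<lambda>(x,t). z x t)"
    and Dx: "\<And>x t. x0 - r\<^sup>2/a0 < x \<Longrightarrow> x \<le> x0 \<Longrightarrow> c - r < t \<Longrightarrow> t < c + r \<Longrightarrow>
               ((\<lambda>s. z s t) has_real_derivative zx x t) (at x)"
    and D1: "\<And>x t. x0 - r\<^sup>2/a0 < x \<Longrightarrow> x \<le> x0 \<Longrightarrow> c - r < t \<Longrightarrow> t < c + r \<Longrightarrow>
               (z x has_real_derivative z1 x t) (at t)"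
    and D2: "\<And>x t. x0 - r\<^sup>2/a0 < x \<Longrightarrow> x \<le> x0 \<Longrightarrow> c - r < t \<Longrightarrow> t < c + r \<Longrightarrow>
               (z1 x has_real_derivative z2 x t) (at t)"
    and a: "\<And>x t. x0 - r\<^sup>2/a0 < x \<Longrightarrow> x \<le> x0 \<Longrightarrow> c - r < t \<Longrightarrow> t < c + r \<Longrightarrow>
               a0 \<le> a x t \<and> a x t \<le> a1"
    and e: "\<And>x t. x0 - r\<^sup>2/a0 < x \<Longrightarrow> x \<le> x0 \<Longrightarrow> c - r < t \<Longrightarrow> t < c + r \<Longrightarrow>
               \<bar>zx x t - a x t * z2 x t\<bar> \<le> E"
    and bd: "\<And>x t. x0 - r\<^sup>2/a0 \<le> x \<Longrightarrow> x \<le> x0 \<Longrightarrow> c - r \<le> t \<Longrightarrow> t \<le> c + r \<Longrightarrow> \<bar>z x t\<bar> \<le> M"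
    and k: "0 \<le> k" "k \<le> r"
  shows "z x0 (c + k) - z x0 c \<le> (M * (2 + 4 * a1 / a0) / r + E * r / a0) * k + 2 * M / r\<^sup>2 * k\<^sup>2"
proof -
  define T where "T = r\<^sup>2 / a0"
  \<comment> \<open>Fixed by \<open>N r^2 = N a0 T = 2 M\<close>: on the lateral sides and at the
    initial time the quadratic penalty already outweighs the oscillation \<open>2 M\<close> of
    \<open>z\<close>.\<close>
  define N where "N = 2 * M / r\<^sup>2"
  \<comment> \<open>Chosen so that \<open>8 \<kappa> a0 L = 2 N a0 + 4 N a1 + 2 E\<close>, which
    exceeds by \<open>N a0\<close> what the conditions at a positive maximum allow.\<close>
  define L where "L = M * (2 + 4 * a1 / a0) / r + E * r / a0"
  define \<kappa> where "\<kappa> = 1 / (4 * r)"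
  define \<phi> where "\<phi> \<rho> = \<rho> - \<kappa> * \<rho>\<^sup>2" for \<rho>
  define S where "S = ({x0 - T..x0} \<times> {c - r..c + r} \<times> {c - r..c + r}) \<inter> {(x, X, Y). Y \<le> X}"
  define G where "G = (\<lambda>(x, X, Y). z x X - z x Y - L * \<phi> (X - Y)
                        - N * ((X - c)\<^sup>2 + (Y - c)\<^sup>2 + a0 * (x0 - x)))"
  have T: "T > 0" and N: "N > 0" using r a0 M by (auto simp: T_def N_def)
  have a01: "a0 \<le> a1" using a[of x0 c] r T by (auto simp: T_def)
  have L: "L > 0" using M r a0 a01 E by (auto simp: L_def intro!: add_pos_nonneg divide_pos_pos mult_pos_pos)
  have closed: "closed {(x::real, X::real, Y::real). Y \<le> X}"
    unfolding split_def by (intro closed_Collect_le continuous_intros)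
  have S: "compact S"
    unfolding S_def by (intro compact_Int_closed compact_Times closed) auto
  have "(x0, c, c) \<in> S" using r T by (auto simp: S_def)
  then have ne: "S \<noteq> {}" by auto
  have Gcont: "continuous_on S G"
  proof -
    have "continuous_on S (\<lambda>q. (\<lambda>(x,t). z x t) (fst q, fst (snd q)))"
      by (rule continuous_on_compose2[OF cont]) (auto intro!: continuous_intros simp: S_def T_def)
    moreover have "continuous_on S (\<lambda>q. (\<lambda>(x,t). z x t) (fst q, snd (snd q)))"
      by (rule continuous_on_compose2[OF cont]) (auto intro!: continuous_intros simp: S_def T_def)
    ultimately show ?thesis
      unfolding G_def \<phi>_def split_def using r by (auto intro!: continuous_intros)
  qed
  obtain q where q: "q \<in> S" "\<And>r. r \<in> S \<Longrightarrow> G r \<le> G q"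
    using continuous_attains_sup[OF S ne Gcont] by auto
  obtain x X Y where xXY: "q = (x, X, Y)" by (cases q) auto
  have x: "x0 - T \<le> x" "x \<le> x0" and X: "c - r \<le> X" "X \<le> c + r"
    and Y: "c - r \<le> Y" "Y \<le> c + r" and YX: "Y \<le> X"
    using q(1) xXY by (auto simp: S_def)
  have max: "G (s, u, v) \<le> G (x, X, Y)"
    if "x0 - T \<le> s" "s \<le> x0" "c - r \<le> u" "u \<le> c + r" "c - r \<le> v" "v \<le> c + r" "v \<le> u" for s u v
    using q(2)[of "(s, u, v)"] that xXY by (auto simp: S_def)
  have phi0: "\<phi> \<rho> \<ge> 0" if "0 \<le> \<rho>" "\<rho> \<le> 2 * r" for \<rho>
  proof -
    have "\<rho>\<^sup>2 \<le> \<rho> * (2 * r)" using that by (simp add: power2_eq_square mult_left_mono)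
    then have "\<kappa> * \<rho>\<^sup>2 \<le> \<rho> / 2" using r by (simp add: \<kappa>_def field_simps)
    then show ?thesis using that by (simp add: \<phi>_def)
  qed
  have "G (x, X, Y) \<le> 0"
  proof (rule ccontr)
    assume "\<not> G (x, X, Y) \<le> 0"
    then have pos: "G (x, X, Y) > 0" by simp
    have z2M: "z x X - z x Y \<le> 2 * M" using bd[of x X] bd[of x Y] x X Y by (auto simp: T_def)
    have Lphi: "L * \<phi> (X - Y) \<ge> 0" using phi0[of "X - Y"] X Y YX L by auto
    have Nr: "N * r\<^sup>2 = 2 * M" "N * (a0 * T) = 2 * M" using r a0 by (auto simp: N_def T_def)
    have sm: "N * ((X - c)\<^sup>2 + (Y - c)\<^sup>2 + a0 * (x0 - x)) < 2 * M"
      using pos z2M Lphi by (simp add: G_def)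
    have parts: "N * (X - c)\<^sup>2 < N * r\<^sup>2" "N * (Y - c)\<^sup>2 < N * r\<^sup>2" "N * (a0 * (x0 - x)) < N * (a0 * T)"
    proof -
      have "0 \<le> N * (X - c)\<^sup>2" "0 \<le> N * (Y - c)\<^sup>2" "0 \<le> N * (a0 * (x0 - x))" using N a0 x by auto
      then show "N * (X - c)\<^sup>2 < N * r\<^sup>2" "N * (Y - c)\<^sup>2 < N * r\<^sup>2" "N * (a0 * (x0 - x)) < N * (a0 * T)"
        using sm unfolding Nr by (auto simp: algebra_simps)
    qed
    have "(X - c)\<^sup>2 < r\<^sup>2" "(Y - c)\<^sup>2 < r\<^sup>2" "x0 - x < T"
      using parts N a0 by (auto simp: mult_less_cancel_left_pos)
    then have int: "\<bar>X - c\<bar> < r" "\<bar>Y - c\<bar> < r" "x0 - T < x"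
      using r by (auto intro!: power2_less_imp_less[of _ r])
    have "X \<noteq> Y"
    proof
      assume "X = Y"
      then have "G (x, X, Y) = - (N * ((X - c)\<^sup>2 + (Y - c)\<^sup>2 + a0 * (x0 - x)))"
        by (simp add: G_def \<phi>_def)
      also have "\<dots> \<le> 0" using N a0 x by auto
      finally show False using pos by simp
    qed
    then have YX': "Y < X" using YX by simp
    have intX: "x0 - r\<^sup>2/a0 < x" "c - r < X" "X < c + r" "c - r < Y" "Y < c + r"
      using int by (auto simp: T_def)
    define \<alpha> where "\<alpha> = sqrt (a x X)"
    define \<beta> where "\<beta> = sqrt (a x Y)"
    have aX: "a0 \<le> a x X" "a x X \<le> a1" and aY: "a0 \<le> a x Y" "a x Y \<le> a1"
      using a intX x by auto
    have sq: "\<alpha>\<^sup>2 = a x X" "\<beta>\<^sup>2 = a x Y" "\<alpha> > 0" "\<beta> > 0" using aX aY a0 by (auto simp: \<alpha>_def \<beta>_def)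
    have time: "zx x X - zx x Y + N * a0 \<ge> 0"
    proof (rule derivative_at_left_max[where \<delta> = "x - (x0 - T)"])
      show "((\<lambda>s. G (s, X, Y)) has_real_derivative zx x X - zx x Y + N * a0) (at x)"
        unfolding G_def split
        by (rule derivative_eq_intros Dx intX x refl | simp add: algebra_simps)+
    qed (use int x X Y YX in \<open>auto intro!: max\<close>)
    \<comment> \<open>Since \<open>X\<close> and \<open>Y\<close> move in opposite directions, the
      second derivative of \<open>- L \<phi> (X - Y)\<close> is the gain
      \<open>2 \<kappa> L (\<alpha> + \<beta>)^2\<close>, at least \<open>8 \<kappa> a0 L\<close>
      however much the coefficient oscillates.\<close>
    have space: "\<alpha>\<^sup>2 * z2 x X - \<beta>\<^sup>2 * z2 x Y + L * (2 * \<kappa> * (\<alpha> + \<beta>)\<^sup>2) - N * (2 * \<alpha>\<^sup>2 + 2 * \<beta>\<^sup>2) \<le> 0"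
    proof -
      define m where "m = Min {r - \<bar>X - c\<bar>, r - \<bar>Y - c\<bar>, X - Y}"
      define d where "d = m / (2 * (\<alpha> + \<beta>))"
      have m: "m > 0" "m \<le> r - \<bar>X - c\<bar>" "m \<le> r - \<bar>Y - c\<bar>" "m \<le> X - Y"
        using int YX' by (auto simp: m_def)
      have ab: "\<alpha> + \<beta> > 0" using sq by simp
      have d: "d > 0" using m ab by (auto simp: d_def)
      have near: "\<bar>X + s * \<alpha> - c\<bar> < r \<and> \<bar>Y - s * \<beta> - c\<bar> < r \<and> Y - s * \<beta> < X + s * \<alpha>"
        if "\<bar>s\<bar> < d" for s
      proof -
        have "\<bar>s\<bar> * (\<alpha> + \<beta>) < d * (\<alpha> + \<beta>)" using that ab by simp
        also have "d * (\<alpha> + \<beta>) = m / 2"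
          using ab by (simp add: d_def field_simps)
        finally have "\<bar>s\<bar> * (\<alpha> + \<beta>) < r - \<bar>X - c\<bar>" "\<bar>s\<bar> * (\<alpha> + \<beta>) < r - \<bar>Y - c\<bar>" "\<bar>s\<bar> * (\<alpha> + \<beta>) < X - Y"
          using m by auto
        moreover have "\<bar>s * \<alpha>\<bar> \<le> \<bar>s\<bar> * (\<alpha> + \<beta>)" "\<bar>s * \<beta>\<bar> \<le> \<bar>s\<bar> * (\<alpha> + \<beta>)"
          "\<bar>s * \<alpha> + s * \<beta>\<bar> \<le> \<bar>s\<bar> * (\<alpha> + \<beta>)"
          using sq by (auto simp: abs_mult mult_left_mono simp flip: distrib_left)
        ultimately show ?thesis by (smt (verit))
      qed
      define g where "g s = G (x, X + s * \<alpha>, Y - s * \<beta>)" for s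
      define g' where "g' s = z1 x (X + s * \<alpha>) * \<alpha> + z1 x (Y - s * \<beta>) * \<beta>
          - L * ((\<alpha> + \<beta>) - 2 * \<kappa> * (X - Y + s * (\<alpha> + \<beta>)) * (\<alpha> + \<beta>))
          - N * (2 * (X + s * \<alpha> - c) * \<alpha> - 2 * (Y - s * \<beta> - c) * \<beta>)" for s
      show ?thesis
      proof (rule second_derivative_at_max[OF d])
        fix s assume "\<bar>s - 0\<bar> < d"
        then have n: "c - r < X + s * \<alpha>" "X + s * \<alpha> < c + r" "c - r < Y - s * \<beta>" "Y - s * \<beta> < c + r"
          "Y - s * \<beta> < X + s * \<alpha>" using near[of s] by auto
        show "g s \<le> g 0" using n x by (auto simp: g_def intro!: max)
        show "(g has_real_derivative g' s) (at s)"
          unfolding g_def G_def split \<phi>_def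
          by (rule derivative_eq_intros DERIV_chain2[OF D1] intX x n refl)+
             (simp add: g'_def algebra_simps power2_eq_square)
      next
        show "(g' has_real_derivative \<alpha>\<^sup>2 * z2 x X - \<beta>\<^sup>2 * z2 x Y + L * (2 * \<kappa> * (\<alpha> + \<beta>)\<^sup>2) - N * (2 * \<alpha>\<^sup>2 + 2 * \<beta>\<^sup>2)) (at 0)"
          unfolding g'_def
          by (rule derivative_eq_intros DERIV_chain2[OF D2] intX x refl | use intX x in \<open>simp; fail\<close>)+
             (simp add: algebra_simps power2_eq_square)
      qed
    qed
    have eq: "\<bar>zx x X - \<alpha>\<^sup>2 * z2 x X\<bar> \<le> E" "\<bar>zx x Y - \<beta>\<^sup>2 * z2 x Y\<bar> \<le> E"
      using e intX x unfolding sq by auto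
    have "4 * a0 \<le> (\<alpha> + \<beta>)\<^sup>2"
    proof -
      have "sqrt a0 \<le> \<alpha>" "sqrt a0 \<le> \<beta>" using aX aY by (auto simp: \<alpha>_def \<beta>_def)
      then have "(2 * sqrt a0)\<^sup>2 \<le> (\<alpha> + \<beta>)\<^sup>2" using a0 by (intro power_mono) auto
      then show ?thesis using a0 by (simp add: power_mult_distrib)
    qed
    then have "L * (2 * \<kappa> * (4 * a0)) \<le> L * (2 * \<kappa> * (\<alpha> + \<beta>)\<^sup>2)"
      using L r by (intro mult_left_mono) (auto simp: \<kappa>_def)
    moreover have "N * (2 * \<alpha>\<^sup>2 + 2 * \<beta>\<^sup>2) \<le> N * (4 * a1)"
      using N aX aY unfolding sq by (intro mult_left_mono) auto
    ultimately have "L * (2 * \<kappa> * (4 * a0)) \<le> N * a0 + N * (4 * a1) + 2 * E"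
      using time space eq by linarith
    moreover have "L * (2 * \<kappa> * (4 * a0)) = N * (2 * a0) + N * (4 * a1) + 2 * E"
      using r a0 by (simp add: L_def N_def \<kappa>_def field_simps power2_eq_square)
    ultimately show False using N a0 by (simp add: mult_pos_pos)
  qed
  moreover have "G (x0, c + k, c) \<le> G (x, X, Y)" using k r T by (intro max) auto
  ultimately have "z x0 (c + k) - z x0 c \<le> L * \<phi> k + N * k\<^sup>2" by (simp add: G_def)
  also have "\<phi> k \<le> k" using r by (simp add: \<phi>_def \<kappa>_def)
  finally show ?thesis using L by (simp add: L_def N_def mult_left_mono)
qed

text \<open>Dividing the increment bound by \<open>k\<close> and letting \<open>k\<close> tend to 0
  removes the quadratic term. The lower bound is the same statement for \<open>- z\<close>, which
  solves an equation of the same kind.\<close>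

lemma local_lipschitz_slope:
  fixes z zx z1 z2 a :: "real \<Rightarrow> real \<Rightarrow> real"
  assumes r: "r > 0" and a0: "a0 > 0" and M: "M > 0" and E: "E \<ge> 0"
    and cont: "continuous_on ({x0 - r\<^sup>2/a0..x0} \<times> {c - r..c + r}) (\<lambda>(x,t). z x t)"
    and Dx: "\<And>x t. x0 - r\<^sup>2/a0 < x \<Longrightarrow> x \<le> x0 \<Longrightarrow> c - r < t \<Longrightarrow> t < c + r \<Longrightarrow>
               ((\<lambda>s. z s t) has_real_derivative zx x t) (at x)"
    and D1: "\<And>x t. x0 - r\<^sup>2/a0 < x \<Longrightarrow> x \<le> x0 \<Longrightarrow> c - r < t \<Longrightarrow> t < c + r \<Longrightarrow>
               (z x has_real_derivative z1 x t) (at t)"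
    and D2: "\<And>x t. x0 - r\<^sup>2/a0 < x \<Longrightarrow> x \<le> x0 \<Longrightarrow> c - r < t \<Longrightarrow> t < c + r \<Longrightarrow>
               (z1 x has_real_derivative z2 x t) (at t)"
    and a: "\<And>x t. x0 - r\<^sup>2/a0 < x \<Longrightarrow> x \<le> x0 \<Longrightarrow> c - r < t \<Longrightarrow> t < c + r \<Longrightarrow>
               a0 \<le> a x t \<and> a x t \<le> a1"
    and e: "\<And>x t. x0 - r\<^sup>2/a0 < x \<Longrightarrow> x \<le> x0 \<Longrightarrow> c - r < t \<Longrightarrow> t < c + r \<Longrightarrow>
               \<bar>zx x t - a x t * z2 x t\<bar> \<le> E"
    and bd: "\<And>x t. x0 - r\<^sup>2/a0 \<le> x \<Longrightarrow> x \<le> x0 \<Longrightarrow> c - r \<le> t \<Longrightarrow> t \<le> c + r \<Longrightarrow> \<bar>z x t\<bar> \<le> M"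
  shows "\<bar>z1 x0 c\<bar> \<le> M * (2 + 4 * a1 / a0) / r + E * r / a0"
proof -
  define L where "L = M * (2 + 4 * a1 / a0) / r + E * r / a0"
  have T: "r\<^sup>2 / a0 > 0" using r a0 by simp
  have slope: "l \<le> L"
    if der: "(\<zeta> has_real_derivative l) (at c)"
      and ub: "\<And>k. 0 \<le> k \<Longrightarrow> k \<le> r \<Longrightarrow> \<zeta> (c + k) - \<zeta> c \<le> L * k + 2 * M / r\<^sup>2 * k\<^sup>2" for \<zeta> l
  proof -
    have "((\<lambda>k. (\<zeta> (c + k) - \<zeta> c) / k) \<longlongrightarrow> l) (at_right 0)"
      using der unfolding DERIV_def by (rule filterlim_mono) (auto simp: at_le)
    moreover have "((\<lambda>k. L + 2 * M / r\<^sup>2 * k) \<longlongrightarrow> L + 2 * M / r\<^sup>2 * 0) (at_right 0)"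
      by (intro tendsto_intros)
    moreover have "\<forall>\<^sub>F k in at_right 0. (\<zeta> (c + k) - \<zeta> c) / k \<le> L + 2 * M / r\<^sup>2 * k"
      unfolding eventually_at_right_field
    proof (intro exI[of _ r] conjI allI impI)
      fix k assume "0 < k" "k < r"
      then show "(\<zeta> (c + k) - \<zeta> c) / k \<le> L + 2 * M / r\<^sup>2 * k"
        using ub[of k] by (simp add: divide_le_eq algebra_simps power2_eq_square)
    qed (use r in auto)
    ultimately have "l \<le> L + 2 * M / r\<^sup>2 * 0"
      by (intro tendsto_le[OF trivial_limit_at_right_real])
    then show ?thesis by simp
  qed
  have "z1 x0 c \<le> L"
  proof (rule slope)
    show "(z x0 has_real_derivative z1 x0 c) (at c)" using D1[of x0 c] r T by auto
    show "z x0 (c + k) - z x0 c \<le> L * k + 2 * M / r\<^sup>2 * k\<^sup>2" if "0 \<le> k" "k \<le> r" for k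
      unfolding L_def by (rule local_lipschitz_upper[where a = a]) (fact | fact that)+
  qed
  moreover have "- z1 x0 c \<le> L"
  proof (rule slope)
    show "((\<lambda>t. - z x0 t) has_real_derivative - z1 x0 c) (at c)"
      using D1[of x0 c] r T by (auto intro: DERIV_minus)
    have e': "\<bar>- zx x t - a x t * - z2 x t\<bar> \<le> E"
      if "x0 - r\<^sup>2/a0 < x" "x \<le> x0" "c - r < t" "t < c + r" for x t
      using e[OF that] by (simp add: abs_minus_commute)
    have cont': "continuous_on ({x0 - r\<^sup>2/a0..x0} \<times> {c - r..c + r}) (\<lambda>(x,t). - z x t)"
      using cont by (simp add: split_def continuous_on_minus)
    show "- z x0 (c + k) - - z x0 c \<le> L * k + 2 * M / r\<^sup>2 * k\<^sup>2" if k: "0 \<le> k" "k \<le> r" for k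
      unfolding L_def
      by (rule local_lipschitz_upper[OF r a0 M E cont' DERIV_minus[OF Dx] DERIV_minus[OF D1] DERIV_minus[OF D2] a e' _ k])
         (use bd in auto)
  qed
  ultimately show ?thesis by (simp add: L_def)
qed

text \<open>The penalty \<open>\<epsilon> (t^2 + (2 A + 1) x)\<close> replaces a condition at
  infinity: its growth in \<open>x\<close> beats the diffusion of \<open>t^2\<close>, at most
  \<open>2 A\<close>. The coefficient may depend on the point and on the solutions, and a level
  \<open>\<eta>\<close> is allowed because one of the barriers is ordered initially only up to a
  small error.\<close>

lemma comparison_principle:
  fixes d dx d1 d2 :: "real \<Rightarrow> real \<Rightarrow> real" and A M \<eta> X :: real
  assumes cont: "continuous_on ({0..X} \<times> {0..}) (\<lambda>(x,t). d x t)"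
    and bd: "\<And>x t. 0 \<le> x \<Longrightarrow> x \<le> X \<Longrightarrow> 0 \<le> t \<Longrightarrow> d x t \<le> M"
    and init: "\<And>t. 0 \<le> t \<Longrightarrow> d 0 t \<le> \<eta>"
    and left: "\<And>x. 0 \<le> x \<Longrightarrow> x \<le> X \<Longrightarrow> d x 0 \<le> \<eta>"
    and Dx: "\<And>x t. 0 < x \<Longrightarrow> x \<le> X \<Longrightarrow> 0 < t \<Longrightarrow> ((\<lambda>s. d s t) has_real_derivative dx x t) (at x)"
    and D1: "\<And>x t. 0 < x \<Longrightarrow> x \<le> X \<Longrightarrow> 0 < t \<Longrightarrow> (d x has_real_derivative d1 x t) (at t)"
    and D2: "\<And>x t. 0 < x \<Longrightarrow> x \<le> X \<Longrightarrow> 0 < t \<Longrightarrow> (d1 x has_real_derivative d2 x t) (at t)"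
    and A: "A \<ge> 0"
    and op: "\<And>x t. 0 < x \<Longrightarrow> x \<le> X \<Longrightarrow> 0 < t \<Longrightarrow> d x t > \<eta> \<Longrightarrow>
               \<exists>a. 0 \<le> a \<and> a \<le> A \<and> dx x t \<le> a * d2 x t"
    and x: "0 \<le> x" "x \<le> X" and t: "0 \<le> t"
  shows "d x t \<le> \<eta>"
proof -
  have approx: "d x t \<le> \<eta> + \<epsilon> * (t\<^sup>2 + (2 * A + 1) * x)" if \<epsilon>: "\<epsilon> > 0" for \<epsilon>
  proof -
    \<comment> \<open>Beyond this height \<open>\<epsilon> R^2\<close> alone exceeds
      \<open>M - \<eta>\<close>, so the right side of the rectangle needs no information.\<close>
    define R where "R = max t (sqrt (\<bar>M - \<eta>\<bar> / \<epsilon>))"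
    have R: "t \<le> R" "R \<ge> 0" using t by (auto simp: R_def)
    have "(sqrt (\<bar>M - \<eta>\<bar> / \<epsilon>))\<^sup>2 \<le> R\<^sup>2" using \<epsilon> by (intro power_mono) (auto simp: R_def)
    then have R2: "M - \<eta> \<le> \<epsilon> * R\<^sup>2" using \<epsilon> by (simp add: divide_le_eq mult.commute)
    have "d x t - \<eta> - \<epsilon> * (t\<^sup>2 + (2 * A + 1) * x) \<le> 0"
    proof (rule rectangle_max_principle[where F = "\<lambda>x t. d x t - \<eta> - \<epsilon> * (t\<^sup>2 + (2 * A + 1) * x)"
          and Fx = "\<lambda>x t. dx x t - \<epsilon> * (2 * A + 1)" and ?F1.0 = "\<lambda>x t. d1 x t - \<epsilon> * (2 * t)"
          and ?F2.0 = "\<lambda>x t. d2 x t - \<epsilon> * 2" and ?x1.0 = 0 and ?x2.0 = X and \<alpha> = 0 and \<beta> = R])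
      have "continuous_on ({0..X} \<times> {0..R}) (\<lambda>(x,t). d x t)"
        by (rule continuous_on_subset[OF cont]) auto
      then show "continuous_on ({0..X} \<times> {0..R}) (\<lambda>(x, t). d x t - \<eta> - \<epsilon> * (t\<^sup>2 + (2 * A + 1) * x))"
        by (auto simp: split_def intro!: continuous_intros)
      show "d 0 s - \<eta> - \<epsilon> * (s\<^sup>2 + (2 * A + 1) * 0) \<le> 0" if "0 \<le> s" for s
      proof -
        have "\<epsilon> * s\<^sup>2 \<ge> 0" using \<epsilon> by simp
        then show ?thesis using init[OF that] by (simp del: mult_nonneg_nonneg)
      qed
      show "d y 0 - \<eta> - \<epsilon> * (0\<^sup>2 + (2 * A + 1) * y) \<le> 0" if "0 \<le> y" "y \<le> X" for y
      proof -
        have "\<epsilon> * ((2 * A + 1) * y) \<ge> 0" using that \<epsilon> A by simp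
        then show ?thesis using left[OF that] by simp
      qed
      show "d y R - \<eta> - \<epsilon> * (R\<^sup>2 + (2 * A + 1) * y) \<le> 0" if "0 \<le> y" "y \<le> X" for y
      proof -
        have "\<epsilon> * ((2 * A + 1) * y) \<ge> 0" using that \<epsilon> A by simp
        then show ?thesis using bd[OF that R(2)] R2 by (simp add: algebra_simps)
      qed
      fix y s assume ys: "0 < y" "y \<le> X" "0 < s" "s < R"
      show "((\<lambda>y. d y s - \<eta> - \<epsilon> * (s\<^sup>2 + (2 * A + 1) * y)) has_real_derivative dx y s - \<epsilon> * (2 * A + 1)) (at y)"
        using ys by (auto intro!: derivative_eq_intros Dx)
      show "((\<lambda>s. d y s - \<eta> - \<epsilon> * (s\<^sup>2 + (2 * A + 1) * y)) has_real_derivative d1 y s - \<epsilon> * (2 * s)) (at s)"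
        using ys by (auto intro!: derivative_eq_intros D1)
      show "((\<lambda>s. d1 y s - \<epsilon> * (2 * s)) has_real_derivative d2 y s - \<epsilon> * 2) (at s)"
        using ys by (auto intro!: derivative_eq_intros D2)
      assume F: "d y s - \<eta> - \<epsilon> * (s\<^sup>2 + (2 * A + 1) * y) > 0"
        and Fx: "dx y s - \<epsilon> * (2 * A + 1) \<ge> 0" and F2: "d2 y s - \<epsilon> * 2 \<le> 0"
      have "\<epsilon> * (s\<^sup>2 + (2 * A + 1) * y) \<ge> 0" using ys \<epsilon> A by simp
      then have "d y s > \<eta>" using F by linarith
      then obtain a where a: "0 \<le> a" "a \<le> A" "dx y s \<le> a * d2 y s" using op ys by blast
      have "a * d2 y s \<le> a * (\<epsilon> * 2)" using a F2 by (intro mult_left_mono) auto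
      also have "\<dots> \<le> A * (\<epsilon> * 2)" using a \<epsilon> by (intro mult_right_mono) auto
      finally show False using a Fx \<epsilon> by (simp add: algebra_simps)
    qed (use x t R in auto)
    then show ?thesis by simp
  qed
  define Q where "Q = t\<^sup>2 + (2 * A + 1) * x"
  have Q: "Q \<ge> 0" using x A by (simp add: Q_def)
  show ?thesis
  proof (rule field_le_epsilon)
    fix e :: real assume e: "e > 0"
    have "d x t \<le> \<eta> + e / (Q + 1) * Q" using approx[of "e / (Q + 1)"] e Q by (simp add: Q_def)
    also have "e / (Q + 1) * Q \<le> e" using e Q by (simp add: field_simps)
    finally show "d x t \<le> \<eta> + e" by simp
  qed
qed

text \<open>The diffusion may vanish like \<open>sqrt t\<close> and the zeroth-order coefficient may blow up like
  \<open>1/t\<close> at \<open>t = 0\<close>; the concavity of \<open>sqrt t\<close> in the barrier \<open>exp (K x) (sqrt t + t\<^sup>2)\<close> absorbs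
  both. Halving the constant in front of the barrier repeatedly yields the bound \<open>0\<close>.\<close>

lemma degenerate_comparison_principle:
  fixes d dx d1 d2 :: "real \<Rightarrow> real \<Rightarrow> real" and A B M X c :: real
  assumes cont: "continuous_on ({0..X} \<times> {0..}) (\<lambda>(x,t). d x t)"
    and bd: "\<And>x t. 0 \<le> x \<Longrightarrow> x \<le> X \<Longrightarrow> 0 \<le> t \<Longrightarrow> d x t \<le> M"
    and lin: "\<And>x t. 0 \<le> x \<Longrightarrow> x \<le> X \<Longrightarrow> 0 \<le> t \<Longrightarrow> d x t \<le> M * t"
    and M: "M > 0"
    and init: "\<And>t. 0 \<le> t \<Longrightarrow> d 0 t \<le> 0"
    and Dx: "\<And>x t. 0 < x \<Longrightarrow> x \<le> X \<Longrightarrow> 0 < t \<Longrightarrow> ((\<lambda>s. d s t) has_real_derivative dx x t) (at x)"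
    and D1: "\<And>x t. 0 < x \<Longrightarrow> x \<le> X \<Longrightarrow> 0 < t \<Longrightarrow> (d x has_real_derivative d1 x t) (at t)"
    and D2: "\<And>x t. 0 < x \<Longrightarrow> x \<le> X \<Longrightarrow> 0 < t \<Longrightarrow> (d1 x has_real_derivative d2 x t) (at t)"
    and A: "A \<ge> 0" and B: "B \<ge> 0" and c: "c > 0"
    and op: "\<And>x t. 0 < x \<Longrightarrow> x \<le> X \<Longrightarrow> 0 < t \<Longrightarrow> d x t > 0 \<Longrightarrow>
               \<exists>a b. 0 \<le> a \<and> a \<le> A \<and> (t \<le> 1 \<longrightarrow> c * sqrt t \<le> a) \<and> b \<le> B * (1 + 1 / t) \<and>
                     dx x t \<le> a * d2 x t + b * d x t"
    and x: "0 \<le> x" "x \<le> X" and t: "0 \<le> t"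
  shows "d x t \<le> 0"
proof -
  define \<beta> where "\<beta> t = sqrt t + t\<^sup>2" for t :: real
  \<comment> \<open>In terms of \<open>s = sqrt t\<close>: up to \<open>s0\<close> the concavity
    term \<open>c / (4 s^2)\<close> beats \<open>2 A + 8 B / s\<close>; above it the exponential
    rate \<open>K\<close> does.\<close>
  define s0 where "s0 = c / (8 * (8 * B + 2 * A + 1))"
  define K where "K = (2 * A + 8 * B + 1) / s0 ^ 3 + 2 * A + 4 * B + 1"
  have s0: "s0 > 0" using A B c by (simp add: s0_def)
  have K: "K > 0" "K \<ge> 2 * A + 4 * B + 1" "K * s0 ^ 3 \<ge> 2 * A + 8 * B + 1"
  proof -
    have q: "(2 * A + 8 * B + 1) / s0 ^ 3 \<ge> 0" using A B s0 by simp
    show "K > 0" "K \<ge> 2 * A + 4 * B + 1" using q A B by (simp_all add: K_def)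
    have "K * s0 ^ 3 = 2 * A + 8 * B + 1 + (2 * A + 4 * B + 1) * s0 ^ 3"
      using s0 by (simp add: K_def field_simps)
    moreover have "(2 * A + 4 * B + 1) * s0 ^ 3 \<ge> 0" using A B s0 by simp
    ultimately show "K * s0 ^ 3 \<ge> 2 * A + 8 * B + 1" by linarith
  qed
  have \<beta>0: "\<beta> t \<ge> 0" if "t \<ge> 0" for t using that by (simp add: \<beta>_def)
  \<comment> \<open>The factor 2 in front of the zeroth-order term is there because, in the halving
    step, \<open>d\<close> is known only to lie below twice the barrier under test.\<close>
  have barrier: "a * (2 - 1 / (4 * t * sqrt t)) + 2 * (B * (1 + 1 / t)) * \<beta> t < K * \<beta> t"
    if t: "t > 0" and a: "0 \<le> a" "a \<le> A" "t \<le> 1 \<longrightarrow> c * sqrt t \<le> a" for a t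
  proof (cases "t \<le> 1")
    case True
    define s where "s = sqrt t"
    have s: "s > 0" "s \<le> 1" and ts: "t = s\<^sup>2" using t True by (auto simp: s_def)
    have \<beta>s: "\<beta> t = s + s ^ 4" using s by (simp add: \<beta>_def ts power2_eq_square power4_eq_xxxx real_sqrt_mult)
    have ac: "c * s \<le> a" using a(3) True by (simp add: s_def)
    have cs: "a * (1 / (4 * t * sqrt t)) \<ge> c / (4 * s\<^sup>2)"
    proof -
      have "c * s * (1 / (4 * t * sqrt t)) \<le> a * (1 / (4 * t * sqrt t))"
        using ac t by (intro mult_right_mono) auto
      moreover have "c * s * (1 / (4 * t * sqrt t)) = c / (4 * s\<^sup>2)"
        using s by (simp add: ts)
      ultimately show ?thesis by simp
    qed
    have s41: "s ^ 4 \<le> s" using s power_decreasing[of 1 4 s] by simp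
    have s1: "s\<^sup>2 \<le> 1" using s by (simp add: power_le_one)
    have "2 * (B * (1 + 1 / t)) * \<beta> t \<le> 2 * (B * (2 / s\<^sup>2)) * (2 * s)"
    proof (intro mult_mono mult_left_mono)
      have "1 \<le> 1 / s\<^sup>2" using s s1 by simp
      then show "1 + 1 / t \<le> 2 / s\<^sup>2" by (simp add: ts)
      show "\<beta> t \<le> 2 * s" using s41 by (simp add: \<beta>s)
    qed (use B s t \<beta>0 in auto)
    also have "\<dots> = 8 * B / s" using s by (simp add: power2_eq_square)
    finally have "a * (2 - 1 / (4 * t * sqrt t)) + 2 * (B * (1 + 1 / t)) * \<beta> t
                  \<le> 2 * A - c / (4 * s\<^sup>2) + 8 * B / s"
      using cs a by (simp add: right_diff_distrib)
    also have "\<dots> < K * s"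
    proof (cases "s \<le> s0")
      case True
      have "(8 * B + 2 * A + 1) * s \<le> (8 * B + 2 * A + 1) * s0" using True A B by (intro mult_left_mono) auto
      also have "\<dots> = c / 8" using A B by (simp add: s0_def field_simps)
      finally have 1: "(8 * B + 2 * A + 1) * s \<le> c / 8" .
      have "2 * A * s\<^sup>2 \<le> 2 * A * s" using s A by (intro mult_left_mono) (auto simp: power2_eq_square)
      then have "2 * A * s\<^sup>2 + 8 * B * s < c / 4" using 1 s c by (simp add: algebra_simps)
      then have "2 * A - c / (4 * s\<^sup>2) + 8 * B / s < 0"
        using s by (simp add: field_simps power2_eq_square)
      moreover have "K * s > 0" using K s by simp
      ultimately show ?thesis by linarith
    next
      case False
      then have "s0 ^ 3 \<le> s ^ 3" using s0 by (intro power_mono) auto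
      then have "K * s0 ^ 3 \<le> K * s ^ 3" using K by simp
      then have 1: "2 * A + 8 * B + 1 \<le> K * s ^ 3" using K by linarith
      have "2 * A * s\<^sup>2 \<le> 2 * A * 1" using s1 A by (intro mult_left_mono) auto
      moreover have "8 * B * s \<le> 8 * B * 1" using s B by (intro mult_left_mono) auto
      ultimately have "2 * A * s\<^sup>2 + 8 * B * s < K * s ^ 3 + c / 4" using 1 c by linarith
      then show ?thesis using s by (simp add: field_simps power2_eq_square power3_eq_cube)
    qed
    also have "K * s \<le> K * \<beta> t" using K s by (simp add: \<beta>s)
    finally show ?thesis .
  next
    case False
    then have t1: "t > 1" by simp
    have "sqrt t \<ge> 1" "t\<^sup>2 \<ge> 1" using t1 by (auto simp: one_le_power)
    then have \<beta>2: "\<beta> t \<ge> 1" unfolding \<beta>_def by linarith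
    have "a * (2 - 1 / (4 * t * sqrt t)) \<le> a * 2"
      using a t by (intro mult_left_mono) auto
    then have "a * (2 - 1 / (4 * t * sqrt t)) \<le> A * 2" using a by linarith
    moreover have "2 * (B * (1 + 1 / t)) * \<beta> t \<le> 2 * (B * 2) * \<beta> t"
      using t1 B \<beta>2 by (intro mult_right_mono mult_left_mono) auto
    moreover have "A * 2 + 2 * (B * 2) * \<beta> t < (2 * A + 4 * B + 1) * \<beta> t"
    proof -
      have "A * 2 \<le> A * 2 * \<beta> t" using A \<beta>2 by (simp add: mult_le_cancel_left1)
      then show ?thesis using \<beta>2 by (simp add: algebra_simps)
    qed
    moreover have "(2 * A + 4 * B + 1) * \<beta> t \<le> K * \<beta> t" using K \<beta>2 by (intro mult_right_mono) auto
    ultimately show ?thesis by linarith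
  qed
  have half: "d x t \<le> m / 2 * exp (K * x) * \<beta> t"
    if m: "m > 0" and ub: "\<And>x t. 0 \<le> x \<Longrightarrow> x \<le> X \<Longrightarrow> 0 \<le> t \<Longrightarrow> d x t \<le> m * exp (K * x) * \<beta> t"
      and x: "0 \<le> x" "x \<le> X" and t: "0 \<le> t" for m x t
  proof -
    define R where "R = max t (sqrt (2 * M / m))"
    have R: "t \<le> R" "R \<ge> 0" using t by (auto simp: R_def)
    have "(sqrt (2 * M / m))\<^sup>2 \<le> R\<^sup>2" using M m by (intro power_mono) (auto simp: R_def)
    then have "2 * M \<le> m * R\<^sup>2" using m M by (simp add: divide_le_eq mult.commute)
    then have R2: "M \<le> m / 2 * \<beta> R" using m R by (simp add: \<beta>_def algebra_simps add_increasing)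
    have "d x t - m / 2 * exp (K * x) * \<beta> t \<le> 0"
    proof (rule rectangle_max_principle[where F = "\<lambda>x t. d x t - m / 2 * exp (K * x) * \<beta> t"
          and Fx = "\<lambda>x t. dx x t - m / 2 * (K * exp (K * x)) * \<beta> t"
          and ?F1.0 = "\<lambda>x t. d1 x t - m / 2 * exp (K * x) * (inverse (sqrt t) / 2 + 2 * t)"
          and ?F2.0 = "\<lambda>x t. d2 x t - m / 2 * exp (K * x) * (2 - 1 / (4 * t * sqrt t))"
          and ?x1.0 = 0 and ?x2.0 = X and \<alpha> = 0 and \<beta> = R])
      have "continuous_on ({0..X} \<times> {0..R}) (\<lambda>(x,t). d x t)"
        by (rule continuous_on_subset[OF cont]) auto
      then show "continuous_on ({0..X} \<times> {0..R}) (\<lambda>(x, t). d x t - m / 2 * exp (K * x) * \<beta> t)"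
        by (auto simp: split_def \<beta>_def intro!: continuous_intros)
      show "d 0 s - m / 2 * exp (K * 0) * \<beta> s \<le> 0" if "0 \<le> s" for s
        using init[OF that] \<beta>0[OF that] m by (simp add: add_increasing2 order_trans[of _ 0])
      show "d y 0 - m / 2 * exp (K * y) * \<beta> 0 \<le> 0" if "0 \<le> y" "y \<le> X" for y
        using lin[OF that, of 0] by (simp add: \<beta>_def)
      show "d y R - m / 2 * exp (K * y) * \<beta> R \<le> 0" if "0 \<le> y" "y \<le> X" for y
      proof -
        have "1 * (m / 2 * \<beta> R) \<le> exp (K * y) * (m / 2 * \<beta> R)"
          using that K m \<beta>0[OF R(2)] by (intro mult_right_mono) auto
        then show ?thesis using bd[OF that R(2)] R2 by (simp add: algebra_simps)
      qed
      fix y s assume ys: "0 < y" "y \<le> X" "0 < s" "s < R"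
      show "((\<lambda>y. d y s - m / 2 * exp (K * y) * \<beta> s) has_real_derivative dx y s - m / 2 * (K * exp (K * y)) * \<beta> s) (at y)"
        using ys by (auto intro!: derivative_eq_intros Dx)
      show "((\<lambda>s. d y s - m / 2 * exp (K * y) * \<beta> s) has_real_derivative
              d1 y s - m / 2 * exp (K * y) * (inverse (sqrt s) / 2 + 2 * s)) (at s)"
        unfolding \<beta>_def using ys by (auto intro!: derivative_eq_intros D1)
      have "((\<lambda>s. inverse (sqrt s) / 2 + 2 * s) has_real_derivative 2 - 1 / (4 * s * sqrt s)) (at s)"
        using ys by (auto intro!: derivative_eq_intros simp: field_simps)
      then show "((\<lambda>s. d1 y s - m / 2 * exp (K * y) * (inverse (sqrt s) / 2 + 2 * s)) has_real_derivative
              d2 y s - m / 2 * exp (K * y) * (2 - 1 / (4 * s * sqrt s))) (at s)"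
        using ys by (intro DERIV_diff D2 DERIV_cmult) auto
      define b0 where "b0 = m / 2 * exp (K * y)"
      have b0: "b0 > 0" using m by (simp add: b0_def)
      assume F: "d y s - m / 2 * exp (K * y) * \<beta> s > 0"
        and Fx: "dx y s - m / 2 * (K * exp (K * y)) * \<beta> s \<ge> 0"
        and F2: "d2 y s - m / 2 * exp (K * y) * (2 - 1 / (4 * s * sqrt s)) \<le> 0"
      have "b0 * \<beta> s \<ge> 0" using b0 \<beta>0[of s] ys by simp
      then have pos: "d y s > 0" using F by (simp add: b0_def)
      then obtain a b where ab: "0 \<le> a" "a \<le> A" "s \<le> 1 \<longrightarrow> c * sqrt s \<le> a" "b \<le> B * (1 + 1 / s)"
        "dx y s \<le> a * d2 y s + b * d y s" using op ys by blast
      have "a * d2 y s \<le> a * (b0 * (2 - 1 / (4 * s * sqrt s)))"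
        using ab F2 by (intro mult_left_mono) (auto simp: b0_def)
      moreover have "b * d y s \<le> B * (1 + 1 / s) * (2 * b0 * \<beta> s)"
      proof -
        have "b * d y s \<le> B * (1 + 1 / s) * d y s" using ab pos by (intro mult_right_mono) auto
        also have "\<dots> \<le> B * (1 + 1 / s) * (2 * b0 * \<beta> s)"
          using ub[of y s] ys B by (intro mult_left_mono) (auto simp: b0_def)
        finally show ?thesis .
      qed
      moreover have "b0 * (a * (2 - 1 / (4 * s * sqrt s)) + 2 * (B * (1 + 1 / s)) * \<beta> s) < b0 * (K * \<beta> s)"
        using barrier[OF ys(3) ab(1,2,3)] b0 by simp
      moreover have "b0 * (a * (2 - 1 / (4 * s * sqrt s)) + 2 * (B * (1 + 1 / s)) * \<beta> s)
           = a * (b0 * (2 - 1 / (4 * s * sqrt s))) + B * (1 + 1 / s) * (2 * b0 * \<beta> s)"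
        by algebra
      moreover have "m / 2 * (K * exp (K * y)) * \<beta> s = b0 * (K * \<beta> s)" by (simp add: b0_def)
      ultimately show False using ab(5) Fx by linarith
    qed (use x t R in auto)
    then show ?thesis by simp
  qed
  \<comment> \<open>The start \<open>n = 0\<close> combines \<open>bd\<close> and
    \<open>lin\<close>, since \<open>min t 1 \<le> \<beta> t\<close>.\<close>
  have iter: "\<forall>x t. 0 \<le> x \<longrightarrow> x \<le> X \<longrightarrow> 0 \<le> t \<longrightarrow> d x t \<le> M * (1/2) ^ n * exp (K * x) * \<beta> t" for n
  proof (induction n)
    case 0
    show ?case
    proof (intro allI impI)
      fix x t :: real assume xt: "0 \<le> x" "x \<le> X" "0 \<le> t"
      have "d x t \<le> M * \<beta> t"
      proof (cases "t \<le> 1")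
        case True
        have "t * t \<le> t" using True xt by (simp add: mult_left_le)
        then have "t \<le> sqrt t" using xt by (intro real_le_rsqrt) (simp add: power2_eq_square)
        then have "M * t \<le> M * \<beta> t" using M by (simp add: \<beta>_def add_increasing2)
        then show ?thesis using lin[OF xt] by simp
      next
        case False
        then have "1 \<le> t\<^sup>2" "0 \<le> sqrt t" by (auto simp: one_le_power)
        then have "1 \<le> \<beta> t" unfolding \<beta>_def by linarith
        then have "M * 1 \<le> M * \<beta> t" using M by (intro mult_left_mono) auto
        then show ?thesis using bd[OF xt] by simp
      qed
      also have "\<dots> = 1 * (M * \<beta> t)" by simp
      also have "\<dots> \<le> exp (K * x) * (M * \<beta> t)"
        using K xt M \<beta>0[OF xt(3)] by (intro mult_right_mono) auto
      finally show "d x t \<le> M * (1/2) ^ 0 * exp (K * x) * \<beta> t" by (simp add: mult_ac)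
    qed
  next
    case (Suc n)
    show ?case using half[of "M * (1/2) ^ n"] Suc M by simp
  qed
  have "(\<lambda>n. M * (1/2) ^ n * exp (K * x) * \<beta> t) \<longlonglongrightarrow> M * 0 * exp (K * x) * \<beta> t"
    by (intro tendsto_intros LIMSEQ_realpow_zero) auto
  then show ?thesis
    by (intro tendsto_lowerbound[where f = "\<lambda>n. M * (1/2) ^ n * exp (K * x) * \<beta> t"]) (use iter x t in auto)
qed

section \<open>Calculus on the half line\<close>

text \<open>\<open>g\<close> is the limit of its averages over intervals of dyadic length \<open>k n\<close>, whose derivatives are the difference
  quotients \<open>D n\<close>; consecutive ones differ by a second difference and hence converge uniformly.\<close>

lemma second_difference_differentiable:
  fixes g :: "real \<Rightarrow> real"
  assumes \<theta>: "\<theta> > 0" and \<rho>: "\<rho> > 0" and cont: "continuous_on {x0 - 2 * \<rho>..x0 + 2 * \<rho>} g"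
    and sd: "\<And>x k. \<bar>x - x0\<bar> < \<rho> \<Longrightarrow> 0 < k \<Longrightarrow> k < \<rho> \<Longrightarrow>
               \<bar>g (x + k) + g (x - k) - 2 * g x\<bar> \<le> K * k powr (1 + \<theta>)"
  shows "\<exists>D. (g has_real_derivative D) (at x0)"
proof -
  define k where "k n = \<rho> / 2 * (1/2) ^ n" for n :: nat
  define \<Gamma> where "\<Gamma> x = integral {x0 - 2 * \<rho>..x} g" for x
  define D where "D n x = (g (x + k n) - g x) / k n" for n x
  define \<gamma> where "\<gamma> n x = (\<Gamma> (x + k n) - \<Gamma> x) / k n" for n x
  define S where "S = {x0 - \<rho> / 2<..<x0 + \<rho> / 2}"
  have k: "k n > 0" "k n \<le> \<rho> / 2" "k (Suc n) = k n / 2" for n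
  proof -
    show "k n > 0" "k (Suc n) = k n / 2" using \<rho> by (simp_all add: k_def)
    have "(1/2::real) ^ n \<le> 1" by (rule power_le_one) auto
    then have "\<rho> / 2 * (1/2) ^ n \<le> \<rho> / 2 * 1" using \<rho> by (intro mult_left_mono) auto
    then show "k n \<le> \<rho> / 2" by (simp add: k_def)
  qed
  have \<Gamma>': "(\<Gamma> has_real_derivative g x) (at x)" if "x0 - 2 * \<rho> < x" "x < x0 + 2 * \<rho>" for x
  proof -
    have "(\<Gamma> has_real_derivative g x) (at x within {x0 - 2 * \<rho>..x0 + 2 * \<rho>})"
      unfolding \<Gamma>_def by (rule integral_has_real_derivative[OF cont]) (use that in auto)
    moreover have "at x within {x0 - 2 * \<rho>..x0 + 2 * \<rho>} = at x"
      by (rule at_within_interior) (use that in auto)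
    ultimately show ?thesis by simp
  qed
  have \<gamma>': "(\<gamma> n has_real_derivative D n x) (at x)" if "x \<in> S" for n x
  proof -
    have "((\<lambda>x. \<Gamma> (x + k n)) has_real_derivative g (x + k n)) (at x)"
      using \<Gamma>'[of "x + k n"] that k[of n] \<rho> by (simp add: S_def DERIV_shift)
    then show ?thesis unfolding \<gamma>_def D_def
      using \<Gamma>'[of x] that \<rho> by (intro DERIV_cdivide DERIV_diff) (auto simp: S_def)
  qed
  have \<gamma>lim: "(\<lambda>n. \<gamma> n x) \<longlonglongrightarrow> g x" if "x \<in> S" for x
  proof -
    have "((\<lambda>h. (\<Gamma> (x + h) - \<Gamma> x) / h) \<longlongrightarrow> g x) (at 0)"
      using \<Gamma>'[of x] that \<rho> by (simp add: S_def DERIV_def)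
    moreover have "filterlim k (at 0) sequentially"
    proof (rule filterlim_atI)
      have "k \<longlonglongrightarrow> \<rho> / 2 * 0" unfolding k_def by (intro tendsto_intros LIMSEQ_realpow_zero) auto
      then show "k \<longlonglongrightarrow> 0" by simp
      show "\<forall>\<^sub>F n in sequentially. k n \<noteq> 0" using k(1) by (auto simp: less_imp_neq[symmetric])
    qed
    ultimately show ?thesis unfolding \<gamma>_def by (rule filterlim_compose)
  qed
  have "\<bar>D (Suc n) x - D n x\<bar> \<le> K / 2 * (k (Suc n)) powr \<theta>" if "x \<in> S" for n x
  proof -
    define h where "h = k (Suc n)"
    have h: "h > 0" "h \<le> \<rho> / 4" "k n = 2 * h" using k[of n] by (auto simp: h_def k(3))
    have "D (Suc n) x - D n x = - (g (x + h + h) + g (x + h - h) - 2 * g (x + h)) / (2 * h)"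
      unfolding D_def h(3) h_def[symmetric] using h(1) by (simp add: field_simps)
    then have "\<bar>D (Suc n) x - D n x\<bar> = \<bar>g (x + h + h) + g (x + h - h) - 2 * g (x + h)\<bar> / (2 * h)"
      using h(1) by (simp add: abs_minus_commute)
    also have "\<dots> \<le> K * h powr (1 + \<theta>) / (2 * h)"
      using h that \<rho> by (intro divide_right_mono sd) (auto simp: S_def)
    also have "\<dots> = K / 2 * h powr \<theta>" using h(1) by (simp add: powr_add)
    finally show ?thesis by (simp add: h_def)
  qed
  then have unif: "uniform_limit S (\<lambda>n x. \<Sum>i<n. D (Suc i) x - D i x) (\<lambda>x. \<Sum>i. D (Suc i) x - D i x) sequentially"
  proof (intro Weierstrass_m_test)
    have eq: "(k (Suc n)) powr \<theta> = (\<rho> / 4) powr \<theta> * ((1/2) powr \<theta>) ^ n" for n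
    proof -
      have "k (Suc n) powr \<theta> = (\<rho> / 4 * (1/2) ^ n) powr \<theta>" by (simp add: k_def)
      also have "\<dots> = (\<rho> / 4) powr \<theta> * ((1/2) ^ n) powr \<theta>" by (rule powr_mult)
      also have "((1/2::real) ^ n) powr \<theta> = ((1/2) powr \<theta>) ^ n"
        by (simp add: powr_powr mult.commute flip: powr_realpow)
      finally show ?thesis .
    qed
    have "norm ((1/2::real) powr \<theta>) < 1"
      using powr_less_mono2[OF \<theta>, of "1/2" 1]
      by (simp only: real_norm_def abs_of_nonneg powr_ge_zero powr_one_eq_one)
    then have "summable (\<lambda>n. K / 2 * ((\<rho> / 4) powr \<theta> * ((1/2) powr \<theta>) ^ n))"
      by (rule summable_mult[OF summable_mult[OF summable_geometric]])
    then show "summable (\<lambda>n. K / 2 * (k (Suc n)) powr \<theta>)" by (simp only: eq)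
  qed auto
  have x0: "x0 \<in> S" using \<rho> by (simp add: S_def)
  have sum0: "summable (\<lambda>n. \<gamma> (Suc n) x0 - \<gamma> n x0)"
    by (rule sums_summable[OF telescope_sums[OF \<gamma>lim[OF x0]]])
  have der: "((\<lambda>x. \<gamma> (Suc n) x - \<gamma> n x) has_real_derivative D (Suc n) x - D n x) (at x within S)"
    if "x \<in> S" for n x
    by (rule has_field_derivative_at_within[OF DERIV_diff[OF \<gamma>'[OF that] \<gamma>'[OF that]]])
  have "convex S" by (simp add: S_def)
  then have "\<exists>G. \<forall>x\<in>S. (\<lambda>n. \<gamma> (Suc n) x - \<gamma> n x) sums G x \<and>
      (G has_real_derivative (\<Sum>i. D (Suc i) x - D i x)) (at x within S)"
    by (rule has_field_derivative_series[OF _ der unif x0 sum0])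
  then obtain G where G: "\<And>x. x \<in> S \<Longrightarrow> (\<lambda>n. \<gamma> (Suc n) x - \<gamma> n x) sums G x"
      "\<And>x. x \<in> S \<Longrightarrow> (G has_real_derivative (\<Sum>i. D (Suc i) x - D i x)) (at x within S)"
    by blast
  have eq: "G x + \<gamma> 0 x = g x" if "x \<in> S" for x
    using sums_unique2[OF G(1)[OF that] telescope_sums[OF \<gamma>lim[OF that]]] by simp
  have S: "open S" by (simp add: S_def)
  have "((\<lambda>x. G x + \<gamma> 0 x) has_real_derivative (\<Sum>i. D (Suc i) x0 - D i x0) + D 0 x0) (at x0)"
    by (rule DERIV_add[OF G(2)[OF x0, unfolded at_within_open[OF x0 S]] \<gamma>'[OF x0]])
  then show ?thesis
    by (intro exI) (rule has_field_derivative_transform_within_open[OF _ S x0 eq])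
qed

section \<open>Inverses of increasing bijections of the half line\<close>

definition half_inverse :: "(real \<Rightarrow> real) \<Rightarrow> real \<Rightarrow> real" where
  "half_inverse F t = (THE y. 0 \<le> y \<and> F y = t)"

text \<open>Serves both the stream functions \<open>\<Psi> x\<close> and the Blasius profile
  \<open>f\<close>; their inverses return the physical height belonging to a value of the stream
  function.\<close>

locale half_line_homeo =
  fixes F :: "real \<Rightarrow> real"
  assumes cont: "continuous_on {0..} F" and zero: "F 0 = 0"
    and mono: "\<And>y y'. 0 \<le> y \<Longrightarrow> y < y' \<Longrightarrow> F y < F y'"
    and unbounded: "filterlim F at_top at_top"
begin

lemma le_iff: "0 \<le> y \<Longrightarrow> 0 \<le> y' \<Longrightarrow> F y \<le> F y' \<longleftrightarrow> y \<le> y'"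
  using mono[of y y'] mono[of y' y] by (cases y y' rule: linorder_cases) auto

lemma less_iff: "0 \<le> y \<Longrightarrow> 0 \<le> y' \<Longrightarrow> F y < F y' \<longleftrightarrow> y < y'"
  using le_iff[of y' y] by auto

lemma inverse_of: "0 \<le> y \<Longrightarrow> half_inverse F (F y) = y"
  unfolding half_inverse_def by (rule the_equality) (simp, metis le_iff order_antisym order_refl)

lemma inverse:
  assumes "0 \<le> t" shows "0 \<le> half_inverse F t" "F (half_inverse F t) = t"
proof -
  obtain b where b: "b \<ge> 0" "F b \<ge> t"
    using unbounded unfolding filterlim_at_top eventually_at_top_linorder
    by (metis linorder_linear max.cobounded1 max.cobounded2)
  have "\<exists>y\<ge>0. y \<le> b \<and> F y = t"
    by (rule IVT'[of F 0 t b]) (use b assms zero in \<open>auto intro: continuous_on_subset[OF cont]\<close>)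
  then show "0 \<le> half_inverse F t" "F (half_inverse F t) = t" using inverse_of by auto
qed

lemma inverse_zero [simp]: "half_inverse F 0 = 0"
  using inverse_of[of 0] zero by simp

lemma inverse_pos: "0 < t \<Longrightarrow> 0 < half_inverse F t"
  using inverse[of t] zero by (metis less_eq_real_def order_less_irrefl)

lemma inverse_le_iff: "0 \<le> t \<Longrightarrow> 0 \<le> t' \<Longrightarrow> half_inverse F t \<le> half_inverse F t' \<longleftrightarrow> t \<le> t'"
  using inverse le_iff by metis

lemma inverse_has_derivative:
  assumes t: "t > 0" and F': "(F has_real_derivative l) (at (half_inverse F t))" and l: "l \<noteq> 0"
  shows "(half_inverse F has_real_derivative inverse l) (at t)"
proof (rule DERIV_inverse_function[where f = F and a = "t / 2" and b = "t + 1"])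
  define y where "y = half_inverse F t"
  have y: "y > 0" "F y = t" using inverse_pos inverse t by (auto simp: y_def)
  have "isCont (half_inverse F) (F y)"
  proof (rule isCont_inverse_function[where d = "y / 2" and f = F])
    show "isCont F z" if "\<bar>z - y\<bar> \<le> y / 2" for z
    proof (rule continuous_on_interior[OF cont])
      have "z > 0" using that y(1) by (smt (verit) field_sum_of_halves)
      then show "z \<in> interior {0..}" by simp
    qed
    show "half_inverse F (F z) = z" if "\<bar>z - y\<bar> \<le> y / 2" for z
      by (rule inverse_of) (use that y(1) in \<open>smt (verit) field_sum_of_halves\<close>)
  qed (use y in auto)
  then show "isCont (half_inverse F) t" using y by simp
qed (use assms inverse in auto)

end

text \<open>For fixed \<open>b \<ge> 0\<close>, whether the inverse at \<open>(x, t)\<close> lies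
  above or below \<open>b\<close> is decided by the sign of \<open>F x b - t\<close>, which is
  continuous in \<open>(x, t)\<close>; hence both order conditions are open. A negative
  \<open>b\<close> lies below every value.\<close>

lemma continuous_on_half_inverse:
  fixes F :: "real \<Rightarrow> real \<Rightarrow> real"
  assumes cont: "continuous_on (S \<times> {0..}) (\<lambda>(x,y). F x y)"
    and homeo: "\<And>x. x \<in> S \<Longrightarrow> half_line_homeo (F x)"
  shows "continuous_on (S \<times> {0..}) (\<lambda>(x,t). half_inverse (F x) t)"
  unfolding continuous_on_def
proof (intro ballI)
  fix q :: "real \<times> real" assume q: "q \<in> S \<times> {0..}"
  obtain x0 t0 where q': "q = (x0, t0)" by force
  define y0 where "y0 = half_inverse (F x0) t0"
  interpret h0: half_line_homeo "F x0" using q q' homeo by auto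
  have y0: "y0 \<ge> 0" "F x0 y0 = t0" using h0.inverse[of t0] q q' by (auto simp: y0_def)
  have lim: "((\<lambda>(x,t). F x y - t) \<longlongrightarrow> F x0 y - t0) (at q within S \<times> {0..})" if "y \<ge> 0" for y
  proof -
    have "continuous_on (S \<times> {0..}) (\<lambda>q. (\<lambda>(x,y). F x y) (fst q, y))"
      by (rule continuous_on_compose2[OF cont]) (use that in \<open>auto intro!: continuous_intros\<close>)
    then have "continuous_on (S \<times> {0..}) (\<lambda>(x,t). F x y - t)"
      by (auto simp: split_def intro!: continuous_intros)
    then show ?thesis using q q' unfolding continuous_on_def by fastforce
  qed
  have mem: "\<forall>\<^sub>F r in at q within S \<times> {0..}. r \<in> S \<times> {0..}" by (simp add: eventually_at_filter)
  have "((\<lambda>(x,t). half_inverse (F x) t) \<longlongrightarrow> y0) (at q within S \<times> {0..})"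
  proof (rule order_tendstoI)
    fix b assume b: "b < y0"
    show "\<forall>\<^sub>F r in at q within S \<times> {0..}. b < (case r of (x, t) \<Rightarrow> half_inverse (F x) t)"
    proof (cases "b < 0")
      case True
      show ?thesis using mem
      proof eventually_elim
        case (elim r)
        then show ?case using True half_line_homeo.inverse(1)[OF homeo] by (force split: prod.split)
      qed
    next
      case False
      have "F x0 b - t0 < 0" using h0.less_iff[of b y0] False b y0 by simp
      then have "\<forall>\<^sub>F r in at q within S \<times> {0..}. (case r of (x, t) \<Rightarrow> F x b - t) < 0"
        using order_tendstoD(2)[OF lim] False by auto
      then show ?thesis using mem
      proof eventually_elim
        case (elim r)
        obtain x t where r: "r = (x, t)" by force
        interpret h: half_line_homeo "F x" using elim r homeo by auto
        have "F x b < F x (half_inverse (F x) t)" using elim r h.inverse(2)[of t] by auto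
        then show ?case using h.less_iff[of b] h.inverse(1)[of t] elim r False by auto
      qed
    qed
  next
    fix b assume b: "y0 < b"
    have b0: "b \<ge> 0" using b y0 by simp
    have "F x0 b - t0 > 0" using h0.less_iff[of y0 b] b b0 y0 by simp
    then have "\<forall>\<^sub>F r in at q within S \<times> {0..}. (case r of (x, t) \<Rightarrow> F x b - t) > 0"
      using order_tendstoD(1)[OF lim] b0 by auto
    then show "\<forall>\<^sub>F r in at q within S \<times> {0..}. (case r of (x, t) \<Rightarrow> half_inverse (F x) t) < b"
      using mem
    proof eventually_elim
      case (elim r)
      obtain x t where r: "r = (x, t)" by force
      interpret h: half_line_homeo "F x" using elim r homeo by auto
      have "F x (half_inverse (F x) t) < F x b" using elim r h.inverse(2)[of t] by auto
      then show ?case using h.less_iff[of _ b] h.inverse(1)[of t] elim r b0 by auto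
    qed
  qed
  then show "((\<lambda>(x,t). half_inverse (F x) t) \<longlongrightarrow> (case q of (x, t) \<Rightarrow> half_inverse (F x) t)) (at q within S \<times> {0..})"
    by (simp add: q' y0_def)
qed

section \<open>Mean values, monotonicity and concavity on the half line\<close>

lemma mvt_open:
  fixes f :: "real \<Rightarrow> real"
  assumes "a < b" "continuous_on {a..b} f"
    and "\<And>x. a < x \<Longrightarrow> x < b \<Longrightarrow> (f has_real_derivative f' x) (at x)"
  obtains z where "a < z" "z < b" "f b - f a = (b - a) * f' z"
proof -
  have "\<exists>l z. a < z \<and> z < b \<and> DERIV f z :> l \<and> f b - f a = (b - a) * l"
    by (rule MVT) (use assms real_differentiable_def in blast)+
  then show ?thesis using that assms(3) DERIV_unique by metis
qed

lemma deriv_pos_strict: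
  fixes f :: "real \<Rightarrow> real"
  assumes "a < b" "continuous_on {a..b} f"
    and "\<And>x. a < x \<Longrightarrow> x < b \<Longrightarrow> (f has_real_derivative f' x) (at x)" "\<And>x. a < x \<Longrightarrow> x < b \<Longrightarrow> 0 < f' x"
  shows "f a < f b"
proof -
  obtain z where "a < z" "z < b" "f b - f a = (b - a) * f' z"
    by (rule mvt_open[OF assms(1,2,3)])
  moreover from this have "0 < (b - a) * f' z" using assms(1,4) by (intro mult_pos_pos) auto
  ultimately show ?thesis by linarith
qed

lemma deriv_nonneg_mono:
  fixes f :: "real \<Rightarrow> real"
  assumes "a \<le> b" "continuous_on {a..b} f"
    and "\<And>x. a < x \<Longrightarrow> x < b \<Longrightarrow> (f has_real_derivative f' x) (at x)" "\<And>x. a < x \<Longrightarrow> x < b \<Longrightarrow> 0 \<le> f' x"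
  shows "f a \<le> f b"
proof (cases "a = b")
  case False
  then obtain z where "a < z" "z < b" "f b - f a = (b - a) * f' z"
    using mvt_open[of a b f f'] assms by auto
  moreover from this have "0 \<le> (b - a) * f' z" using assms(1,4) by (intro mult_nonneg_nonneg) auto
  ultimately show ?thesis by linarith
qed simp

lemma deriv_nonpos_antimono:
  fixes f :: "real \<Rightarrow> real"
  assumes "a \<le> b" "continuous_on {a..b} f"
    and "\<And>x. a < x \<Longrightarrow> x < b \<Longrightarrow> (f has_real_derivative f' x) (at x)" "\<And>x. a < x \<Longrightarrow> x < b \<Longrightarrow> f' x \<le> 0"
  shows "f b \<le> f a"
proof -
  have "- f a \<le> - f b"
    by (rule deriv_nonneg_mono[where f' = "\<lambda>x. - f' x"])
       (use assms in \<open>auto intro!: continuous_on_minus DERIV_minus\<close>)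
  then show ?thesis by simp
qed

lemma half_line_derivative:
  fixes F :: "real \<Rightarrow> real"
  assumes "\<And>y. 0 \<le> y \<Longrightarrow> (F has_real_derivative F' y) (at y within {0..})"
  shows "continuous_on {0..} F" "0 < y \<Longrightarrow> (F has_real_derivative F' y) (at y)"
proof -
  show "continuous_on {0..} F"
    using assms by (auto simp: continuous_on_eq_continuous_within intro: DERIV_continuous)
  assume y: "0 < y"
  have "at y within {0..} = at y" by (rule at_within_interior) (use y in simp)
  then show "(F has_real_derivative F' y) (at y)" using assms[of y] y by simp
qed

text \<open>Used for \<open>\<Omega>\<close>, for \<open>w x\<close> and for \<open>u x\<close>.
  Derivatives are required only off zero because the passage to von Mises variables divides by a
  velocity that vanishes at the wall.\<close>

locale concave_from_zero =
  fixes F F1 F2 :: "real \<Rightarrow> real"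
  assumes cont: "continuous_on {0..} F" and zero: "F 0 = 0"
    and D1: "\<And>t. 0 < t \<Longrightarrow> (F has_real_derivative F1 t) (at t)"
    and D2: "\<And>t. 0 < t \<Longrightarrow> (F1 has_real_derivative F2 t) (at t)"
    and neg: "\<And>t. 0 < t \<Longrightarrow> F2 t \<le> 0"
begin

lemma slope_antimono:
  assumes "0 < s" "s \<le> t" shows "F1 t \<le> F1 s"
proof (rule deriv_nonpos_antimono[OF assms(2)])
  show "continuous_on {s..t} F1"
    by (rule continuous_at_imp_continuous_on) (use assms in \<open>auto intro!: DERIV_isCont D2\<close>)
qed (use assms in \<open>auto intro!: D2 neg\<close>)

lemma mvt:
  assumes "0 \<le> s" "s < t" obtains z where "s < z" "z < t" "F t - F s = (t - s) * F1 z"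
  by (rule mvt_open[OF assms(2) continuous_on_subset[OF cont]]) (use assms D1 in auto)

lemma slope_le: assumes "0 < t" shows "t * F1 t \<le> F t"
proof -
  obtain z where z: "0 < z" "z < t" "F t - F 0 = (t - 0) * F1 z"
    using mvt[OF order_refl assms] .
  have "t * F1 t \<le> t * F1 z" using z assms by (intro mult_left_mono slope_antimono) auto
  then show ?thesis using z zero by simp
qed

lemma ratio: assumes "0 < s" "s \<le> t" shows "s * F t \<le> t * F s"
proof (cases "s = t")
  case False
  then have st: "s < t" using assms by simp
  obtain z where z: "s < z" "z < t" "F t - F s = (t - s) * F1 z"
    using mvt[of s t] assms st by auto
  have "s * F1 z \<le> s * F1 s" using z assms by (intro mult_left_mono slope_antimono) auto
  also have "\<dots> \<le> F s" by (rule slope_le) fact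
  finally have "(t - s) * (s * F1 z) \<le> (t - s) * F s" using st by (intro mult_left_mono) auto
  then have "s * (F t - F s) \<le> (t - s) * F s" unfolding z(3) by (simp add: mult_ac)
  then show ?thesis by (simp add: algebra_simps)
qed simp

text \<open>A negative slope can only decrease further, so the function would fall at least
  linearly; \<open>b\<close> is placed where the drop exceeds the distance to the lower bound by
  1.\<close>

lemma slope_nonneg:
  assumes lb: "\<And>t. 0 < t \<Longrightarrow> m \<le> F t" and t: "0 < t" shows "0 \<le> F1 t"
proof (rule ccontr)
  assume "\<not> 0 \<le> F1 t"
  then have neg': "F1 t < 0" by simp
  define b where "b = t + (\<bar>F t - m\<bar> + 1) / (- F1 t)"
  have b: "t < b" using neg' by (simp add: b_def divide_pos_neg)
  obtain z where z: "t < z" "z < b" "F b - F t = (b - t) * F1 z"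
    using mvt[of t b] t b by auto
  have "(b - t) * F1 z \<le> (b - t) * F1 t" using z t b by (intro mult_left_mono slope_antimono) auto
  also have "\<dots> = - (\<bar>F t - m\<bar> + 1)" using neg' by (simp add: b_def)
  finally show False using z lb[of b] b t by auto
qed

end

lemma gaussian_upper_extend:
  fixes h :: "real \<Rightarrow> real"
  assumes \<kappa>: "\<kappa> > 0" and M: "\<And>z. 0 \<le> z \<Longrightarrow> h z \<le> M" and ev: "\<forall>\<^sub>F z in at_top. h z \<le> c * exp (- \<kappa> * z\<^sup>2)"
  shows "\<exists>K>0. \<forall>z\<ge>0. h z \<le> K * exp (- \<kappa> * z\<^sup>2)"
proof -
  obtain Z0 where "\<And>z. z \<ge> Z0 \<Longrightarrow> h z \<le> c * exp (- \<kappa> * z\<^sup>2)"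
    using ev by (auto simp: eventually_at_top_linorder)
  then obtain Z where Z: "Z \<ge> 0" "\<And>z. z \<ge> Z \<Longrightarrow> h z \<le> c * exp (- \<kappa> * z\<^sup>2)"
    by (metis max.bounded_iff max.cobounded1 max.cobounded2)
  define K where "K = \<bar>c\<bar> + \<bar>M\<bar> * exp (\<kappa> * Z\<^sup>2) + 1"
  have K: "K > 0" by (simp add: K_def add_nonneg_pos)
  have "h z \<le> K * exp (- \<kappa> * z\<^sup>2)" if z: "z \<ge> 0" for z
  proof (cases "z \<ge> Z")
    case True
    have "c * exp (- \<kappa> * z\<^sup>2) \<le> K * exp (- \<kappa> * z\<^sup>2)"
    proof (rule mult_right_mono)
      have "\<bar>M\<bar> * exp (\<kappa> * Z\<^sup>2) \<ge> 0" by simp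
      then show "c \<le> K" unfolding K_def by linarith
    qed simp
    then show ?thesis using Z(2)[OF True] by linarith
  next
    case False
    then have "z\<^sup>2 \<le> Z\<^sup>2" using z by (intro power_mono) auto
    then have "exp (- \<kappa> * Z\<^sup>2) \<le> exp (- \<kappa> * z\<^sup>2)" using \<kappa> by simp
    then have "K * exp (- \<kappa> * Z\<^sup>2) \<le> K * exp (- \<kappa> * z\<^sup>2)" using K by simp
    moreover have "\<bar>M\<bar> * exp (\<kappa> * Z\<^sup>2) * exp (- \<kappa> * Z\<^sup>2) = \<bar>M\<bar>" by (simp flip: exp_add)
    moreover have "\<bar>M\<bar> * exp (\<kappa> * Z\<^sup>2) * exp (- \<kappa> * Z\<^sup>2) \<le> K * exp (- \<kappa> * Z\<^sup>2)"
      by (intro mult_right_mono) (auto simp: K_def)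
    ultimately show ?thesis using M[OF z] by linarith
  qed
  then show ?thesis using K by blast
qed

section \<open>The Blasius profile\<close>

locale blasius_profile =
  fixes f f1 f2 f3 :: "real \<Rightarrow> real" and C1 C2 :: real
  assumes bl: "blasius f f1 f2 f3" and C1_pos: "C1 > 0"
    and asym1: "(\<lambda>z. 1 - f1 z) \<in> \<Theta>[at_top](\<lambda>z. exp (- C1 * z\<^sup>2 - C2 * z) / z)"
    and asym2: "f2 \<in> \<Theta>[at_top](\<lambda>z. exp (- C1 * z\<^sup>2 - C2 * z))"
begin

section \<open>Sign, monotonicity and tails of the profile\<close>

lemma f_derivs_within:
  assumes "0 \<le> z"
  shows "(f has_real_derivative f1 z) (at z within {0..})"
    "(f1 has_real_derivative f2 z) (at z within {0..})"
    "(f2 has_real_derivative f3 z) (at z within {0..})"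
  using bl assms by (auto simp: blasius_def)

lemma cont_f: "continuous_on {0..} f" and cont_f1: "continuous_on {0..} f1" and cont_f2: "continuous_on {0..} f2"
  using half_line_derivative(1) f_derivs_within by blast+

lemma df: "0 < z \<Longrightarrow> (f has_real_derivative f1 z) (at z)"
  and df1: "0 < z \<Longrightarrow> (f1 has_real_derivative f2 z) (at z)"
  and df2: "0 < z \<Longrightarrow> (f2 has_real_derivative f3 z) (at z)"
  using half_line_derivative(2) f_derivs_within by blast+

lemma at_zero: "f 0 = 0" "f1 0 = 0" and f1_lim: "(f1 \<longlongrightarrow> 1) at_top"
  using bl by (auto simp: blasius_def)

lemma f3_eq: "0 \<le> z \<Longrightarrow> f3 z = - f z * f2 z / 2"
  using bl by (auto simp: blasius_def eq_neg_iff_add_eq_0 add.commute)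

text \<open>The Blasius equation is linear in \<open>f2\<close>: with the integrating factor
  \<open>exp (\<Phi> / 2)\<close>, where \<open>\<Phi>\<close> is the primitive of \<open>f\<close>,
  the product is constant.\<close>

lemma f2_formula:
  assumes "0 \<le> z" shows "\<exists>e>0. f2 z = f2 0 * e"
proof (cases "z = 0")
  case False
  then have z: "0 < z" using assms by simp
  define \<Phi> where "\<Phi> s = integral {0..s} f" for s
  have \<Phi>w: "(\<Phi> has_real_derivative f s) (at s within {0..z})" if "s \<in> {0..z}" for s
    unfolding \<Phi>_def
    by (rule integral_has_real_derivative[OF continuous_on_subset[OF cont_f] that]) auto
  have \<Phi>: "(\<Phi> has_real_derivative f s) (at s)" if "0 < s" "s < z" for s
  proof -
    have "at s within {0..z} = at s" by (rule at_within_interior) (use that in simp)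
    then show ?thesis using \<Phi>w[of s] that by simp
  qed
  have \<Phi>cont: "continuous_on {0..z} \<Phi>"
    using \<Phi>w unfolding continuous_on_eq_continuous_within by (blast intro: DERIV_continuous)
  obtain s where s: "0 < s" "s < z"
    "f2 z * exp (\<Phi> z / 2) - f2 0 * exp (\<Phi> 0 / 2)
     = (z - 0) * (f3 s * exp (\<Phi> s / 2) + f2 s * (exp (\<Phi> s / 2) * (f s / 2)))"
  proof (rule mvt_open[OF z])
    show "continuous_on {0..z} (\<lambda>z. f2 z * exp (\<Phi> z / 2))"
      by (intro continuous_intros \<Phi>cont continuous_on_subset[OF cont_f2]) auto
    show "((\<lambda>z. f2 z * exp (\<Phi> z / 2)) has_real_derivative
             f3 s * exp (\<Phi> s / 2) + f2 s * (exp (\<Phi> s / 2) * (f s / 2))) (at s)"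
      if "0 < s" "s < z" for s
      using that by (auto intro!: derivative_eq_intros df2 \<Phi>)
  qed
  have "f2 z * exp (\<Phi> z / 2) = f2 0"
    using s f3_eq[of s] by (simp add: \<Phi>_def algebra_simps)
  then have "f2 z = f2 0 * exp (- \<Phi> z / 2)" by (simp add: exp_minus field_simps)
  then show ?thesis by (intro exI[of _ "exp (- \<Phi> z / 2)"]) simp
qed (auto intro: exI[of _ 1])

text \<open>All values of \<open>f2\<close> share the sign of \<open>f2 0\<close>; a nonpositive
  sign would keep \<open>f1\<close> at or below 0, against its limit 1.\<close>

lemma f2_pos: assumes "0 \<le> z" shows "0 < f2 z"
proof -
  have "f2 0 > 0"
  proof (rule ccontr)
    assume "\<not> f2 0 > 0"
    then have np: "f2 z \<le> 0" if "0 \<le> z" for z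
      using f2_formula[OF that] by (auto simp: mult_nonpos_nonneg)
    have "f1 z \<le> 0" if "0 \<le> z" for z
      using deriv_nonpos_antimono[OF that, of f1 f2] df1 np at_zero
        continuous_on_subset[OF cont_f1, of "{0..z}"] by auto
    then have "\<forall>\<^sub>F z in at_top. f1 z \<le> 0" by (rule eventually_mono[OF eventually_ge_at_top[of 0]])
    then have "1 \<le> (0::real)" by (rule tendsto_upperbound[OF f1_lim]) simp
    then show False by simp
  qed
  then show ?thesis using f2_formula[OF assms] by auto
qed

lemma f1_strict: assumes "0 \<le> y" "y < z" shows "f1 y < f1 z"
  by (rule deriv_pos_strict[OF assms(2), of f1 f2])
     (use assms df1 f2_pos continuous_on_subset[OF cont_f1, of "{y..z}"] in auto)

lemma f1_mono: "0 \<le> y \<Longrightarrow> y \<le> z \<Longrightarrow> f1 y \<le> f1 z"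
  using f1_strict[of y z] by (cases "y = z") auto

lemma f1_pos: "0 < z \<Longrightarrow> 0 < f1 z" using f1_strict[of 0 z] at_zero by simp

lemma f1_nonneg: "0 \<le> z \<Longrightarrow> 0 \<le> f1 z" using f1_mono[of 0 z] at_zero by simp

lemma f1_less_one: assumes "0 \<le> z" shows "f1 z < 1"
proof -
  have "\<forall>\<^sub>F y in at_top. f1 (z + 1) \<le> f1 y"
    using eventually_ge_at_top[of "z + 1"] by eventually_elim (use assms f1_mono in auto)
  then have "f1 (z + 1) \<le> 1" by (rule tendsto_lowerbound[OF f1_lim]) simp
  then show ?thesis using f1_strict[of z "z + 1"] assms by simp
qed

lemma f_strict: assumes "0 \<le> y" "y < z" shows "f y < f z"
  by (rule deriv_pos_strict[OF assms(2), of f f1])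
     (use assms df f1_pos continuous_on_subset[OF cont_f, of "{y..z}"] in auto)

lemma f_nonneg: "0 \<le> z \<Longrightarrow> 0 \<le> f z"
  using f_strict[of 0 z] at_zero by (cases "z = 0") auto

lemma f_le: assumes "0 \<le> z" shows "f z \<le> z"
proof (cases "z = 0")
  case False
  then obtain s where "0 < s" "s < z" "f z - f 0 = (z - 0) * f1 s"
    using mvt_open[of 0 z f f1] assms df continuous_on_subset[OF cont_f, of "{0..z}"] by auto
  then show ?thesis using f1_less_one[of s] at_zero assms by (simp add: mult_left_le)
qed (use at_zero in simp)

lemma f2_antimono: assumes "0 \<le> y" "y \<le> z" shows "f2 z \<le> f2 y"
proof (rule deriv_nonpos_antimono[OF assms(2), of f2 f3])
  show "f3 x \<le> 0" if "y < x" for x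
    using f3_eq[of x] f_nonneg[of x] f2_pos[of x] that assms(1) by (simp add: mult_nonneg_nonneg)
qed (use assms df2 continuous_on_subset[OF cont_f2, of "{y..z}"] in auto)

text \<open>Completing the square absorbs the linear term, whose sign is free, at the price of
  halving or doubling \<open>C1\<close>. From here on only pure Gaussians are used.\<close>

lemma gaussian_exponent:
  fixes z :: real
  shows "exp (- C1 * z\<^sup>2 - C2 * z) \<le> exp (C2\<^sup>2 / (2 * C1)) * exp (- (C1 / 2) * z\<^sup>2)"
    and "exp (- C2\<^sup>2 / (4 * C1)) * exp (- (2 * C1) * z\<^sup>2) \<le> exp (- C1 * z\<^sup>2 - C2 * z)"
proof -
  have "0 \<le> (C1 * z + C2)\<^sup>2 / (2 * C1)" "0 \<le> (2 * C1 * z - C2)\<^sup>2 / (4 * C1)" using C1_pos by simp_all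
  then have "- C1 * z\<^sup>2 - C2 * z \<le> C2\<^sup>2 / (2 * C1) + - (C1 / 2) * z\<^sup>2"
    "- C2\<^sup>2 / (4 * C1) + - (2 * C1) * z\<^sup>2 \<le> - C1 * z\<^sup>2 - C2 * z"
    using C1_pos by (simp_all add: field_simps power2_eq_square)
  then show "exp (- C1 * z\<^sup>2 - C2 * z) \<le> exp (C2\<^sup>2 / (2 * C1)) * exp (- (C1 / 2) * z\<^sup>2)"
    and "exp (- C2\<^sup>2 / (4 * C1)) * exp (- (2 * C1) * z\<^sup>2) \<le> exp (- C1 * z\<^sup>2 - C2 * z)"
    by (simp_all flip: exp_add)
qed

lemma f2_gaussian: "\<exists>K>0. \<forall>z\<ge>0. f2 z \<le> K * exp (- (C1 / 2) * z\<^sup>2)"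
proof -
  obtain c where c: "c > 0" "\<forall>\<^sub>F z in at_top. norm (f2 z) \<le> c * norm (exp (- C1 * z\<^sup>2 - C2 * z))"
    using landau_o.bigE[OF bigthetaD1[OF asym2]] by blast
  have ev: "\<forall>\<^sub>F z in at_top. f2 z \<le> (c * exp (C2\<^sup>2 / (2 * C1))) * exp (- (C1 / 2) * z\<^sup>2)"
    using c(2)
  proof eventually_elim
    case (elim z)
    have "c * exp (- C1 * z\<^sup>2 - C2 * z) \<le> c * (exp (C2\<^sup>2 / (2 * C1)) * exp (- (C1 / 2) * z\<^sup>2))"
      using c gaussian_exponent(1) by (intro mult_left_mono) auto
    then show ?case using elim by (simp add: mult.assoc)
  qed
  have bd: "f2 z \<le> f2 0" if "0 \<le> z" for z using f2_antimono that by simp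
  show ?thesis by (rule gaussian_upper_extend[OF _ bd ev]) (use C1_pos in auto)
qed

lemma f1_gaussian: "\<exists>K>0. \<forall>z\<ge>0. 1 - f1 z \<le> K * exp (- (C1 / 2) * z\<^sup>2)"
proof -
  obtain c where c: "c > 0" "\<forall>\<^sub>F z in at_top. norm (1 - f1 z) \<le> c * norm (exp (- C1 * z\<^sup>2 - C2 * z) / z)"
    using landau_o.bigE[OF bigthetaD1[OF asym1]] by blast
  have ev: "\<forall>\<^sub>F z in at_top. 1 - f1 z \<le> (c * exp (C2\<^sup>2 / (2 * C1))) * exp (- (C1 / 2) * z\<^sup>2)"
    using c(2) eventually_ge_at_top[of 1]
  proof eventually_elim
    case (elim z)
    have "exp (- C1 * z\<^sup>2 - C2 * z) / z \<le> exp (- C1 * z\<^sup>2 - C2 * z)"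
      using elim by (simp add: divide_le_eq mult_le_cancel_left1)
    also have "\<dots> \<le> exp (C2\<^sup>2 / (2 * C1)) * exp (- (C1 / 2) * z\<^sup>2)" by (rule gaussian_exponent)
    finally have "c * (exp (- C1 * z\<^sup>2 - C2 * z) / z) \<le> c * (exp (C2\<^sup>2 / (2 * C1)) * exp (- (C1 / 2) * z\<^sup>2))"
      using c by (intro mult_left_mono) auto
    then show ?case using elim by (simp add: mult.assoc)
  qed
  have bd: "1 - f1 z \<le> 1" if "0 \<le> z" for z using f1_nonneg that by simp
  show ?thesis by (rule gaussian_upper_extend[OF _ bd ev]) (use C1_pos in auto)
qed

text \<open>The factor \<open>1 / z\<close> costs one more \<open>C1\<close>, since
  \<open>exp (- 1 / (4 C1) - C1 z^2) \<le> exp (- z) \<le> 1 / z\<close>; together with the doubled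
  rate this gives \<open>3 C1\<close>.\<close>

lemma f1_gaussian_lower: "\<exists>k>0. \<forall>z\<ge>0. k * exp (- (3 * C1) * z\<^sup>2) \<le> 1 - f1 z"
proof -
  obtain c where c: "c > 0" "\<forall>\<^sub>F z in at_top. norm (1 - f1 z) \<ge> c * norm (exp (- C1 * z\<^sup>2 - C2 * z) / z)"
    using landau_omega.bigE[OF bigthetaD2[OF asym1]] by blast
  define c' where "c' = c * (exp (- C2\<^sup>2 / (4 * C1)) * exp (- 1 / (4 * C1)))"
  have c': "c' > 0" using c by (simp add: c'_def)
  have "\<forall>\<^sub>F z in at_top. c' * exp (- (3 * C1) * z\<^sup>2) \<le> 1 - f1 z"
    using c(2) eventually_ge_at_top[of 1]
  proof eventually_elim
    case (elim z)
    have "0 \<le> (2 * C1 * z - 1)\<^sup>2 / (4 * C1)" using C1_pos by simp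
    then have "- 1 / (4 * C1) - C1 * z\<^sup>2 \<le> - z" using C1_pos by (simp add: field_simps power2_eq_square)
    then have "exp (- 1 / (4 * C1) - C1 * z\<^sup>2) \<le> exp (- z)" by simp
    also have "\<dots> \<le> 1 / z"
    proof -
      have "z \<le> exp z" using exp_ge_add_one_self[of z] by linarith
      then show ?thesis using elim by (simp add: exp_minus field_simps)
    qed
    finally have 1: "exp (- 1 / (4 * C1) - C1 * z\<^sup>2) \<le> 1 / z" .
    have "c' * exp (- (3 * C1) * z\<^sup>2)
        = c * ((exp (- C2\<^sup>2 / (4 * C1)) * exp (- (2 * C1) * z\<^sup>2)) * exp (- 1 / (4 * C1) - C1 * z\<^sup>2))"
      by (simp add: c'_def algebra_simps flip: exp_add)
    also have "\<dots> \<le> c * (exp (- C1 * z\<^sup>2 - C2 * z) * (1 / z))"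
      using c 1 gaussian_exponent(2) by (intro mult_left_mono mult_mono) auto
    also have "\<dots> \<le> norm (1 - f1 z)" using elim by simp
    also have "\<dots> = 1 - f1 z" using f1_less_one[of z] elim by simp
    finally show ?case .
  qed
  then obtain Z0 where Z0: "\<And>z. z \<ge> Z0 \<Longrightarrow> c' * exp (- (3 * C1) * z\<^sup>2) \<le> 1 - f1 z"
    by (auto simp: eventually_at_top_linorder)
  define Z where "Z = max Z0 0"
  define k where "k = min c' (1 - f1 Z)"
  have k: "k > 0" using c' f1_less_one[of Z] by (simp add: k_def Z_def)
  have "k * exp (- (3 * C1) * z\<^sup>2) \<le> 1 - f1 z" if z: "z \<ge> 0" for z
  proof (cases "z \<ge> Z")
    case True
    have "k * exp (- (3 * C1) * z\<^sup>2) \<le> c' * exp (- (3 * C1) * z\<^sup>2)"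
      by (intro mult_right_mono) (auto simp: k_def)
    moreover have "c' * exp (- (3 * C1) * z\<^sup>2) \<le> 1 - f1 z" using Z0[of z] True by (simp add: Z_def)
    ultimately show ?thesis by linarith
  next
    case False
    have "k * exp (- (3 * C1) * z\<^sup>2) \<le> k * 1" using k C1_pos by (intro mult_left_mono) auto
    also have "\<dots> \<le> 1 - f1 Z" by (simp add: k_def)
    also have "\<dots> \<le> 1 - f1 z" using f1_mono[of z Z] z False by simp
    finally show ?thesis .
  qed
  then show ?thesis using k by blast
qed

text \<open>Finiteness of the displacement thickness, the integral of \<open>1 - f1\<close>. The
  Gaussian is first replaced by an exponential, whose primitive is explicit.\<close>

lemma f_lower: "\<exists>\<beta>>0. \<forall>z\<ge>0. z - \<beta> \<le> f z"
proof -
  define \<kappa> where "\<kappa> = C1 / 2"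
  have \<kappa>: "\<kappa> > 0" using C1_pos by (simp add: \<kappa>_def)
  obtain K where K: "K > 0" "\<And>z. z \<ge> 0 \<Longrightarrow> 1 - f1 z \<le> K * exp (- \<kappa> * z\<^sup>2)"
    using f1_gaussian by (auto simp: \<kappa>_def)
  define K' where "K' = K * exp (\<kappa> / 4)"
  have K': "K' > 0" using K by (simp add: K'_def)
  have ub: "1 - f1 z \<le> K' * exp (- \<kappa> * z)" if "z \<ge> 0" for z
  proof -
    have "0 \<le> \<kappa> * (z - 1/2)\<^sup>2" using \<kappa> by simp
    then have "- \<kappa> * z\<^sup>2 \<le> \<kappa> / 4 + - \<kappa> * z" by (simp add: power2_eq_square algebra_simps)
    then have "exp (- \<kappa> * z\<^sup>2) \<le> exp (\<kappa> / 4) * exp (- \<kappa> * z)" by (simp flip: exp_add)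
    then have "K * exp (- \<kappa> * z\<^sup>2) \<le> K * (exp (\<kappa> / 4) * exp (- \<kappa> * z))" using K by simp
    then show ?thesis using K(2)[OF that] by (simp add: K'_def mult.assoc)
  qed
  have "z - K' / \<kappa> \<le> f z" if z: "z \<ge> 0" for z
  proof -
    have "f 0 - 0 - K' / \<kappa> * exp (- \<kappa> * 0) \<le> f z - z - K' / \<kappa> * exp (- \<kappa> * z)"
    proof (rule DERIV_nonneg_imp_increasing_open[OF z])
      show "continuous_on {0..z} (\<lambda>z. f z - z - K' / \<kappa> * exp (- \<kappa> * z))"
        by (intro continuous_intros continuous_on_subset[OF cont_f]) auto
      fix s assume s: "0 < s" "s < z"
      have "((\<lambda>z. f z - z - K' / \<kappa> * exp (- \<kappa> * z)) has_real_derivative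
              (f1 s - 1 - K' / \<kappa> * (exp (- \<kappa> * s) * - \<kappa>))) (at s)"
        using s by (auto intro!: derivative_eq_intros df)
      moreover have "f1 s - 1 - K' / \<kappa> * (exp (- \<kappa> * s) * - \<kappa>) \<ge> 0"
        using ub[of s] s \<kappa> by simp
      ultimately show "\<exists>y. ((\<lambda>z. f z - z - K' / \<kappa> * exp (- \<kappa> * z)) has_real_derivative y) (at s) \<and> 0 \<le> y"
        by blast
    qed
    moreover have "K' / \<kappa> * exp (- \<kappa> * z) \<ge> 0" using K' \<kappa> by simp
    ultimately show ?thesis using at_zero by simp
  qed
  then show ?thesis using K' \<kappa> by (intro exI[of _ "K' / \<kappa>"]) auto
qed

sublocale f: half_line_homeo f
proof
  obtain \<beta> where \<beta>: "\<And>z. z \<ge> 0 \<Longrightarrow> z - \<beta> \<le> f z" using f_lower by blast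
  have "filterlim (\<lambda>z::real. z - \<beta>) at_top at_top"
    using filterlim_tendsto_add_at_top[OF tendsto_const[of "- \<beta>"] filterlim_ident] by (simp add: add.commute)
  moreover have "\<forall>\<^sub>F z in at_top. z - \<beta> \<le> f z"
    using eventually_ge_at_top[of 0] by eventually_elim (use \<beta> in auto)
  ultimately show "filterlim f at_top at_top" by (rule filterlim_at_top_mono)
qed (use cont_f at_zero f_strict in auto)

text \<open>\<open>\<Omega>\<close> is the squared Blasius velocity as a function of the similarity variable \<open>t / sqrt x\<close>; \<open>\<Omega>1\<close> and \<open>\<Omega>2\<close>
  are its derivatives.\<close>

definition \<Omega> :: "real \<Rightarrow> real" where "\<Omega> \<xi> = (f1 (half_inverse f \<xi>))\<^sup>2"
definition \<Omega>1 :: "real \<Rightarrow> real" where "\<Omega>1 \<xi> = 2 * f2 (half_inverse f \<xi>)"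
definition \<Omega>2 :: "real \<Rightarrow> real" where "\<Omega>2 \<xi> = - \<xi> * f2 (half_inverse f \<xi>) / f1 (half_inverse f \<xi>)"

lemma \<Omega>_at_f: "0 \<le> z \<Longrightarrow> \<Omega> (f z) = (f1 z)\<^sup>2" by (simp add: \<Omega>_def f.inverse_of)

lemma sqrt_\<Omega>: "0 \<le> \<xi> \<Longrightarrow> sqrt (\<Omega> \<xi>) = f1 (half_inverse f \<xi>)"
  using f1_nonneg f.inverse(1) by (simp add: \<Omega>_def)

lemma \<Omega>_zero [simp]: "\<Omega> 0 = 0" using at_zero by (simp add: \<Omega>_def)

lemma \<Omega>_pos: "0 < \<xi> \<Longrightarrow> 0 < \<Omega> \<xi>" using f1_pos[OF f.inverse_pos, of \<xi>] by (simp add: \<Omega>_def)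

lemma \<Omega>_less_one: "0 \<le> \<xi> \<Longrightarrow> \<Omega> \<xi> < 1"
  using f1_nonneg f1_less_one f.inverse(1) by (simp add: \<Omega>_def power_less_one_iff abs_square_less_1)

lemma \<Omega>_mono: "0 \<le> \<xi> \<Longrightarrow> \<xi> \<le> \<xi>' \<Longrightarrow> \<Omega> \<xi> \<le> \<Omega> \<xi>'"
  using f.inverse_le_iff[of \<xi> \<xi>'] f.inverse(1) f1_mono f1_nonneg by (simp add: \<Omega>_def power_mono)

lemma finv_cont: "continuous_on {0..} (half_inverse f)"
proof -
  have "continuous_on (UNIV \<times> {0..}) (\<lambda>(x::real,y). f y)"
    unfolding split_def by (rule continuous_on_compose2[OF cont_f]) (auto intro!: continuous_intros)
  then have "continuous_on (UNIV \<times> {0..}) (\<lambda>(x::real,t). half_inverse f t)"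
    by (rule continuous_on_half_inverse) (rule f.half_line_homeo_axioms)
  then have "continuous_on {0..} (\<lambda>t. (\<lambda>(x::real,t). half_inverse f t) (0, t))"
    by (rule continuous_on_compose2) (auto intro!: continuous_intros)
  then show ?thesis by simp
qed

lemma \<Omega>_cont: "continuous_on {0..} \<Omega>"
  unfolding \<Omega>_def
  by (intro continuous_intros continuous_on_compose2[OF cont_f1] finv_cont) (auto simp: f.inverse)

lemma finv_deriv: "0 < \<xi> \<Longrightarrow> (half_inverse f has_real_derivative inverse (f1 (half_inverse f \<xi>))) (at \<xi>)"
  using f1_pos[OF f.inverse_pos, of \<xi>] by (auto intro!: f.inverse_has_derivative df f.inverse_pos)

lemma \<Omega>_deriv:
  assumes "0 < \<xi>"
  shows "(\<Omega> has_real_derivative \<Omega>1 \<xi>) (at \<xi>)" "(\<Omega>1 has_real_derivative \<Omega>2 \<xi>) (at \<xi>)"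
proof -
  define z where "z = half_inverse f \<xi>"
  have z: "0 < z" "f z = \<xi>" using assms f.inverse_pos f.inverse by (auto simp: z_def)
  have nz: "f1 z \<noteq> 0" using f1_pos z by force
  have "((\<lambda>\<xi>. f1 (half_inverse f \<xi>)) has_real_derivative f2 z * inverse (f1 z)) (at \<xi>)"
    using DERIV_chain2[OF df1[OF z(1), unfolded z_def] finv_deriv[OF assms]] by (simp add: z_def)
  from DERIV_power[OF this, of 2] show "(\<Omega> has_real_derivative \<Omega>1 \<xi>) (at \<xi>)"
    unfolding \<Omega>_def[abs_def] \<Omega>1_def using nz by (simp add: z_def[symmetric] mult.assoc)
  have "((\<lambda>\<xi>. 2 * f2 (half_inverse f \<xi>)) has_real_derivative 2 * (f3 z * inverse (f1 z))) (at \<xi>)"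
    using DERIV_cmult[OF DERIV_chain2[OF df2[OF z(1), unfolded z_def] finv_deriv[OF assms]]] by (simp add: z_def)
  then show "(\<Omega>1 has_real_derivative \<Omega>2 \<xi>) (at \<xi>)"
    unfolding \<Omega>1_def[abs_def] \<Omega>2_def using nz z f3_eq[of z] by (simp add: z_def[symmetric] field_simps)
qed

lemma \<Omega>2_nonpos: "0 < \<xi> \<Longrightarrow> \<Omega>2 \<xi> \<le> 0"
  using f1_pos f2_pos f.inverse_pos f.inverse(1) by (simp add: \<Omega>2_def divide_nonneg_pos less_imp_le)

text \<open>The ordinary differential equation to which \<open>w_x = sqrt w w_tt\<close> reduces for
  functions of \<open>t / sqrt x\<close>; it rests on the formula for \<open>\<Omega>2\<close>,
  where the Blasius equation has been used.\<close>

lemma \<Omega>_ode: assumes "0 < \<xi>" shows "sqrt (\<Omega> \<xi>) * \<Omega>2 \<xi> = - \<xi> * \<Omega>1 \<xi> / 2"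
  using assms f1_pos[of "half_inverse f \<xi>"] f.inverse_pos by (simp add: sqrt_\<Omega> \<Omega>1_def \<Omega>2_def)

sublocale \<Omega>: concave_from_zero \<Omega> \<Omega>1 \<Omega>2
  by unfold_locales (use \<Omega>_cont \<Omega>_deriv \<Omega>2_nonpos in auto)

lemma \<Omega>_linear_upper: assumes "0 \<le> \<xi>" shows "\<Omega> \<xi> \<le> 2 * f2 0 * \<xi>"
proof (cases "\<xi> = 0")
  case False
  then obtain s where s: "0 < s" "s < \<xi>" "\<Omega> \<xi> - \<Omega> 0 = (\<xi> - 0) * \<Omega>1 s"
    using \<Omega>.mvt[of 0 \<xi>] assms by auto
  have "\<Omega>1 s \<le> 2 * f2 0" using f2_antimono[of 0] f.inverse(1) s by (simp add: \<Omega>1_def)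
  then have "\<xi> * \<Omega>1 s \<le> \<xi> * (2 * f2 0)" using assms by (intro mult_left_mono) auto
  then show ?thesis using s by (simp add: mult_ac)
qed simp

lemma \<Omega>_linear_lower: assumes "0 \<le> \<xi>" shows "\<Omega> 1 * min \<xi> 1 \<le> \<Omega> \<xi>"
proof (cases "\<xi> \<le> 1")
  case True
  then show ?thesis using \<Omega>.ratio[of \<xi> 1] assms by (cases "\<xi> = 0") (auto simp: mult.commute)
qed (use \<Omega>_mono[of 1 \<xi>] in auto)

lemma \<Omega>_lim: assumes "\<eta> > 0" shows "\<exists>\<Xi>>0. \<forall>\<xi>\<ge>\<Xi>. 1 - \<eta> \<le> \<Omega> \<xi>"
proof -
  have "((\<lambda>z. (f1 z)\<^sup>2) \<longlongrightarrow> 1\<^sup>2) at_top" by (intro tendsto_intros f1_lim)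
  then have "\<forall>\<^sub>F z in at_top. 1 - \<eta> < (f1 z)\<^sup>2" using assms by (intro order_tendstoD(1)) auto
  then have "\<forall>\<^sub>F z in at_top. 1 - \<eta> < (f1 z)\<^sup>2 \<and> z > 0"
    by (intro eventually_conj eventually_gt_at_top)
  then obtain z where z: "1 - \<eta> < (f1 z)\<^sup>2" "z > 0" using eventually_happens by force
  show ?thesis
  proof (intro exI[of _ "f z"] conjI allI impI)
    show "f z > 0" using f_strict[of 0 z] z at_zero by simp
    then show "1 - \<eta> \<le> \<Omega> \<xi>" if "f z \<le> \<xi>" for \<xi>
      using \<Omega>_mono[of "f z" \<xi>] \<Omega>_at_f[of z] z that by simp
  qed
qed

text \<open>The Blasius flow shifted by \<open>s\<close> in von Mises variables, with its first two \<open>t\<close>-derivatives.\<close>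

definition W :: "real \<Rightarrow> real \<Rightarrow> real \<Rightarrow> real" where "W s x t = \<Omega> (t / sqrt (x + s))"
definition W1 :: "real \<Rightarrow> real \<Rightarrow> real \<Rightarrow> real" where "W1 s x t = \<Omega>1 (t / sqrt (x + s)) / sqrt (x + s)"
definition W2 :: "real \<Rightarrow> real \<Rightarrow> real \<Rightarrow> real" where "W2 s x t = \<Omega>2 (t / sqrt (x + s)) / (x + s)"

lemma W_deriv:
  assumes "0 < x + s" "0 < t"
  shows "((\<lambda>x. W s x t) has_real_derivative sqrt (W s x t) * W2 s x t) (at x)"
    "(W s x has_real_derivative W1 s x t) (at t)" "(W1 s x has_real_derivative W2 s x t) (at t)"
proof -
  define r where "r = sqrt (x + s)"
  have r: "r > 0" "r\<^sup>2 = x + s" using assms by (auto simp: r_def)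
  have \<xi>: "0 < t / r" using r assms by simp
  have inner: "((\<lambda>x. t / sqrt (x + s)) has_real_derivative - t / (2 * r ^ 3)) (at x)"
    using assms unfolding r_def
    by (auto intro!: derivative_eq_intros simp: field_simps power3_eq_cube)
  have "((\<lambda>x. \<Omega> (t / sqrt (x + s))) has_real_derivative \<Omega>1 (t / r) * (- t / (2 * r ^ 3))) (at x)"
    by (rule DERIV_chain2[OF _ inner]) (use \<Omega>_deriv(1)[OF \<xi>] in \<open>simp add: r_def\<close>)
  moreover have "\<Omega>1 (t / r) * (- t / (2 * r ^ 3)) = sqrt (\<Omega> (t / r)) * \<Omega>2 (t / r) / (x + s)"
    unfolding \<Omega>_ode[OF \<xi>] r(2)[symmetric] using r(1) by (simp add: field_simps power2_eq_square power3_eq_cube)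
  ultimately show "((\<lambda>x. W s x t) has_real_derivative sqrt (W s x t) * W2 s x t) (at x)"
    by (simp add: W_def W2_def r_def)
  have "((\<lambda>t. t / r) has_real_derivative 1 / r) (at t)" using r by (auto intro!: derivative_eq_intros)
  note ch = DERIV_chain2[OF _ this]
  show "(W s x has_real_derivative W1 s x t) (at t)"
    using ch[OF \<Omega>_deriv(1)[OF \<xi>]] by (simp add: W_def[abs_def] W1_def r_def)
  show "(W1 s x has_real_derivative W2 s x t) (at t)"
    using DERIV_cdivide[OF ch[OF \<Omega>_deriv(2)[OF \<xi>]], of r] r
    by (simp add: W1_def[abs_def] W2_def r_def)
qed

lemma W2_nonpos: "0 < x + s \<Longrightarrow> 0 < t \<Longrightarrow> W2 s x t \<le> 0"
  using \<Omega>2_nonpos[of "t / sqrt (x + s)"] by (simp add: W2_def divide_nonpos_pos)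

lemma W_cont:
  assumes "s > 0" shows "continuous_on ({0..X} \<times> {0..}) (\<lambda>(x,t). W s x t)"
  unfolding W_def split_def
  by (rule continuous_on_compose2[OF \<Omega>_cont]) (use assms in \<open>auto intro!: continuous_intros\<close>)

lemma W_bounds: "0 < x + s \<Longrightarrow> 0 \<le> t \<Longrightarrow> 0 \<le> W s x t \<and> W s x t < 1"
  using \<Omega>_less_one \<Omega>_mono[of 0] by (simp add: W_def)

end

text \<open>Only the second partial derivative has to be continuous; the first need exist at the one
  point. This asymmetry matters for \<open>p\<close>, whose \<open>x\<close>-derivative is known to
  exist pointwise but not to be continuous.\<close>

lemma chain_rule_two_variables:
  fixes F F' :: "real \<Rightarrow> real \<Rightarrow> real"
  assumes pos: "0 < \<alpha> \<tau>" "0 < \<beta> \<tau>"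
    and Fx: "((\<lambda>s. F s (\<beta> \<tau>)) has_real_derivative A) (at (\<alpha> \<tau>))"
    and Fy: "\<And>s r. 0 < s \<Longrightarrow> 0 < r \<Longrightarrow> (F s has_real_derivative F' s r) (at r)"
    and cont: "continuous_on ({0<..} \<times> {0<..}) (\<lambda>(s,r). F' s r)"
    and \<alpha>: "(\<alpha> has_real_derivative a) (at \<tau>)" and \<beta>: "(\<beta> has_real_derivative b) (at \<tau>)"
  shows "((\<lambda>\<tau>. F (\<alpha> \<tau>) (\<beta> \<tau>)) has_real_derivative A * a + F' (\<alpha> \<tau>) (\<beta> \<tau>) * b) (at \<tau>)"
proof -
  have op: "open ({0<..} \<times> {0<..} :: (real \<times> real) set)" by (intro open_Times) auto
  have mem: "(\<alpha> \<tau>, \<beta> \<tau>) \<in> {0<..} \<times> {0<..}" using pos by auto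
  have "((\<lambda>(s,r). F s r) has_derivative (\<lambda>(ts, tr). A * ts + blinfun_mult_right (F' (\<alpha> \<tau>) (\<beta> \<tau>)) tr))
          (at (\<alpha> \<tau>, \<beta> \<tau>) within {0<..} \<times> {0<..})"
  proof (rule has_derivative_partialsI)
    show "((\<lambda>s. F s (\<beta> \<tau>)) has_derivative (*) A) (at (\<alpha> \<tau>) within {0<..})"
      using Fx by (auto simp: has_field_derivative_def intro: has_derivative_at_withinI)
    show "(F s has_derivative blinfun_apply (blinfun_mult_right (F' s r))) (at r within {0<..})"
      if "s \<in> {0<..}" "r \<in> {0<..}" for s r
      using Fy[of s r] that by (auto simp: has_field_derivative_def intro: has_derivative_at_withinI)
    have "continuous_on ({0<..} \<times> {0<..}) (\<lambda>(s,r). blinfun_mult_right (F' s r))"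
      using bounded_linear.continuous_on[OF bounded_linear_blinfun_mult_right cont] by (simp add: split_def)
    then show "continuous (at (\<alpha> \<tau>, \<beta> \<tau>) within {0<..} \<times> {0<..}) (\<lambda>(s,r). blinfun_mult_right (F' s r))"
      using mem by (simp add: continuous_on_eq_continuous_within)
  qed (use pos in auto)
  then have F: "((\<lambda>(s,r). F s r) has_derivative (\<lambda>(ts, tr). A * ts + F' (\<alpha> \<tau>) (\<beta> \<tau>) * tr)) (at (\<alpha> \<tau>, \<beta> \<tau>))"
    using at_within_open[OF mem op] by (simp add: split_def)
  have "((\<lambda>\<tau>. (\<alpha> \<tau>, \<beta> \<tau>)) has_derivative (\<lambda>h. (a * h, b * h))) (at \<tau>)"
    using \<alpha> \<beta> by (intro has_derivative_Pair) (auto simp: has_field_derivative_def)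
  from has_derivative_compose[OF this F]
  have "((\<lambda>\<tau>. F (\<alpha> \<tau>) (\<beta> \<tau>)) has_derivative (\<lambda>h. A * (a * h) + F' (\<alpha> \<tau>) (\<beta> \<tau>) * (b * h))) (at \<tau>)"
    by simp
  moreover have "(\<lambda>h. A * (a * h) + F' (\<alpha> \<tau>) (\<beta> \<tau>) * (b * h)) = (*) (A * a + F' (\<alpha> \<tau>) (\<beta> \<tau>) * b)"
    by (auto simp: fun_eq_iff algebra_simps)
  ultimately show ?thesis by (simp add: has_field_derivative_def)
qed

lemma continuous_on_quadrantI:
  assumes "\<And>X. X > 0 \<Longrightarrow> continuous_on (strip X) g"
  shows "continuous_on quadrant g"
  unfolding continuous_on_eq_continuous_within
proof
  fix q assume q: "q \<in> quadrant"
  obtain x y where xy: "q = (x, y)" by force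
  have x: "x \<ge> 0" "y \<ge> 0" using q xy by (auto simp: quadrant_def)
  have "at q within quadrant = at q within strip (x + 1)"
    by (rule at_within_nhd[where S = "{..<x + 1} \<times> UNIV"])
       (use x in \<open>auto simp: xy quadrant_def strip_def open_Times\<close>)
  moreover have "continuous (at q within strip (x + 1)) g"
    using assms[of "x + 1"] x by (auto simp: continuous_on_eq_continuous_within xy strip_def)
  ultimately show "continuous (at q within quadrant) g" by simp
qed

lemma continuous_on_slice:
  assumes "continuous_on quadrant (\<lambda>(x,y). g x y)" "0 \<le> x"
  shows "continuous_on {0..} (g x)"
proof -
  have "continuous_on {0..} (\<lambda>y. (\<lambda>(x,y). g x y) (x, y))"
    by (rule continuous_on_compose2[OF assms(1)])
       (use assms(2) in \<open>auto intro!: continuous_intros simp: quadrant_def\<close>)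
  then show ?thesis by simp
qed

section \<open>Von Mises variables\<close>

locale prandtl_flow =
  fixes u0 u0' u0'' :: "real \<Rightarrow> real" and u v ux uy uyy vy :: "real \<Rightarrow> real \<Rightarrow> real"
  assumes datum: "oleinik_datum u0 u0' u0''"
    and sol: "oleinik_solution u0 u v ux uy uyy vy"
    and concave_datum: "\<And>y. 0 \<le> y \<Longrightarrow> u0'' y \<le> 0"
begin

section \<open>Regularity, equations and strip bounds of the solution\<close>

lemma derivs_within:
  assumes "0 \<le> x" "0 \<le> y"
  shows "((\<lambda>s. u s y) has_real_derivative ux x y) (at x within {0..})"
    "(u x has_real_derivative uy x y) (at y within {0..})"
    "(uy x has_real_derivative uyy x y) (at y within {0..})"
    "(v x has_real_derivative vy x y) (at y within {0..})"
  using sol assms by (auto simp: oleinik_solution_def)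

lemma u_dy: "0 \<le> x \<Longrightarrow> 0 < y \<Longrightarrow> (u x has_real_derivative uy x y) (at y)"
  and uy_dy: "0 \<le> x \<Longrightarrow> 0 < y \<Longrightarrow> (uy x has_real_derivative uyy x y) (at y)"
  and v_dy: "0 \<le> x \<Longrightarrow> 0 < y \<Longrightarrow> (v x has_real_derivative vy x y) (at y)"
  and u_dx: "0 < x \<Longrightarrow> 0 \<le> y \<Longrightarrow> ((\<lambda>s. u s y) has_real_derivative ux x y) (at x)"
  using half_line_derivative(2)[of "u x" "uy x", OF derivs_within(2)]
    half_line_derivative(2)[of "uy x" "uyy x", OF derivs_within(3)]
    half_line_derivative(2)[of "v x" "vy x", OF derivs_within(4)]
    half_line_derivative(2)[of "\<lambda>s. u s y" "\<lambda>s. ux s y", OF derivs_within(1)] by auto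

lemma cont_u: "continuous_on quadrant (\<lambda>(x,y). u x y)"
  and cont_ux: "continuous_on quadrant (\<lambda>(x,y). ux x y)"
  and cont_uy: "continuous_on quadrant (\<lambda>(x,y). uy x y)"
  and cont_uyy: "continuous_on quadrant (\<lambda>(x,y). uyy x y)"
  and cont_v: "continuous_on quadrant (\<lambda>(x,y). v x y)"
proof -
  have c: "continuous_on quadrant (\<lambda>(x,y). u x y)" "continuous_on quadrant (\<lambda>(x,y). ux x y)"
    "continuous_on quadrant (\<lambda>(x,y). uy x y)"
    "\<forall>X>0. continuous_on (strip X) (\<lambda>(x,y). uyy x y) \<and> continuous_on (strip X) (\<lambda>(x,y). v x y)"
    using sol unfolding oleinik_solution_def by simp_all
  then show "continuous_on quadrant (\<lambda>(x,y). u x y)" "continuous_on quadrant (\<lambda>(x,y). ux x y)"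
    "continuous_on quadrant (\<lambda>(x,y). uy x y)" by simp_all
  show "continuous_on quadrant (\<lambda>(x,y). uyy x y)" "continuous_on quadrant (\<lambda>(x,y). v x y)"
    using c(4) by (simp_all add: continuous_on_quadrantI)
qed

lemma momentum: "0 < x \<Longrightarrow> 0 < y \<Longrightarrow> u x y * ux x y + v x y * uy x y = uyy x y"
  and divergence: "0 < x \<Longrightarrow> 0 < y \<Longrightarrow> vy x y = - ux x y"
  and u_start: "0 \<le> y \<Longrightarrow> u 0 y = u0 y"
  and u_wall: "0 \<le> x \<Longrightarrow> u x 0 = 0" and v_wall: "0 \<le> x \<Longrightarrow> v x 0 = 0"
  and u_lim: "0 \<le> x \<Longrightarrow> (u x \<longlongrightarrow> 1) at_top"
  using sol by (auto simp: oleinik_solution_def add_eq_0_iff)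

lemma u_pos: assumes "0 \<le> x" "0 < y" shows "0 < u x y"
proof -
  have "\<forall>X>0. \<forall>x\<in>{0..X}. \<forall>y>0. u x y > 0" using sol by (auto simp: oleinik_solution_def)
  then show ?thesis using assms by (auto dest!: spec[of _ "x + 1"])
qed

lemma bounded_on_strip:
  assumes "0 < X"
  shows "\<exists>M>0. \<forall>x y. 0 \<le> x \<longrightarrow> x \<le> X \<longrightarrow> 0 \<le> y \<longrightarrow> \<bar>u x y\<bar> \<le> M \<and> \<bar>uy x y\<bar> \<le> M \<and> \<bar>uyy x y\<bar> \<le> M"
proof -
  have "bounded ((\<lambda>(x,y). u x y) ` strip X)" "bounded ((\<lambda>(x,y). uy x y) ` strip X)"
    "bounded ((\<lambda>(x,y). uyy x y) ` strip X)"
    using sol assms by (auto simp: oleinik_solution_def)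
  then obtain a b c where abc: "\<And>r. r \<in> (\<lambda>(x,y). u x y) ` strip X \<Longrightarrow> \<bar>r\<bar> \<le> a"
    "\<And>r. r \<in> (\<lambda>(x,y). uy x y) ` strip X \<Longrightarrow> \<bar>r\<bar> \<le> b" "\<And>r. r \<in> (\<lambda>(x,y). uyy x y) ` strip X \<Longrightarrow> \<bar>r\<bar> \<le> c"
    unfolding bounded_real by metis
  define M where "M = max (max a b) (max c 1)"
  have "\<bar>u x y\<bar> \<le> M \<and> \<bar>uy x y\<bar> \<le> M \<and> \<bar>uyy x y\<bar> \<le> M" if "0 \<le> x" "x \<le> X" "0 \<le> y" for x y
  proof -
    have m: "(x, y) \<in> strip X" using that by (simp add: strip_def)
    show ?thesis
      using abc(1)[OF imageI[OF m]] abc(2)[OF imageI[OF m]] abc(3)[OF imageI[OF m]] by (simp add: M_def le_max_iff_disj)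
  qed
  moreover have "M > 0" by (simp add: M_def)
  ultimately show ?thesis by blast
qed

section \<open>The stream function\<close>

definition \<Psi> :: "real \<Rightarrow> real \<Rightarrow> real" where "\<Psi> x y = integral {0..y} (u x)"

lemma cont_u_slice: "0 \<le> x \<Longrightarrow> continuous_on {0..} (u x)"
  by (rule continuous_on_slice[OF cont_u])

lemma \<Psi>_dy_within:
  assumes "0 \<le> x" "0 \<le> y" shows "(\<Psi> x has_real_derivative u x y) (at y within {0..})"
proof -
  have "(\<Psi> x has_real_derivative u x y) (at y within {0..y + 1})"
    unfolding \<Psi>_def
    by (rule integral_has_real_derivative[OF continuous_on_subset[OF cont_u_slice[OF assms(1)]]])
       (use assms in auto)
  moreover have "at y within {0..y + 1} = at y within {0..}"
    by (rule at_within_nhd[where S = "{..<y + 1}"]) auto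
  ultimately show ?thesis by simp
qed

lemma \<Psi>_dy: "0 \<le> x \<Longrightarrow> 0 < y \<Longrightarrow> (\<Psi> x has_real_derivative u x y) (at y)"
  and cont_\<Psi>_slice: "0 \<le> x \<Longrightarrow> continuous_on {0..} (\<Psi> x)"
  using half_line_derivative \<Psi>_dy_within by blast+

lemma \<Psi>_wall [simp]: "\<Psi> x 0 = 0" by (simp add: \<Psi>_def)

lemma \<Psi>_homeo: assumes "0 \<le> x" shows "half_line_homeo (\<Psi> x)"
proof
  have mono: "\<Psi> x y < \<Psi> x y'" if "0 \<le> y" "y < y'" for y y'
    by (rule deriv_pos_strict[OF that(2), of _ "u x"])
       (use assms that in \<open>auto intro!: \<Psi>_dy u_pos intro: continuous_on_subset[OF cont_\<Psi>_slice]\<close>)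
  then show "\<Psi> x y < \<Psi> x y'" if "0 \<le> y" "y < y'" for y y' using that .
  have "\<forall>\<^sub>F y in at_top. u x y > 1/2" using u_lim[OF assms] by (rule order_tendstoD(1)) simp
  then obtain Y1 where "\<And>y. y \<ge> Y1 \<Longrightarrow> u x y > 1/2" by (auto simp: eventually_at_top_linorder)
  then obtain Y0 where Y0: "\<And>y. y \<ge> Y0 \<Longrightarrow> u x y > 1/2" "Y0 > 0"
    by (rule that[of "max Y1 1"]) auto
  have "y / 2 - Y0 / 2 \<le> \<Psi> x y" if y: "y \<ge> Y0" for y
  proof -
    have "\<Psi> x Y0 - Y0 / 2 \<le> \<Psi> x y - y / 2"
    proof (rule deriv_nonneg_mono[OF y, where f' = "\<lambda>y. u x y - 1 / 2"])
      show "continuous_on {Y0..y} (\<lambda>y. \<Psi> x y - y / 2)"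
        by (intro continuous_intros continuous_on_subset[OF cont_\<Psi>_slice[OF assms]]) (use Y0 in auto)
      show "((\<lambda>y. \<Psi> x y - y / 2) has_real_derivative u x r - 1 / 2) (at r)" if "Y0 < r" for r
        using that Y0 assms by (auto intro!: derivative_eq_intros \<Psi>_dy)
      show "0 \<le> u x r - 1 / 2" if "Y0 < r" for r using Y0(1)[of r] that by simp
    qed
    moreover have "\<Psi> x Y0 > 0" using mono[of 0 Y0] Y0 by simp
    ultimately show ?thesis by linarith
  qed
  then have "\<forall>\<^sub>F y in at_top. y / 2 - Y0 / 2 \<le> \<Psi> x y"
    by (rule eventually_mono[OF eventually_ge_at_top[of Y0]])
  moreover have "filterlim (\<lambda>y::real. y / 2 - Y0 / 2) at_top at_top"
  proof -
    have "filterlim (\<lambda>y::real. - (Y0 / 2) + y * (1/2)) at_top at_top"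
      by (intro filterlim_tendsto_add_at_top[OF tendsto_const]
            filterlim_at_top_mult_tendsto_pos[OF tendsto_const] filterlim_ident) auto
    then show ?thesis by simp
  qed
  ultimately show "filterlim (\<Psi> x) at_top at_top" using filterlim_at_top_mono by blast
qed (use assms cont_\<Psi>_slice in auto)

lemma \<Psi>_dx_within:
  assumes "0 \<le> x" "0 \<le> y"
  shows "((\<lambda>s. \<Psi> s y) has_real_derivative integral {0..y} (ux x)) (at x within {0..})"
proof -
  have "((\<lambda>s. integral (cbox 0 y) (u s)) has_real_derivative integral (cbox 0 y) (ux x)) (at x within {0..})"
  proof (rule leibniz_rule_field_derivative)
    show "u s integrable_on cbox 0 y" if "s \<in> {0..}" for s
      by (rule integrable_continuous) (use that in \<open>auto intro: continuous_on_subset[OF cont_u_slice]\<close>)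
    show "continuous_on ({0..} \<times> cbox 0 y) (\<lambda>(s,t). ux s t)"
      by (rule continuous_on_subset[OF cont_ux]) (auto simp: quadrant_def)
  qed (use assms derivs_within(1) in auto)
  then show ?thesis by (simp add: \<Psi>_def)
qed

text \<open>Incompressibility turns the integral of \<open>ux\<close> into \<open>- v\<close>, the
  constant being removed by \<open>v x 0 = 0\<close>.\<close>

lemma \<Psi>_dx: assumes "0 < x" "0 \<le> y" shows "((\<lambda>s. \<Psi> s y) has_real_derivative - v x y) (at x)"
proof -
  have "((\<lambda>t. - ux x t) has_integral (v x y - v x 0)) {0..y}"
  proof (rule fundamental_theorem_of_calculus_interior[OF assms(2)])
    show "continuous_on {0..y} (v x)"
      using continuous_on_slice[OF cont_v, of x] assms by (auto intro: continuous_on_subset)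
    show "(v x has_vector_derivative - ux x t) (at t)" if "t \<in> {0<..<y}" for t
      using v_dy[of x t] divergence[of x t] that assms
      by (auto simp: has_real_derivative_iff_has_vector_derivative)
  qed
  from has_integral_neg[OF this] have "integral {0..y} (ux x) = - v x y"
    using v_wall[of x] assms by (auto intro: integral_unique)
  moreover have "at x within {0..} = at x" by (rule at_within_interior) (use assms in simp)
  ultimately show ?thesis using \<Psi>_dx_within[of x y] assms by simp
qed

text \<open>Continuity in \<open>x\<close> at fixed height, combined with a Lipschitz bound in
  \<open>y\<close> that is uniform on a strip because \<open>u\<close> is bounded there.\<close>

lemma cont_\<Psi>: "continuous_on quadrant (\<lambda>(x,y). \<Psi> x y)"
  unfolding continuous_on_def
proof
  fix q assume q: "q \<in> quadrant"
  obtain x y where xy: "q = (x, y)" by force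
  have x: "x \<ge> 0" "y \<ge> 0" using q xy by (auto simp: quadrant_def)
  obtain M where M: "M > 0" "\<And>s r. 0 \<le> s \<Longrightarrow> s \<le> x + 1 \<Longrightarrow> 0 \<le> r \<Longrightarrow> \<bar>u s r\<bar> \<le> M"
    using bounded_on_strip[of "x + 1"] x by auto
  have lip: "\<bar>\<Psi> s r - \<Psi> s y\<bar> \<le> M * \<bar>r - y\<bar>" if "0 \<le> s" "s \<le> x + 1" "0 \<le> r" for s r
    using field_differentiable_bound[of "{0..}" "\<Psi> s" "u s" M r y] \<Psi>_dy_within[OF that(1)] M(2)[OF that(1,2)] that x
    by (auto simp: real_norm_def)
  have fst_lim: "(fst \<longlongrightarrow> x) (at q within quadrant)" and snd_lim: "(snd \<longlongrightarrow> y) (at q within quadrant)"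
    using tendsto_fst[OF tendsto_ident_at[of q quadrant]] tendsto_snd[OF tendsto_ident_at[of q quadrant]]
    by (simp_all add: xy)
  have mem: "\<forall>\<^sub>F r in at q within quadrant. r \<in> quadrant" by (simp add: eventually_at_filter)
  have near: "\<forall>\<^sub>F r in at q within quadrant. fst r < x + 1" using fst_lim by (rule order_tendstoD(2)) simp
  have "((\<lambda>s. \<Psi> s y) \<longlongrightarrow> \<Psi> x y) (at x within {0..})"
    using DERIV_continuous[OF \<Psi>_dx_within[OF x]] by (simp add: continuous_within)
  then have "continuous (at x within {0..}) (\<lambda>s. \<Psi> s y)" by (simp add: continuous_within)
  then have "continuous_on {0..} (\<lambda>s. \<Psi> s y)"
    using DERIV_continuous[OF \<Psi>_dx_within[OF _ x(2)]] by (simp add: continuous_on_eq_continuous_within)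
  then have "continuous_on quadrant (\<lambda>r. \<Psi> (fst r) y)"
    by (rule continuous_on_compose2) (auto intro!: continuous_intros simp: quadrant_def)
  then have L1: "((\<lambda>r. \<Psi> (fst r) y) \<longlongrightarrow> \<Psi> x y) (at q within quadrant)"
    using q by (auto simp: continuous_on_def xy)
  have "((\<lambda>r. M * \<bar>snd r - y\<bar>) \<longlongrightarrow> M * \<bar>y - y\<bar>) (at q within quadrant)"
    by (intro tendsto_intros snd_lim)
  then have L2: "((\<lambda>r. M * \<bar>snd r - y\<bar>) \<longlongrightarrow> 0) (at q within quadrant)" by simp
  have "((\<lambda>r. \<Psi> (fst r) (snd r) - \<Psi> (fst r) y) \<longlongrightarrow> 0) (at q within quadrant)"
  proof (rule Lim_null_comparison[OF _ L2])
    show "\<forall>\<^sub>F r in at q within quadrant. norm (\<Psi> (fst r) (snd r) - \<Psi> (fst r) y) \<le> M * \<bar>snd r - y\<bar>"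
      using mem near by eventually_elim (use lip in \<open>auto simp: quadrant_def\<close>)
  qed
  from tendsto_add[OF this L1]
  show "((\<lambda>(x,y). \<Psi> x y) \<longlongrightarrow> (case q of (x,y) \<Rightarrow> \<Psi> x y)) (at q within quadrant)"
    by (simp add: xy split_def)
qed

text \<open>\<open>Y x\<close> inverts the stream function \<open>\<Psi> x\<close>. For \<open>t > 0\<close>, \<open>p\<close> and \<open>q\<close> are the first two \<open>t\<close>-derivatives of \<open>w\<close>,
  and \<open>g\<close> is its \<open>x\<close>-derivative when also \<open>x > 0\<close>; at \<open>t = 0\<close> the value of \<open>q\<close> is meaningless (division by zero).\<close>

definition Y :: "real \<Rightarrow> real \<Rightarrow> real" where "Y x t = half_inverse (\<Psi> x) t"
definition w :: "real \<Rightarrow> real \<Rightarrow> real" where "w x t = (u x (Y x t))\<^sup>2"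
definition p :: "real \<Rightarrow> real \<Rightarrow> real" where "p x t = 2 * uy x (Y x t)"
definition g :: "real \<Rightarrow> real \<Rightarrow> real" where "g x t = 2 * uyy x (Y x t)"
definition q :: "real \<Rightarrow> real \<Rightarrow> real" where "q x t = g x t / sqrt (w x t)"

lemma Y_nonneg: "0 \<le> x \<Longrightarrow> 0 \<le> t \<Longrightarrow> 0 \<le> Y x t"
  and Y_pos: "0 \<le> x \<Longrightarrow> 0 < t \<Longrightarrow> 0 < Y x t"
  and \<Psi>_Y: "0 \<le> x \<Longrightarrow> 0 \<le> t \<Longrightarrow> \<Psi> x (Y x t) = t"
  and Y_\<Psi>: "0 \<le> x \<Longrightarrow> 0 \<le> y \<Longrightarrow> Y x (\<Psi> x y) = y"
  and Y_wall: "0 \<le> x \<Longrightarrow> Y x 0 = 0"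
  unfolding Y_def
  using half_line_homeo.inverse[OF \<Psi>_homeo] half_line_homeo.inverse_pos[OF \<Psi>_homeo]
    half_line_homeo.inverse_of[OF \<Psi>_homeo] half_line_homeo.inverse_zero[OF \<Psi>_homeo] by auto

lemma \<Psi>_less_iff: "0 \<le> x \<Longrightarrow> 0 \<le> y \<Longrightarrow> 0 \<le> y' \<Longrightarrow> \<Psi> x y < \<Psi> x y' \<longleftrightarrow> y < y'"
  and \<Psi>_le_iff: "0 \<le> x \<Longrightarrow> 0 \<le> y \<Longrightarrow> 0 \<le> y' \<Longrightarrow> \<Psi> x y \<le> \<Psi> x y' \<longleftrightarrow> y \<le> y'"
  using half_line_homeo.less_iff[OF \<Psi>_homeo] half_line_homeo.le_iff[OF \<Psi>_homeo] by auto

lemma \<Psi>_nonneg: "0 \<le> x \<Longrightarrow> 0 \<le> y \<Longrightarrow> 0 \<le> \<Psi> x y"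
  and \<Psi>_pos: "0 \<le> x \<Longrightarrow> 0 < y \<Longrightarrow> 0 < \<Psi> x y"
  using \<Psi>_le_iff[of x 0 y] \<Psi>_less_iff[of x 0 y] by auto

lemma cont_Y: "continuous_on quadrant (\<lambda>(x,t). Y x t)"
proof -
  have "continuous_on ({0..} \<times> {0..}) (\<lambda>(x,t). half_inverse (\<Psi> x) t)"
    by (rule continuous_on_half_inverse) (use cont_\<Psi> \<Psi>_homeo in \<open>auto simp: quadrant_def\<close>)
  then show ?thesis by (simp add: Y_def quadrant_def)
qed

lemma cont_comp_Y:
  assumes "continuous_on quadrant (\<lambda>(x,y). h x y)"
  shows "continuous_on quadrant (\<lambda>(x,t). h x (Y x t))"
proof -
  have "continuous_on quadrant (\<lambda>r. (\<lambda>(x,y). h x y) (fst r, Y (fst r) (snd r)))"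
    by (rule continuous_on_compose2[OF assms])
       (use cont_Y Y_nonneg in \<open>auto intro!: continuous_intros simp: split_def quadrant_def\<close>)
  then show ?thesis by (simp add: split_def)
qed

lemma cont_w: "continuous_on quadrant (\<lambda>(x,t). w x t)"
  using continuous_on_power[OF cont_comp_Y[OF cont_u], of 2] by (simp add: w_def split_def)

lemma cont_p: "continuous_on quadrant (\<lambda>(x,t). p x t)"
  using continuous_on_mult_const[THEN continuous_on_compose2, OF cont_comp_Y[OF cont_uy], of UNIV 2]
  by (simp add: p_def split_def)

lemma cont_g: "continuous_on quadrant (\<lambda>(x,t). g x t)"
  using continuous_on_mult_const[THEN continuous_on_compose2, OF cont_comp_Y[OF cont_uyy], of UNIV 2]
  by (simp add: g_def split_def)

lemma u_Y_nonneg: "0 \<le> x \<Longrightarrow> 0 \<le> t \<Longrightarrow> 0 \<le> u x (Y x t)"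
  using u_pos[of x "Y x t"] Y_pos[of x t] Y_wall[of x] u_wall[of x] by (cases "t = 0") (auto simp: less_imp_le)

lemma sqrt_w: "0 \<le> x \<Longrightarrow> 0 \<le> t \<Longrightarrow> sqrt (w x t) = u x (Y x t)"
  using u_Y_nonneg by (simp add: w_def)

lemma w_wall: "0 \<le> x \<Longrightarrow> w x 0 = 0" by (simp add: w_def Y_wall u_wall)

lemma w_pos: "0 \<le> x \<Longrightarrow> 0 < t \<Longrightarrow> 0 < w x t" using u_pos[OF _ Y_pos, of x x t] by (simp add: w_def)

lemma w_nonneg: "0 \<le> w x t" by (simp add: w_def)

section \<open>The von Mises equation\<close>

lemma Y_dt: assumes "0 \<le> x" "0 < t" shows "(Y x has_real_derivative inverse (u x (Y x t))) (at t)"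
proof -
  have "(half_inverse (\<Psi> x) has_real_derivative inverse (u x (Y x t))) (at t)"
    by (rule half_line_homeo.inverse_has_derivative[OF \<Psi>_homeo])
       (use assms Y_pos[of x t] u_pos[of x "Y x t"] in \<open>auto intro!: \<Psi>_dy simp: Y_def[symmetric]\<close>)
  then show ?thesis by (simp add: Y_def[abs_def])
qed

lemma w_dt: assumes "0 \<le> x" "0 < t" shows "(w x has_real_derivative p x t) (at t)"
proof -
  have nz: "u x (Y x t) \<noteq> 0" using u_pos[OF assms(1) Y_pos[OF assms]] by simp
  have "((\<lambda>t. u x (Y x t)) has_real_derivative uy x (Y x t) * inverse (u x (Y x t))) (at t)"
    by (rule DERIV_chain2[OF u_dy[OF assms(1) Y_pos[OF assms]] Y_dt[OF assms]])
  from DERIV_power[OF this, of 2] show ?thesis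
    using nz by (simp add: w_def[abs_def] p_def mult.assoc)
qed

lemma p_dt: assumes "0 \<le> x" "0 < t" shows "(p x has_real_derivative q x t) (at t)"
proof -
  have "((\<lambda>t. uy x (Y x t)) has_real_derivative uyy x (Y x t) * inverse (u x (Y x t))) (at t)"
    by (rule DERIV_chain2[OF uy_dy[OF assms(1) Y_pos[OF assms]] Y_dt[OF assms]])
  from DERIV_cmult[OF this, of 2] show ?thesis
    using assms by (simp add: p_def[abs_def] q_def g_def sqrt_w divide_inverse mult.assoc)
qed

lemma g_eq: "0 \<le> x \<Longrightarrow> 0 < t \<Longrightarrow> g x t = sqrt (w x t) * q x t"
  using w_pos[of x t] by (simp add: q_def)

text \<open>Implicit differentiation of \<open>\<Psi> s (Y s t) = t\<close>, carried out by
  hand.\<close>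

lemma Y_dx: assumes "0 < x" "0 < t"
  shows "((\<lambda>s. Y s t) has_real_derivative v x (Y x t) / u x (Y x t)) (at x)"
proof -
  define y where "y = Y x t"
  have y: "0 < y" "\<Psi> x y = t" "0 < u x y" using assms Y_pos \<Psi>_Y u_pos by (auto simp: y_def)
  \<comment> \<open>\<open>R s\<close> is the chord slope of \<open>\<Psi> s\<close> between
    \<open>y\<close> and \<open>Y s t\<close>, completed by \<open>u s y\<close> when they coincide.
    It always satisfies \<open>R s (Y s t - y) = \<Psi> x y - \<Psi> s y\<close>, and it tends to
    \<open>u x y\<close> as a value of \<open>u\<close> at a nearby point.\<close>
  define R where "R s = (if Y s t = y then u s y else (\<Psi> s (Y s t) - \<Psi> s y) / (Y s t - y))" for s
  have xpos: "\<forall>\<^sub>F s in at x. 0 < s"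
    using order_tendstoD(1)[OF tendsto_ident_at assms(1)] by simp
  have opq: "(x, y) \<in> {0<..} \<times> {0<..}" using assms y by auto
  have "continuous_on ({0<..} \<times> {0<..}) (\<lambda>(x,y). u x y)"
    by (rule continuous_on_subset[OF cont_u]) (auto simp: quadrant_def)
  then have isc: "isCont (\<lambda>(x,y). u x y) (x, y)"
    using opq by (subst (asm) continuous_on_eq_continuous_at) (auto intro: open_Times)
  have "continuous_on {0..} (\<lambda>s. (\<lambda>(x,t). Y x t) (s, t))"
    by (rule continuous_on_compose2[OF cont_Y]) (use assms in \<open>auto intro!: continuous_intros simp: quadrant_def\<close>)
  then have "isCont (\<lambda>s. Y s t) x" using assms by (auto intro!: continuous_on_interior)
  then have Ylim: "((\<lambda>s. Y s t) \<longlongrightarrow> y) (at x)" by (simp add: isCont_def y_def)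
  have Rlim: "(R \<longlongrightarrow> u x y) (at x)"
  proof (rule tendstoI)
    fix e :: real assume e: "e > 0"
    obtain d where d: "d > 0" "\<And>r. dist r (x, y) < d \<Longrightarrow> \<bar>(case r of (x,y) \<Rightarrow> u x y) - u x y\<bar> < e"
      using isc e unfolding continuous_at_eps_delta by (auto simp: dist_real_def)
    have d': "\<bar>u s r - u x y\<bar> < e" if "\<bar>s - x\<bar> < d / 2" "\<bar>r - y\<bar> < d / 2" for s r
    proof -
      have "dist (s, r) (x, y) \<le> dist s x + dist r y"
        unfolding dist_prod_def by (rule order_trans[OF sqrt_sum_squares_le_sum]) auto
      then show ?thesis using d(2)[of "(s, r)"] that by (auto simp: dist_real_def)
    qed
    have "\<forall>\<^sub>F s in at x. \<bar>Y s t - y\<bar> < d / 2" using tendstoD[OF Ylim, of "d / 2"] d(1) by (simp add: dist_real_def)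
    moreover have "\<forall>\<^sub>F s in at x. \<bar>s - x\<bar> < d / 2"
      using tendstoD[OF tendsto_ident_at, of "d / 2" x UNIV] d(1) by (simp add: dist_real_def)
    ultimately show "\<forall>\<^sub>F s in at x. dist (R s) (u x y) < e" using xpos
    proof eventually_elim
      case (elim s)
      show ?case
      proof (cases "Y s t = y")
        case True
        then show ?thesis using d'[of s y] elim d(1) by (simp add: R_def dist_real_def)
      next
        case False
        define a b where "a = min (Y s t) y" and "b = max (Y s t) y"
        have ab: "0 < a" "a < b" using False y Y_pos[of s t] elim assms by (auto simp: a_def b_def)
        obtain z where z: "a < z" "z < b" "\<Psi> s b - \<Psi> s a = (b - a) * u s z"
          by (rule mvt_open[OF ab(2), of "\<Psi> s" "u s"])
             (use ab elim in \<open>auto intro!: \<Psi>_dy intro: continuous_on_subset[OF cont_\<Psi>_slice]\<close>)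
        have "R s = u s z" using z(3) False by (auto simp: R_def a_def b_def min_def max_def field_simps split: if_splits)
        moreover have "\<bar>z - y\<bar> \<le> \<bar>Y s t - y\<bar>"
          using z(1,2) unfolding a_def b_def min_def max_def by (auto split: if_splits)
        ultimately show ?thesis using d'[of s z] elim by (simp add: dist_real_def)
      qed
    qed
  qed
  have "((\<lambda>s. - ((\<Psi> s y - \<Psi> x y) / (s - x)) / R s) \<longlongrightarrow> - (- v x y) / u x y) (at x)"
    using \<Psi>_dx[of x y] assms y Rlim
    by (intro tendsto_intros) (auto simp: has_field_derivative_iff)
  moreover have "\<forall>\<^sub>F s in at x. - ((\<Psi> s y - \<Psi> x y) / (s - x)) / R s = (Y s t - Y x t) / (s - x)"
  proof -
    have "\<forall>\<^sub>F s in at x. R s > 0" using order_tendstoD(1)[OF Rlim y(3)] .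
    moreover have "\<forall>\<^sub>F s in at x. s \<noteq> x" by (simp add: eventually_at_filter)
    ultimately show ?thesis using xpos
    proof eventually_elim
      case (elim s)
      have "\<Psi> s (Y s t) - \<Psi> s y = R s * (Y s t - y)" by (simp add: R_def)
      moreover have "\<Psi> s (Y s t) = \<Psi> x y" using \<Psi>_Y[of s t] elim assms y by simp
      ultimately have "- (\<Psi> s y - \<Psi> x y) = R s * (Y s t - y)" by simp
      then have "- ((\<Psi> s y - \<Psi> x y) / (s - x)) / R s = R s * (Y s t - y) / (s - x) / R s"
        by (metis minus_divide_left)
      then show ?case using elim by (simp add: y_def[symmetric])
    qed
  qed
  ultimately have "((\<lambda>s. (Y s t - Y x t) / (s - x)) \<longlongrightarrow> v x y / u x y) (at x)"
    by (subst (asm) tendsto_cong) auto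
  then show ?thesis by (simp add: has_field_derivative_iff y_def)
qed

text \<open>Along a streamline \<open>u\<close> changes at rate \<open>ux + uy v / u\<close>;
  multiplying by \<open>2 u\<close> gives twice the left-hand side of the momentum equation, hence
  \<open>2 uyy\<close>.\<close>

lemma w_dx: assumes "0 < x" "0 < t" shows "((\<lambda>s. w s t) has_real_derivative g x t) (at x)"
proof -
  define y where "y = Y x t"
  have y: "0 < y" "0 < u x y" using assms Y_pos u_pos by (auto simp: y_def)
  have cont: "continuous_on ({0<..} \<times> {0<..}) (\<lambda>(x,y). uy x y)"
    by (rule continuous_on_subset[OF cont_uy]) (auto simp: quadrant_def)
  have "((\<lambda>s. u s (Y s t)) has_real_derivative ux x (Y x t) * 1 + uy x (Y x t) * (v x (Y x t) / u x (Y x t))) (at x)"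
    by (rule chain_rule_two_variables[OF _ _ u_dx u_dy cont DERIV_ident Y_dx])
       (use assms y in \<open>auto simp: y_def[symmetric]\<close>)
  from DERIV_power[OF this, of 2]
  have "((\<lambda>s. w s t) has_real_derivative 2 * ((ux x y + uy x y * (v x y / u x y)) * u x y)) (at x)"
    by (simp add: w_def[abs_def] y_def mult_ac)
  moreover have "(ux x y + uy x y * (v x y / u x y)) * u x y = uyy x y"
    using momentum[of x y] assms y by (simp add: field_simps)
  ultimately show ?thesis by (simp add: g_def y_def)
qed

lemma w_strip_bounds:
  assumes "0 < X"
  shows "\<exists>M>0. \<forall>x t. 0 \<le> x \<longrightarrow> x \<le> X \<longrightarrow> 0 \<le> t \<longrightarrow> w x t \<le> M \<and> w x t \<le> M * t \<and> \<bar>g x t\<bar> \<le> M"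
proof -
  obtain M where M: "M > 0" "\<And>x y. 0 \<le> x \<Longrightarrow> x \<le> X \<Longrightarrow> 0 \<le> y \<Longrightarrow> \<bar>u x y\<bar> \<le> M \<and> \<bar>uy x y\<bar> \<le> M \<and> \<bar>uyy x y\<bar> \<le> M"
    using bounded_on_strip[OF assms] by auto
  have "w x t \<le> M\<^sup>2 + 2 * M \<and> w x t \<le> (M\<^sup>2 + 2 * M) * t \<and> \<bar>g x t\<bar> \<le> M\<^sup>2 + 2 * M"
    if x: "0 \<le> x" "x \<le> X" and t: "0 \<le> t" for x t
  proof -
    have b: "\<bar>u x (Y x s)\<bar> \<le> M" "\<bar>p x s\<bar> \<le> 2 * M" "\<bar>g x s\<bar> \<le> 2 * M" if "0 \<le> s" for s
      using M(2)[OF x Y_nonneg[OF x(1) that]] by (auto simp: p_def g_def)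
    have "w x t \<le> M\<^sup>2" using b(1)[OF t] M(1) by (simp add: w_def abs_le_square_iff[symmetric])
    moreover have "w x t \<le> 2 * M * t"
    proof (cases "t = 0")
      case False
      have "continuous_on {0..t} (w x)"
        using continuous_on_slice[OF cont_w x(1)] by (rule continuous_on_subset) auto
      then obtain s where s: "0 < s" "s < t" "w x t - w x 0 = (t - 0) * p x s"
        using mvt_open[of 0 t "w x" "p x"] False t w_dt[OF x(1)] by auto
      have "t * p x s \<le> t * (2 * M)" using b(2)[of s] s t by (intro mult_left_mono) auto
      then show ?thesis using s w_wall[OF x(1)] by (simp add: mult_ac)
    qed (simp add: w_wall x)
    moreover have "2 * M * t \<le> (M\<^sup>2 + 2 * M) * t" using t by (intro mult_right_mono) auto
    moreover have "0 \<le> M\<^sup>2" by simp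
    ultimately show ?thesis using b(3)[OF t] M(1) by (smt (verit))
  qed
  then show ?thesis using M(1) by (intro exI[of _ "M\<^sup>2 + 2 * M"]) (auto intro: add_pos_pos)
qed

lemma cont_w_strip: "continuous_on ({0..X} \<times> {0..}) (\<lambda>(x,t). w x t)"
  by (rule continuous_on_subset[OF cont_w]) (auto simp: quadrant_def)

section \<open>Comparison with the Blasius flow and with rescalings\<close>

lemma u0_derivs: "0 < y \<Longrightarrow> (u0 has_real_derivative u0' y) (at y)" "0 < y \<Longrightarrow> (u0' has_real_derivative u0'' y) (at y)"
  using half_line_derivative(2)[of u0 u0'] half_line_derivative(2)[of u0' u0''] datum
  by (auto simp: oleinik_datum_def)

lemma uy_start: assumes "0 < y" shows "uy 0 y = u0' y"
proof -
  have "(u0 has_real_derivative uy 0 y) (at y)"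
    by (rule has_field_derivative_transform_within_open[OF u_dy[OF order_refl assms], of "{0<..}"])
       (use assms u_start in auto)
  then show ?thesis using u0_derivs(1)[OF assms] DERIV_unique by blast
qed

lemma uyy_start: assumes "0 < y" shows "uyy 0 y = u0'' y"
proof -
  have "(u0' has_real_derivative uyy 0 y) (at y)"
    by (rule has_field_derivative_transform_within_open[OF uy_dy[OF order_refl assms], of "{0<..}"])
       (use assms uy_start in auto)
  then show ?thesis using u0_derivs(2)[OF assms] DERIV_unique by blast
qed

lemma g_start_nonpos: "0 < t \<Longrightarrow> g 0 t \<le> 0"
  using uyy_start[of "Y 0 t"] concave_datum[of "Y 0 t"] Y_pos[of 0 t] by (simp add: g_def)

lemma concave_w:
  assumes "0 \<le> x" and "\<And>t. 0 < t \<Longrightarrow> g x t \<le> 0"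
  shows "concave_from_zero (w x) (p x) (q x)"
proof
  show "q x t \<le> 0" if "0 < t" for t
    using assms(2)[OF that] w_nonneg by (simp add: q_def divide_nonpos_nonneg)
qed (use assms w_dt p_dt w_wall continuous_on_slice[OF cont_w] in auto)

lemma w_start_concave: "concave_from_zero (w 0) (p 0) (q 0)"
  by (rule concave_w) (use g_start_nonpos in auto)

lemma w_start_slope: "0 < t \<Longrightarrow> 0 \<le> p 0 t"
  using concave_from_zero.slope_nonneg[OF w_start_concave, of 0 t] w_nonneg by auto

lemma w_start_mono: assumes "0 \<le> s" "s \<le> t" shows "w 0 s \<le> w 0 t"
  by (rule deriv_nonneg_mono[OF assms(2), of _ "p 0"])
     (use assms in \<open>auto intro!: w_dt w_start_slope intro: continuous_on_subset[OF continuous_on_slice[OF cont_w]]\<close>)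

lemma u_start_le_one: assumes "0 \<le> y" shows "u 0 y \<le> 1"
proof -
  have nn: "0 \<le> uy 0 r" if "0 < r" for r
    using w_start_slope[of "\<Psi> 0 r"] \<Psi>_pos[of 0 r] Y_\<Psi>[of 0 r] that by (simp add: p_def)
  have "u 0 y \<le> u 0 r" if "y \<le> r" for r
    by (rule deriv_nonneg_mono[OF that, of _ "uy 0"])
       (use assms that nn in \<open>auto intro!: u_dy intro: continuous_on_subset[OF cont_u_slice]\<close>)
  then have "\<forall>\<^sub>F r in at_top. u 0 y \<le> u 0 r" by (rule eventually_mono[OF eventually_ge_at_top[of y]])
  then show ?thesis by (intro tendsto_lowerbound[OF u_lim]) auto
qed

lemma w_start_le_one: "0 \<le> t \<Longrightarrow> w 0 t \<le> 1"
  using u_start_le_one[OF Y_nonneg, of 0 t] u_Y_nonneg[of 0 t] by (simp add: w_def power_le_one)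

lemma Y_start_ge: assumes "0 \<le> t" shows "t \<le> Y 0 t"
proof -
  have "\<Psi> 0 y - y \<le> \<Psi> 0 0 - 0" if "0 \<le> y" for y
  proof (rule deriv_nonpos_antimono[OF that, of "\<lambda>y. \<Psi> 0 y - y" "\<lambda>y. u 0 y - 1"])
    show "continuous_on {0..y} (\<lambda>y. \<Psi> 0 y - y)"
      by (intro continuous_intros continuous_on_subset[OF cont_\<Psi>_slice]) auto
  qed (use u_start_le_one in \<open>auto intro!: derivative_eq_intros \<Psi>_dy\<close>)
  from this[of "Y 0 t"] show ?thesis using \<Psi>_Y[of 0 t] Y_nonneg[of 0 t] assms by simp
qed

text \<open>The concave initial profile, frozen in \<open>x\<close>, is a supersolution. This
  supplies the initial ordering when \<open>w\<close> is later compared with its translates in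
  \<open>x\<close>.\<close>

lemma w_le_start:
  assumes "0 \<le> x" "0 \<le> t" shows "w x t \<le> w 0 t"
proof (cases "x = 0")
  case False
  then have x: "0 < x" using assms by simp
  obtain M where M: "M > 0" "\<And>s t. 0 \<le> s \<Longrightarrow> s \<le> x \<Longrightarrow> 0 \<le> t \<Longrightarrow> w s t \<le> M"
    using w_strip_bounds[OF x] by auto
  have "w x t - w 0 t \<le> 0"
  proof (rule comparison_principle[where d = "\<lambda>s t. w s t - w 0 t" and X = x and M = M
        and dx = g and ?d1.0 = "\<lambda>s t. p s t - p 0 t" and ?d2.0 = "\<lambda>s t. q s t - q 0 t" and A = "sqrt M"])
    have "continuous_on ({0..x} \<times> {0..}) (\<lambda>r. w 0 (snd r))"
      by (rule continuous_on_compose2[OF continuous_on_slice[OF cont_w order_refl]])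
         (auto intro!: continuous_intros)
    then show "continuous_on ({0..x} \<times> {0..}) (\<lambda>(s,t). w s t - w 0 t)"
      using cont_w_strip[of x] by (auto simp: split_def intro: continuous_on_diff)
    show "w s t - w 0 t \<le> M" if "0 \<le> s" "s \<le> x" "0 \<le> t" for s t
      using M(2)[OF that] w_nonneg[of 0 t] by simp
    show "\<exists>a\<ge>0. a \<le> sqrt M \<and> g s t \<le> a * (q s t - q 0 t)"
      if st: "0 < s" "s \<le> x" "0 < t" for s t
    proof (intro exI[of _ "sqrt (w s t)"] conjI)
      have "0 \<le> sqrt (w s t) * - q 0 t"
        using concave_from_zero.neg[OF w_start_concave st(3)] w_nonneg by (intro mult_nonneg_nonneg) auto
      then show "g s t \<le> sqrt (w s t) * (q s t - q 0 t)"
        using g_eq[of s t] st by (simp add: algebra_simps)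
    qed (use M st w_nonneg in auto)
  qed (use assms M w_wall in \<open>auto intro!: w_dt p_dt w_dx derivative_eq_intros\<close>)
  then show ?thesis by simp
qed simp

lemma w_le_one: "0 \<le> x \<Longrightarrow> 0 \<le> t \<Longrightarrow> w x t \<le> 1"
  using w_le_start[of x t] w_start_le_one[of t] by simp

end

section \<open>The shifted Blasius flow as a lower barrier\<close>

locale prandtl = prandtl_flow u0 u0' u0'' u v ux uy uyy vy + blasius_profile f f1 f2 f3 C1 C2
  for u0 u0' u0'' u v ux uy uyy vy f f1 f2 f3 C1 C2 +
  fixes C4 C5 :: real
  assumes C4_pos: "C4 > 0" and C5_pos: "C5 > 0"
    and decay: "\<And>y. 0 \<le> y \<Longrightarrow> \<bar>u0 y - 1\<bar> \<le> C4 * exp (- C5 * y\<^sup>2)"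
begin

lemma w_start_decay: assumes "0 \<le> t" shows "1 - w 0 t \<le> 2 * C4 * exp (- C5 * t\<^sup>2)"
proof -
  define y where "y = Y 0 t"
  have y: "0 \<le> y" "t \<le> y" using Y_nonneg Y_start_ge assms by (auto simp: y_def)
  have u: "0 \<le> u 0 y" "u 0 y \<le> 1" "u 0 y = u0 y"
    using u_Y_nonneg[of 0 t] u_start_le_one u_start y assms by (auto simp: y_def)
  have "1 - w 0 t = (1 - u 0 y) * (1 + u 0 y)" by (simp add: w_def y_def power2_eq_square algebra_simps)
  also have "\<dots> \<le> (1 - u 0 y) * 2" using u by (intro mult_left_mono) auto
  also have "1 - u 0 y \<le> C4 * exp (- C5 * y\<^sup>2)" using decay[OF y(1)] u by auto
  also have "C4 * exp (- C5 * y\<^sup>2) \<le> C4 * exp (- C5 * t\<^sup>2)"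
    using y assms C4_pos C5_pos by (simp add: power_mono)
  finally show ?thesis by simp
qed

text \<open>As \<open>0 \<le> f1 \<le> 1\<close>, \<open>1 - f1^2\<close> is at least
  \<open>1 - f1\<close>; replacing the height \<open>z\<close> by the stream value through
  \<open>z \<le> \<xi> + \<beta>\<close> doubles the rate to \<open>6 C1\<close>.\<close>

lemma one_minus_\<Omega>_lower: "\<exists>k>0. \<exists>\<gamma>>0. \<forall>\<xi>\<ge>0. k * exp (- \<gamma> * \<xi>\<^sup>2) \<le> 1 - \<Omega> \<xi>"
proof -
  obtain k where k: "k > 0" "\<And>z. z \<ge> 0 \<Longrightarrow> k * exp (- (3 * C1) * z\<^sup>2) \<le> 1 - f1 z"
    using f1_gaussian_lower by auto
  obtain \<beta> where \<beta>: "\<beta> > 0" "\<And>z. z \<ge> 0 \<Longrightarrow> z - \<beta> \<le> f z" using f_lower by auto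
  have "(k * exp (- (6 * C1) * \<beta>\<^sup>2)) * exp (- (6 * C1) * \<xi>\<^sup>2) \<le> 1 - \<Omega> \<xi>" if \<xi>: "\<xi> \<ge> 0" for \<xi>
  proof -
    define z where "z = half_inverse f \<xi>"
    have z: "z \<ge> 0" "f z = \<xi>" using f.inverse \<xi> by (auto simp: z_def)
    have "z \<le> \<xi> + \<beta>" using \<beta>(2)[OF z(1)] z by simp
    then have "z\<^sup>2 \<le> (\<xi> + \<beta>)\<^sup>2" using z by (intro power_mono) auto
    also have "\<dots> \<le> 2 * \<beta>\<^sup>2 + 2 * \<xi>\<^sup>2"
      using zero_le_power2[of "\<xi> - \<beta>"] by (simp add: power2_eq_square algebra_simps)
    finally have "3 * C1 * z\<^sup>2 \<le> 3 * C1 * (2 * \<beta>\<^sup>2 + 2 * \<xi>\<^sup>2)" using C1_pos by (intro mult_left_mono) auto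
    then have "k * exp (- (6 * C1) * \<beta>\<^sup>2 + - (6 * C1) * \<xi>\<^sup>2) \<le> k * exp (- (3 * C1) * z\<^sup>2)"
      using k(1) by (simp add: algebra_simps)
    also have "\<dots> \<le> 1 - f1 z" by (rule k(2)[OF z(1)])
    also have "\<dots> \<le> 1 - \<Omega> \<xi>"
      using f1_nonneg[OF z(1)] f1_less_one[OF z(1)] by (simp add: \<Omega>_def z_def[symmetric] power2_eq_square mult_left_le)
    finally show ?thesis by (simp only: exp_add mult.assoc)
  qed
  then show ?thesis using k C1_pos
    by (intro exI[of _ "k * exp (- (6 * C1) * \<beta>\<^sup>2)"] conjI exI[of _ "6 * C1"]) auto
qed

text \<open>A large shift \<open>s\<close> flattens the Blasius profile. Near the wall its slope
  then drops below a chord slope of the concave \<open>w 0\<close>; far out its defect from 1 decays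
  too slowly to be reached by the Gaussian defect of the datum.\<close>

lemma initial_shift: "\<exists>s\<ge>1. \<forall>t\<ge>0. W s 0 t \<le> w 0 t"
proof -
  obtain k \<gamma> where k: "k > 0" "\<gamma> > 0" "\<And>\<xi>. \<xi> \<ge> 0 \<Longrightarrow> k * exp (- \<gamma> * \<xi>\<^sup>2) \<le> 1 - \<Omega> \<xi>"
    using one_minus_\<Omega>_lower by blast
  \<comment> \<open>From here on \<open>exp (C5 t^2 / 2) \<ge> 2 C4 / k\<close>, so half of the
    Gaussian rate of the datum pays for the prefactors.\<close>
  define T where "T = sqrt (4 * C4 / (k * C5))"
  have T: "T > 0" "T\<^sup>2 = 4 * C4 / (k * C5)" using k C4_pos C5_pos by (auto simp: T_def)
  define m where "m = w 0 T / T"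
  have m: "m > 0" using T w_pos[of 0 T] by (simp add: m_def)
  \<comment> \<open>One summand for \<open>s \<ge> 1\<close>, one for the spread Gaussian rate
    \<open>\<gamma> / s \<le> C5 / 2\<close>, one for the wall slope
    \<open>2 f2 0 / sqrt s \<le> m\<close>.\<close>
  define s where "s = 1 + 2 * \<gamma> / C5 + (2 * f2 0 / m)\<^sup>2"
  have parts: "0 < 2 * \<gamma> / C5" "0 \<le> (2 * f2 0 / m)\<^sup>2" using k C5_pos by auto
  then have s: "s \<ge> 1" "2 * \<gamma> / C5 \<le> s" "(2 * f2 0 / m)\<^sup>2 \<le> s" by (auto simp: s_def)
  have rs: "sqrt s > 0" "2 * f2 0 / m \<le> sqrt s" using s by (auto intro: real_le_rsqrt)
  have "W s 0 t \<le> w 0 t" if t: "t \<ge> 0" for t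
  proof (cases "t \<le> T")
    case True
    show ?thesis
    proof (cases "t = 0")
      case False
      then have t': "t > 0" using t by simp
      have "W s 0 t \<le> 2 * f2 0 * (t / sqrt s)"
        using \<Omega>_linear_upper[of "t / sqrt s"] rs t by (simp add: W_def)
      also have "\<dots> = (2 * f2 0 / sqrt s) * t" by simp
      also have "\<dots> \<le> m * t"
      proof (rule mult_right_mono)
        show "2 * f2 0 / sqrt s \<le> m" using rs m by (simp add: field_simps)
      qed (use t in simp)
      also have "\<dots> \<le> w 0 t"
        using concave_from_zero.ratio[OF w_start_concave t' True] T(1) by (simp add: m_def field_simps)
      finally show ?thesis .
    qed (simp add: W_def w_wall)
  next
    case False
    have "C5 * T\<^sup>2 / 2 = 2 * C4 / k" using k C5_pos by (simp add: T field_simps)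
    moreover have "C5 * T\<^sup>2 \<le> C5 * t\<^sup>2"
      using False T(1) C5_pos by (intro mult_left_mono power_mono) auto
    ultimately have "2 * C4 / k \<le> C5 * t\<^sup>2 / 2" by linarith
    also have "\<dots> \<le> exp (C5 * t\<^sup>2 / 2)" using exp_ge_add_one_self[of "C5 * t\<^sup>2 / 2"] by linarith
    finally have "2 * C4 \<le> k * exp (C5 * t\<^sup>2 / 2)" using k by (simp add: field_simps)
    then have "2 * C4 * exp (- C5 * t\<^sup>2) \<le> k * exp (C5 * t\<^sup>2 / 2) * exp (- C5 * t\<^sup>2)"
      by (intro mult_right_mono) auto
    also have "\<dots> = k * exp (- (C5 * t\<^sup>2 / 2))" by (simp add: mult.assoc flip: exp_add)
    also have "\<dots> \<le> k * exp (- \<gamma> * (t / sqrt s)\<^sup>2)"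
    proof -
      have "2 * \<gamma> \<le> s * C5" using s(2) C5_pos by (simp add: field_simps)
      then have "2 * \<gamma> * t\<^sup>2 \<le> s * C5 * t\<^sup>2" by (intro mult_right_mono) auto
      then have "\<gamma> * t\<^sup>2 / s \<le> C5 * t\<^sup>2 / 2" using s(1) by (simp add: field_simps)
      then show ?thesis using k s(1) by (simp add: power_divide)
    qed
    also have "\<dots> \<le> 1 - \<Omega> (t / sqrt s)" using k(3) rs t by simp
    finally have "2 * C4 * exp (- C5 * t\<^sup>2) \<le> 1 - W s 0 t" by (simp add: W_def)
    then show ?thesis using w_start_decay[OF t] by linarith
  qed
  then show ?thesis using s by blast
qed

definition s0 :: real where "s0 = (SOME s. s \<ge> 1 \<and> (\<forall>t\<ge>0. W s 0 t \<le> w 0 t))"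

lemma s0: "1 \<le> s0" "0 \<le> t \<Longrightarrow> W s0 0 t \<le> w 0 t"
  using someI_ex[of "\<lambda>s. s \<ge> 1 \<and> (\<forall>t\<ge>0. W s 0 t \<le> w 0 t)"] initial_shift
  unfolding s0_def by blast+

text \<open>Where \<open>W\<close> exceeds \<open>w\<close>, concavity of \<open>W\<close> makes
  \<open>(sqrt W - sqrt w) W_tt\<close> nonpositive, so the difference is a subsolution for the
  coefficient \<open>sqrt w\<close>.\<close>

lemma w_lower: assumes "0 \<le> x" "0 \<le> t" shows "W s0 x t \<le> w x t"
proof -
  have s: "s0 > 0" using s0(1) by simp
  have "W s0 x t - w x t \<le> 0"
  proof (rule comparison_principle[where d = "\<lambda>x t. W s0 x t - w x t" and X = x and M = 1 and A = 1
        and dx = "\<lambda>x t. sqrt (W s0 x t) * W2 s0 x t - g x t"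
        and ?d1.0 = "\<lambda>x t. W1 s0 x t - p x t" and ?d2.0 = "\<lambda>x t. W2 s0 x t - q x t"])
    show "continuous_on ({0..x} \<times> {0..}) (\<lambda>(x, t). W s0 x t - w x t)"
      using continuous_on_diff[OF W_cont[OF s] cont_w_strip] by (simp add: split_def)
    show "W s0 y r - w y r \<le> 1" if "0 \<le> y" "y \<le> x" "0 \<le> r" for y r
      using W_bounds[of y s0 r] w_nonneg[of y r] that s by simp
    show "\<exists>a\<ge>0. a \<le> 1 \<and> sqrt (W s0 y r) * W2 s0 y r - g y r \<le> a * (W2 s0 y r - q y r)"
      if yr: "0 < y" "y \<le> x" "0 < r" and d: "W s0 y r - w y r > 0" for y r
    proof (intro exI[of _ "sqrt (w y r)"] conjI)
      have "(sqrt (W s0 y r) - sqrt (w y r)) * W2 s0 y r \<le> 0"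
        using W2_nonpos[of y s0 r] yr s d by (intro mult_nonneg_nonpos) auto
      then show "sqrt (W s0 y r) * W2 s0 y r - g y r \<le> sqrt (w y r) * (W2 s0 y r - q y r)"
        using g_eq[of y r] yr by (simp add: algebra_simps)
      show "sqrt (w y r) \<le> 1" using w_le_one[of y r] yr by simp
    qed (use w_nonneg in auto)
  qed (use assms s0 s w_wall in \<open>auto intro!: w_dt p_dt w_dx W_deriv derivative_eq_intros simp: W_def[of _ _ 0]\<close>)
  then show ?thesis by simp
qed

section \<open>Monotonicity in x, concavity and scaling\<close>

lemma w_linear_lower:
  assumes "0 < X" shows "\<exists>c>0. \<forall>x t. 0 \<le> x \<longrightarrow> x \<le> X \<longrightarrow> 0 \<le> t \<longrightarrow> c * min t 1 \<le> w x t"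
proof -
  define R where "R = sqrt (X + s0)"
  have R: "R \<ge> 1" using assms s0(1) by (simp add: R_def)
  have O1: "\<Omega> 1 > 0" by (rule \<Omega>_pos) simp
  have "\<Omega> 1 / R * min t 1 \<le> w x t" if x: "0 \<le> x" "x \<le> X" and t: "0 \<le> t" for x t
  proof -
    have r: "0 < sqrt (x + s0)" "sqrt (x + s0) \<le> R" using x s0(1) by (auto simp: R_def)
    have "min t 1 / R \<le> min (t / R) 1" using R t by (auto simp: min_def divide_right_mono)
    also have "\<dots> \<le> min (t / sqrt (x + s0)) 1"
      using r t by (intro min.mono divide_left_mono) (auto simp: R_def intro!: mult_pos_pos)
    finally have "\<Omega> 1 * (min t 1 / R) \<le> \<Omega> 1 * min (t / sqrt (x + s0)) 1"
      using O1 by (intro mult_left_mono) auto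
    also have "\<dots> \<le> W s0 x t" using \<Omega>_linear_lower[of "t / sqrt (x + s0)"] r t by (simp add: W_def)
    also have "\<dots> \<le> w x t" by (rule w_lower) fact+
    finally show ?thesis by simp
  qed
  then show ?thesis using O1 R by (intro exI[of _ "\<Omega> 1 / R"]) auto
qed

lemma w_antimono:
  assumes x: "0 \<le> x" and h: "0 < h" and t: "0 \<le> t" shows "w (x + h) t \<le> w x t"
proof -
  define X where "X = x + h"
  have X: "X > 0" "x \<le> X" using x h by (auto simp: X_def)
  obtain M where M: "M > 0" "\<And>s t. 0 \<le> s \<Longrightarrow> s \<le> X + h \<Longrightarrow> 0 \<le> t \<Longrightarrow> w s t \<le> M \<and> w s t \<le> M * t \<and> \<bar>g s t\<bar> \<le> M"
    using w_strip_bounds[of "X + h"] X h by auto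
  obtain c where c: "c > 0" "\<And>s t. 0 \<le> s \<Longrightarrow> s \<le> X + h \<Longrightarrow> 0 \<le> t \<Longrightarrow> c * min t 1 \<le> w s t"
    using w_linear_lower[of "X + h"] X h by auto
  have "w (x + h) t - w x t \<le> 0"
  proof (rule degenerate_comparison_principle[where d = "\<lambda>s t. w (s + h) t - w s t" and X = X and M = M
        and dx = "\<lambda>s t. g (s + h) t - g s t" and ?d1.0 = "\<lambda>s t. p (s + h) t - p s t"
        and ?d2.0 = "\<lambda>s t. q (s + h) t - q s t" and A = 1 and B = "M / c" and c = "sqrt c"])
    have "continuous_on ({0..X} \<times> {0..}) (\<lambda>r. (\<lambda>(s,t). w s t) (fst r + h, snd r))"
      by (rule continuous_on_compose2[OF cont_w]) (use h in \<open>auto intro!: continuous_intros simp: quadrant_def\<close>)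
    then show "continuous_on ({0..X} \<times> {0..}) (\<lambda>(s,t). w (s + h) t - w s t)"
      using cont_w_strip[of X] by (auto simp: split_def intro: continuous_on_diff)
    show "w (s + h) t - w s t \<le> M" "w (s + h) t - w s t \<le> M * t" if "0 \<le> s" "s \<le> X" "0 \<le> t" for s t
      using M(2)[of "s + h" t] that h w_nonneg[of s t] by auto
    show "w (0 + h) t - w 0 t \<le> 0" if "0 \<le> t" for t using w_le_start[of h t] h that by simp
    show "((\<lambda>s. w (s + h) t - w s t) has_real_derivative g (s + h) t - g s t) (at s)" if "0 < s" "0 < t" for s t
      using w_dx[of s t] w_dx[of "s + h" t] that h by (intro DERIV_diff) (auto simp: DERIV_shift)
    show "\<exists>a b. 0 \<le> a \<and> a \<le> 1 \<and> (t \<le> 1 \<longrightarrow> sqrt c * sqrt t \<le> a) \<and> b \<le> M / c * (1 + 1 / t) \<and>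
             g (s + h) t - g s t \<le> a * (q (s + h) t - q s t) + b * (w (s + h) t - w s t)"
      if st: "0 < s" "s \<le> X" "0 < t" and d: "w (s + h) t - w s t > 0" for s t
    proof (intro exI conjI impI)
      define a where "a = sqrt (w (s + h) t)"
      define b where "b = sqrt (w s t)"
      have ab: "a > 0" "b > 0" "b \<le> a" using w_pos[of s t] w_pos[of "s + h" t] st h d by (auto simp: a_def b_def)
      have sq: "a\<^sup>2 = w (s + h) t" "b\<^sup>2 = w s t" using w_nonneg by (auto simp: a_def b_def)
      show "0 \<le> a" "a \<le> 1" using ab w_le_one[of "s + h" t] st h by (auto simp: a_def)
      show "sqrt c * sqrt t \<le> a" if "t \<le> 1"
        using c(2)[of "s + h" t] st h that by (simp add: a_def flip: real_sqrt_mult)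
      show "M / c * (1 + 1 / t) \<le> M / c * (1 + 1 / t)" by simp
      \<comment> \<open>Inserting \<open>(a + b) / b \<ge> 1\<close> turns the difference of the
        roots into the difference of the squares, the quantity being compared.\<close>
      have "(a - b) * q s t \<le> (a - b) * (\<bar>g s t\<bar> / b)"
        using ab by (intro mult_left_mono) (auto simp: q_def b_def[symmetric] divide_right_mono)
      also have "\<dots> \<le> (a - b) * ((a + b) / b) * (\<bar>g s t\<bar> / b)"
      proof -
        have "(a - b) * 1 \<le> (a - b) * ((a + b) / b)" using ab by (intro mult_left_mono) auto
        then show ?thesis using ab by (intro mult_right_mono) auto
      qed
      also have "\<dots> = (a\<^sup>2 - b\<^sup>2) * (\<bar>g s t\<bar> / b\<^sup>2)" by (simp add: power2_eq_square algebra_simps)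
      also have "\<dots> = (w (s + h) t - w s t) * (\<bar>g s t\<bar> / w s t)" by (simp add: sq)
      also have "\<dots> \<le> (w (s + h) t - w s t) * (M / c * (1 + 1 / t))"
      proof (rule mult_left_mono)
        have "\<bar>g s t\<bar> / w s t \<le> M / (c * min t 1)"
          using M(2)[of s t] c(2)[of s t] c(1) st h w_pos[of s t] by (intro frac_le) auto
        also have "\<dots> = M / c * (1 / min t 1)" by simp
        also have "\<dots> \<le> M / c * (1 + 1 / t)" using M c st by (intro mult_left_mono) (auto simp: min_def)
        finally show "\<bar>g s t\<bar> / w s t \<le> M / c * (1 + 1 / t)" .
      qed (use d in simp)
      finally have "(a - b) * q s t \<le> M / c * (1 + 1 / t) * (w (s + h) t - w s t)" by (simp add: mult.commute)
      then show "g (s + h) t - g s t \<le> a * (q (s + h) t - q s t) + M / c * (1 + 1 / t) * (w (s + h) t - w s t)"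
        using g_eq[of s t] g_eq[of "s + h" t] st h by (simp add: a_def b_def algebra_simps)
    qed
  qed (use M c X x t h in \<open>auto intro!: w_dt p_dt derivative_eq_intros\<close>)
  then show ?thesis by simp
qed

lemma g_nonpos: assumes "0 \<le> x" "0 < t" shows "g x t \<le> 0"
proof (cases "x = 0")
  case False
  then have x: "0 < x" using assms by simp
  show ?thesis
  proof (rule ccontr)
    assume "\<not> g x t \<le> 0"
    then obtain d where d: "d > 0" "\<And>h. h > 0 \<Longrightarrow> h < d \<Longrightarrow> w x t < w (x + h) t"
      using DERIV_pos_inc_right[OF w_dx[OF x assms(2)]] by auto
    have "w x t < w (x + d / 2) t" by (rule d(2)) (use d(1) in auto)
    moreover have "w (x + d / 2) t \<le> w x t" by (rule w_antimono) (use assms d(1) in auto)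
    ultimately show False by simp
  qed
qed (use g_start_nonpos assms in simp)

lemma w_concave: "0 \<le> x \<Longrightarrow> concave_from_zero (w x) (p x) (q x)"
  by (rule concave_w) (use g_nonpos in auto)

lemma q_nonpos: "0 \<le> x \<Longrightarrow> 0 < t \<Longrightarrow> q x t \<le> 0"
  using concave_from_zero.neg[OF w_concave] .

lemma p_nonneg: "0 \<le> x \<Longrightarrow> 0 < t \<Longrightarrow> 0 \<le> p x t"
  using concave_from_zero.slope_nonneg[OF w_concave, of x 0 t] w_nonneg by auto

lemma w_mono: assumes "0 \<le> x" "0 \<le> s" "s \<le> t" shows "w x s \<le> w x t"
  by (rule deriv_nonneg_mono[OF assms(3), of _ "p x"])
     (use assms in \<open>auto intro!: w_dt p_nonneg intro: continuous_on_subset[OF continuous_on_slice[OF cont_w]]\<close>)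

lemma p_le: "0 \<le> x \<Longrightarrow> 0 < t \<Longrightarrow> t * p x t \<le> w x t"
  by (rule concave_from_zero.slope_le[OF w_concave])

lemma w_ratio: "0 \<le> x \<Longrightarrow> 0 < s \<Longrightarrow> s \<le> t \<Longrightarrow> s * w x t \<le> t * w x s"
  by (rule concave_from_zero.ratio[OF w_concave])

text \<open>The dilated solution solves the same equation and is concave by now, so the residual has
  a good sign and no zeroth-order term arises. The initial ordering is the monotonicity of
  \<open>w 0\<close>.\<close>

lemma w_scaling:
  assumes \<mu>: "1 \<le> \<mu>" and x: "0 \<le> x" and t: "0 \<le> t"
  shows "w x t \<le> w (\<mu> * x) (sqrt \<mu> * t)"
proof -
  define r where "r = sqrt \<mu>"
  have r: "r \<ge> 1" "r * r = \<mu>" using \<mu> by (auto simp: r_def)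
  have "w x t - w (\<mu> * x) (r * t) \<le> 0"
  proof (rule comparison_principle[where d = "\<lambda>x t. w x t - w (\<mu> * x) (r * t)" and X = x and M = 1 and A = 1
        and dx = "\<lambda>x t. g x t - g (\<mu> * x) (r * t) * \<mu>"
        and ?d1.0 = "\<lambda>x t. p x t - p (\<mu> * x) (r * t) * r" and ?d2.0 = "\<lambda>x t. q x t - q (\<mu> * x) (r * t) * \<mu>"])
    have "continuous_on ({0..x} \<times> {0..}) (\<lambda>a. (\<lambda>(s,t). w s t) (\<mu> * fst a, r * snd a))"
      by (rule continuous_on_compose2[OF cont_w]) (use r \<mu> in \<open>auto intro!: continuous_intros simp: quadrant_def\<close>)
    then show "continuous_on ({0..x} \<times> {0..}) (\<lambda>(x,t). w x t - w (\<mu> * x) (r * t))"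
      using cont_w_strip[of x] by (auto simp: split_def intro: continuous_on_diff)
    show "w y s - w (\<mu> * y) (r * s) \<le> 1" if "0 \<le> y" "0 \<le> s" for y s
      using w_le_one[OF that] w_nonneg[of "\<mu> * y" "r * s"] by simp
    show "w 0 s - w (\<mu> * 0) (r * s) \<le> 0" if "0 \<le> s" for s
      using w_start_mono[of s "r * s"] that r by (simp add: mult_le_cancel_right1)
    fix y s :: real assume ys: "0 < y" "y \<le> x" "0 < s"
    have ly: "0 < \<mu> * y" "0 < r * s" using ys r \<mu> by auto
    have i1: "((\<lambda>y. \<mu> * y) has_real_derivative \<mu>) (at y)" and i2: "((\<lambda>s. r * s) has_real_derivative r) (at s)"
      using DERIV_cmult_Id by auto
    show "((\<lambda>y. w y s - w (\<mu> * y) (r * s)) has_real_derivative g y s - g (\<mu> * y) (r * s) * \<mu>) (at y)"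
      by (intro DERIV_diff w_dx DERIV_chain2[OF w_dx i1]) (use ys ly in auto)
    show "((\<lambda>s. w y s - w (\<mu> * y) (r * s)) has_real_derivative p y s - p (\<mu> * y) (r * s) * r) (at s)"
      by (intro DERIV_diff w_dt DERIV_chain2[OF w_dt i2]) (use ys ly in auto)
    have "((\<lambda>s. p (\<mu> * y) (r * s) * r) has_real_derivative q (\<mu> * y) (r * s) * r * r) (at s)"
      by (intro DERIV_cmult_right DERIV_chain2[OF p_dt i2]) (use ys ly in auto)
    then show "((\<lambda>s. p y s - p (\<mu> * y) (r * s) * r) has_real_derivative q y s - q (\<mu> * y) (r * s) * \<mu>) (at s)"
      using ys by (intro DERIV_diff p_dt) (auto simp: mult.assoc r(2))
    assume d: "w y s - w (\<mu> * y) (r * s) > 0"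
    show "\<exists>a\<ge>0. a \<le> 1 \<and> g y s - g (\<mu> * y) (r * s) * \<mu> \<le> a * (q y s - q (\<mu> * y) (r * s) * \<mu>)"
    proof (intro exI[of _ "sqrt (w y s)"] conjI)
      have "(sqrt (w y s) - sqrt (w (\<mu> * y) (r * s))) * (q (\<mu> * y) (r * s) * \<mu>) \<le> 0"
        using d q_nonpos[of "\<mu> * y" "r * s"] ly \<mu> by (intro mult_nonneg_nonpos mult_nonpos_nonneg) auto
      then show "g y s - g (\<mu> * y) (r * s) * \<mu> \<le> sqrt (w y s) * (q y s - q (\<mu> * y) (r * s) * \<mu>)"
        using g_eq[of y s] g_eq[of "\<mu> * y" "r * s"] ys ly by (simp add: algebra_simps)
    qed (use ys w_le_one[of y s] w_nonneg in auto)
  qed (use x t w_wall \<mu> in auto)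
  then show ?thesis by (simp add: r_def)
qed

text \<open>Differentiating the monotone family \<open>\<mu> \<mapsto> w (\<mu> x) (sqrt \<mu> t)\<close> at \<open>\<mu> = 1\<close>.\<close>

lemma g_lower: assumes x: "0 < x" and t: "0 < t" shows "- (t * p x t) / (2 * x) \<le> g x t"
proof -
  define \<phi> where "\<phi> \<mu> = w (\<mu> * x) (sqrt \<mu> * t)" for \<mu>
  have cont: "continuous_on ({0<..} \<times> {0<..}) (\<lambda>(s,r). p s r)"
    by (rule continuous_on_subset[OF cont_p]) (auto simp: quadrant_def)
  have "(\<phi> has_real_derivative g (1 * x) (sqrt 1 * t) * x + p (1 * x) (sqrt 1 * t) * (t / 2)) (at 1)"
    unfolding \<phi>_def
  proof (rule chain_rule_two_variables[OF _ _ w_dx w_dt cont])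
    show "((\<lambda>\<mu>. sqrt \<mu> * t) has_real_derivative t / 2) (at 1)"
      by (auto intro!: derivative_eq_intros)
  qed (use x t in \<open>auto intro!: derivative_eq_intros\<close>)
  then have der: "(\<phi> has_real_derivative g x t * x + p x t * (t / 2)) (at 1)" by simp
  have "0 \<le> g x t * x + p x t * (t / 2)"
  proof (rule ccontr)
    assume "\<not> 0 \<le> g x t * x + p x t * (t / 2)"
    then have "((\<lambda>\<mu>. - \<phi> \<mu>) has_real_derivative - (g x t * x + p x t * (t / 2))) (at 1)"
      "0 < - (g x t * x + p x t * (t / 2))" using DERIV_minus[OF der] by auto
    then obtain d where d: "d > 0" "\<And>h. h > 0 \<Longrightarrow> h < d \<Longrightarrow> - \<phi> 1 < - \<phi> (1 + h)"
      using DERIV_pos_inc_right by blast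
    have "\<phi> 1 \<le> \<phi> (1 + d / 2)" using w_scaling[of "1 + d / 2" x t] d(1) x t by (simp add: \<phi>_def)
    then show False using d(1) d(2)[of "d / 2"] by simp
  qed
  then show ?thesis using x by (simp add: field_simps)
qed

text \<open>The unshifted Blasius flow jumps at \<open>x = 0\<close>. It is approached through a
  small shift \<open>\<delta>\<close>, which is above the datum up to an error \<open>e\<close>; the
  shift is then dropped by monotonicity of \<open>\<Omega>\<close>.\<close>

lemma w_upper: assumes x: "0 < x" and t: "0 \<le> t" shows "w x t \<le> \<Omega> (t / sqrt x)"
proof (rule field_le_epsilon)
  fix e :: real assume e: "0 < e"
  obtain \<Xi> where \<Xi>: "\<Xi> > 0" "\<And>\<xi>. \<xi> \<ge> \<Xi> \<Longrightarrow> 1 - e \<le> \<Omega> \<xi>" using \<Omega>_lim[OF e] by blast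
  obtain M where M: "M > 0" "\<And>t. 0 \<le> t \<Longrightarrow> w 0 t \<le> M * t"
    using w_strip_bounds[of 1] by force
  \<comment> \<open>Below the height \<open>\<Xi> sqrt \<delta>\<close> the linear bound
    \<open>M t\<close> for the datum is at most \<open>e\<close>; above it the barrier is at least
    \<open>1 - e\<close>.\<close>
  define \<delta> where "\<delta> = (e / (M * \<Xi>))\<^sup>2"
  have \<delta>: "\<delta> > 0" "sqrt \<delta> = e / (M * \<Xi>)" using e M \<Xi> by (auto simp: \<delta>_def)
  have "w x t - W \<delta> x t \<le> e"
  proof (rule comparison_principle[where d = "\<lambda>x t. w x t - W \<delta> x t" and X = x and M = 1 and A = 1
        and dx = "\<lambda>x t. g x t - sqrt (W \<delta> x t) * W2 \<delta> x t"
        and ?d1.0 = "\<lambda>x t. p x t - W1 \<delta> x t" and ?d2.0 = "\<lambda>x t. q x t - W2 \<delta> x t"])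
    show "continuous_on ({0..x} \<times> {0..}) (\<lambda>(x, t). w x t - W \<delta> x t)"
      using continuous_on_diff[OF cont_w_strip W_cont[OF \<delta>(1)]] by (simp add: split_def)
    show "w y r - W \<delta> y r \<le> 1" if "0 \<le> y" "y \<le> x" "0 \<le> r" for y r
      using W_bounds[of y \<delta> r] w_le_one[of y r] that \<delta> by simp
    show "w 0 r - W \<delta> 0 r \<le> e" if r: "0 \<le> r" for r
    proof (cases "r / sqrt \<delta> \<ge> \<Xi>")
      case True
      then show ?thesis using \<Xi>(2)[OF True] w_start_le_one[OF r] by (simp add: W_def)
    next
      case False
      then have "r < \<Xi> * sqrt \<delta>" using \<delta>(1) by (simp only: not_le pos_divide_less_eq real_sqrt_gt_zero)
      then have "M * r \<le> M * (\<Xi> * sqrt \<delta>)" using M by (intro mult_left_mono) auto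
      also have "\<dots> = e" using M \<Xi> by (simp add: \<delta>(2))
      finally have "M * r \<le> e" .
      then show ?thesis using M(2)[OF r] W_bounds[of 0 \<delta> r] \<delta>(1) r by simp
    qed
    show "\<exists>a\<ge>0. a \<le> 1 \<and> g y r - sqrt (W \<delta> y r) * W2 \<delta> y r \<le> a * (q y r - W2 \<delta> y r)"
      if yr: "0 < y" "y \<le> x" "0 < r" and d: "w y r - W \<delta> y r > e" for y r
    proof (intro exI[of _ "sqrt (w y r)"] conjI)
      have "(sqrt (w y r) - sqrt (W \<delta> y r)) * W2 \<delta> y r \<le> 0"
        using W2_nonpos[of y \<delta> r] yr \<delta>(1) d e by (intro mult_nonneg_nonpos) auto
      then show "g y r - sqrt (W \<delta> y r) * W2 \<delta> y r \<le> sqrt (w y r) * (q y r - W2 \<delta> y r)"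
        using g_eq[of y r] yr by (simp add: algebra_simps)
      show "sqrt (w y r) \<le> 1" using w_le_one[of y r] yr by simp
    qed (use w_nonneg in auto)
  qed (use assms e \<delta> w_wall in \<open>auto intro!: w_dt p_dt w_dx W_deriv derivative_eq_intros simp: W_def[of _ _ 0]\<close>)
  moreover have "W \<delta> x t \<le> \<Omega> (t / sqrt x)"
    unfolding W_def using x t \<delta>(1) by (intro \<Omega>_mono divide_left_mono) (auto intro!: mult_pos_pos)
  ultimately show "w x t \<le> \<Omega> (t / sqrt x) + e" by simp
qed

end

section \<open>Estimates in physical variables\<close>

text \<open>Carries estimates to the wall, where the differential equations are not part of the
  solution concept and the von Mises change degenerates.\<close>

lemma le_at_zero_by_continuity:
  fixes h1 h2 :: "real \<Rightarrow> real"
  assumes "continuous_on {0..} h1" "continuous_on {0..} h2" and le: "\<And>y. 0 < y \<Longrightarrow> h1 y \<le> h2 y"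
  shows "h1 0 \<le> h2 0"
proof (rule tendsto_le[OF trivial_limit_at_right_real])
  have r: "at_right (0::real) \<le> at 0 within {0..}" by (rule at_le) auto
  show "(h1 \<longlongrightarrow> h1 0) (at_right 0)" "(h2 \<longlongrightarrow> h2 0) (at_right 0)"
    using assms(1,2) by (auto simp: continuous_on_def intro: tendsto_mono[OF r])
  show "\<forall>\<^sub>F y in at_right 0. h1 y \<le> h2 y"
    by (auto simp: eventually_at_right_field intro!: exI[of _ 1] le)
qed

lemma gaussian_absorb:
  fixes \<xi> \<kappa> :: real
  assumes "\<kappa> > 0" "0 \<le> \<xi>"
  shows "\<xi> * exp (- \<kappa> * \<xi>\<^sup>2) \<le> (1 + 2 / \<kappa>) * exp (- (\<kappa> / 2) * \<xi>\<^sup>2)"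
proof -
  have "0 \<le> (\<xi> - 1)\<^sup>2 + \<xi>\<^sup>2 + 1" by (intro add_nonneg_nonneg) auto
  then have "\<xi> \<le> 1 + \<xi>\<^sup>2" by (simp add: power2_eq_square algebra_simps)
  also have "\<dots> \<le> (1 + 2 / \<kappa>) * (1 + \<kappa> / 2 * \<xi>\<^sup>2)"
    using assms by (simp add: field_simps)
  also have "\<dots> \<le> (1 + 2 / \<kappa>) * exp (\<kappa> / 2 * \<xi>\<^sup>2)"
    using assms exp_ge_add_one_self[of "\<kappa> / 2 * \<xi>\<^sup>2"] by (intro mult_left_mono) auto
  finally have "\<xi> * exp (- \<kappa> * \<xi>\<^sup>2) \<le> (1 + 2 / \<kappa>) * exp (\<kappa> / 2 * \<xi>\<^sup>2) * exp (- \<kappa> * \<xi>\<^sup>2)"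
    by (intro mult_right_mono) auto
  also have "\<dots> = (1 + 2 / \<kappa>) * exp (- (\<kappa> / 2) * \<xi>\<^sup>2)"
    by (simp add: mult.assoc flip: exp_add)
  finally show ?thesis .
qed

text \<open>The step points away from the wall so that Gaussian weights at \<open>y\<close> dominate
  those on the whole interval. A fixed length loses nothing here because \<open>A\<close> and
  \<open>B\<close> will both be of order \<open>1/x\<close>.\<close>

lemma interpolation_unit_step:
  fixes G G1 G2 :: "real \<Rightarrow> real"
  assumes "0 < y" and D1: "\<And>s. y \<le> s \<Longrightarrow> (G has_real_derivative G1 s) (at s)"
    and D2: "\<And>s. y \<le> s \<Longrightarrow> (G1 has_real_derivative G2 s) (at s)"
    and B: "\<bar>G y\<bar> \<le> A" "\<bar>G (y + 1)\<bar> \<le> A" "\<And>s. y < s \<Longrightarrow> s < y + 1 \<Longrightarrow> \<bar>G2 s\<bar> \<le> B"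
  shows "\<bar>G1 y\<bar> \<le> 2 * A + B"
proof -
  have cont: "continuous_on {y..b} G" "continuous_on {y..b} G1" for b
    using D1 D2 by (auto intro!: continuous_at_imp_continuous_on DERIV_isCont)
  obtain \<eta> where \<eta>: "y < \<eta>" "\<eta> < y + 1" "G (y + 1) - G y = (y + 1 - y) * G1 \<eta>"
    by (rule mvt_open[of y "y + 1" G G1]) (use cont D1 in auto)
  obtain \<zeta> where \<zeta>: "y < \<zeta>" "\<zeta> < \<eta>" "G1 \<eta> - G1 y = (\<eta> - y) * G2 \<zeta>"
    by (rule mvt_open[of y \<eta> G1 G2]) (use \<eta> cont D2 in auto)
  have "\<bar>(\<eta> - y) * G2 \<zeta>\<bar> \<le> 1 * B"
    unfolding abs_mult using \<eta> \<zeta> B(3)[of \<zeta>] by (intro mult_mono) auto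
  then show ?thesis using B \<eta>(3) \<zeta>(3) by (simp add: abs_le_iff)
qed

context prandtl
begin

text \<open>The differentiated quantity is the height at which the Blasius flow of width
  \<open>r\<close> carries the same stream value, minus the actual height. The sign of its
  derivative tells which flow is faster at equal stream value.\<close>

lemma finv_\<Psi>_deriv:
  assumes "0 \<le> x" "0 < y" "0 < r"
  shows "((\<lambda>y. r * half_inverse f (\<Psi> x y / r) - y) has_real_derivative
           u x y / f1 (half_inverse f (\<Psi> x y / r)) - 1) (at y)"
proof -
  have pos: "0 < \<Psi> x y / r" using \<Psi>_pos assms by simp
  have "((\<lambda>y. \<Psi> x y / r) has_real_derivative u x y / r) (at y)"
    by (rule DERIV_cdivide[OF \<Psi>_dy]) (use assms in auto)
  from DERIV_cmult[OF DERIV_chain2[OF finv_deriv[OF pos] this], of r]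
  moreover have "r * (inverse (f1 (half_inverse f (\<Psi> x y / r))) * (u x y / r)) = u x y / f1 (half_inverse f (\<Psi> x y / r))"
    using assms(3) by (simp add: field_simps)
  ultimately have "((\<lambda>y. r * half_inverse f (\<Psi> x y / r)) has_real_derivative
      u x y / f1 (half_inverse f (\<Psi> x y / r))) (at y)" by simp
  then show ?thesis by (intro DERIV_diff DERIV_ident)
qed

lemma finv_\<Psi>_cont:
  assumes "0 \<le> x" "0 < r"
  shows "continuous_on {0..y} (\<lambda>y. r * half_inverse f (\<Psi> x y / r) - y)"
proof -
  have "continuous_on {0..y} (\<lambda>y. \<Psi> x y / r)"
    by (intro continuous_intros continuous_on_subset[OF cont_\<Psi>_slice[OF assms(1)]]) (use assms in auto)
  then have "continuous_on {0..y} (\<lambda>y. half_inverse f (\<Psi> x y / r))"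
    by (rule continuous_on_compose2[OF finv_cont]) (use assms \<Psi>_nonneg in auto)
  then show ?thesis by (intro continuous_on_diff continuous_on_mult_left continuous_on_id)
qed

lemma u_eq_sqrt_w: "0 \<le> x \<Longrightarrow> 0 \<le> y \<Longrightarrow> u x y = sqrt (w x (\<Psi> x y))"
  by (simp add: sqrt_w \<Psi>_nonneg Y_\<Psi>)

lemma u_le_one: "0 \<le> x \<Longrightarrow> 0 \<le> y \<Longrightarrow> u x y \<le> 1"
  using w_le_one[OF _ \<Psi>_nonneg, of x x y] by (simp add: u_eq_sqrt_w)

text \<open>The barrier orders velocities at equal stream value. A slower Blasius flow needs more
  height to carry the same flux, and the first claim records this; it allows the ordering to be
  transferred to equal height.\<close>

lemma u_lower_aux:
  assumes x: "0 \<le> x" and y: "0 \<le> y" and r: "r = sqrt (x + s0)"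
  shows "y / r \<le> half_inverse f (\<Psi> x y / r)" "f1 (half_inverse f (\<Psi> x y / r)) \<le> u x y"
proof -
  have rpos: "0 < r" using x s0(1) by (simp add: r)
  have le: "f1 (half_inverse f (\<Psi> x z / r)) \<le> u x z" if z: "0 \<le> z" for z
  proof -
    have "sqrt (\<Omega> (\<Psi> x z / r)) \<le> sqrt (w x (\<Psi> x z))"
      using w_lower[OF x \<Psi>_nonneg[OF x z]] by (simp add: W_def r)
    then show ?thesis using \<Psi>_nonneg[OF x z] rpos by (simp add: sqrt_\<Omega> u_eq_sqrt_w[OF x z])
  qed
  then show "f1 (half_inverse f (\<Psi> x y / r)) \<le> u x y" using y by simp
  have "r * half_inverse f (\<Psi> x 0 / r) - 0 \<le> r * half_inverse f (\<Psi> x y / r) - y"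
  proof (rule deriv_nonneg_mono[OF y finv_\<Psi>_cont[OF x rpos] finv_\<Psi>_deriv[OF x _ rpos]])
    fix z assume z: "0 < z" "z < y"
    have "f1 (half_inverse f (\<Psi> x z / r)) > 0" using f1_pos[OF f.inverse_pos] \<Psi>_pos[OF x z(1)] rpos by simp
    then show "0 \<le> u x z / f1 (half_inverse f (\<Psi> x z / r)) - 1" using le[of z] z by simp
  qed auto
  then show "y / r \<le> half_inverse f (\<Psi> x y / r)" using rpos by (simp add: field_simps)
qed

lemma u_lower: assumes "0 \<le> x" "0 \<le> y" shows "f1 (y / sqrt (x + s0)) \<le> u x y"
proof -
  have "0 \<le> y / sqrt (x + s0)" using assms s0(1) by simp
  then have "f1 (y / sqrt (x + s0)) \<le> f1 (half_inverse f (\<Psi> x y / sqrt (x + s0)))"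
    by (rule f1_mono) (rule u_lower_aux(1)[OF assms refl])
  then show ?thesis using u_lower_aux(2)[OF assms refl] by simp
qed

text \<open>Converts Gaussian weights in the stream variable into weights in \<open>y\<close>: the
  two differ by at most a multiple of the boundary layer width.\<close>

lemma \<Psi>_lower: "\<exists>\<beta>>0. \<forall>x\<ge>0. \<forall>y\<ge>0. y - \<beta> * sqrt (x + s0) \<le> \<Psi> x y"
proof -
  obtain \<beta> where \<beta>: "\<beta> > 0" "\<And>z. z \<ge> 0 \<Longrightarrow> z - \<beta> \<le> f z" using f_lower by auto
  have "y - \<beta> * sqrt (x + s0) \<le> \<Psi> x y" if xy: "0 \<le> x" "0 \<le> y" for x y
  proof -
    define r where "r = sqrt (x + s0)"
    have r: "0 < r" using xy s0(1) by (simp add: r_def)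
    have P: "0 \<le> \<Psi> x y / r" using \<Psi>_nonneg xy r by simp
    have "y / r - \<beta> \<le> half_inverse f (\<Psi> x y / r) - \<beta>"
      using u_lower_aux(1)[OF xy, of r] by (simp add: r_def)
    also have "\<dots> \<le> \<Psi> x y / r" using \<beta>(2)[OF f.inverse(1)[OF P]] f.inverse(2)[OF P] by simp
    finally have "r * (y / r - \<beta>) \<le> r * (\<Psi> x y / r)" using r by (intro mult_left_mono) auto
    then show ?thesis using r by (simp add: r_def[symmetric] algebra_simps)
  qed
  then show ?thesis using \<beta>(1) by blast
qed

lemma u_upper: assumes x: "0 < x" and y: "0 \<le> y" shows "u x y \<le> f1 (y / sqrt x)"
proof -
  define r where "r = sqrt x"
  have r: "0 < r" using x by (simp add: r_def)
  have x0: "0 \<le> x" using x by simp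
  have le: "u x z \<le> f1 (half_inverse f (\<Psi> x z / r))" if z: "0 \<le> z" for z
  proof -
    have "sqrt (w x (\<Psi> x z)) \<le> sqrt (\<Omega> (\<Psi> x z / r))"
      using w_upper[OF x \<Psi>_nonneg[OF x0 z]] by (simp add: r_def)
    then show ?thesis using \<Psi>_nonneg[OF x0 z] r by (simp add: sqrt_\<Omega> u_eq_sqrt_w[OF x0 z])
  qed
  have "r * half_inverse f (\<Psi> x y / r) - y \<le> r * half_inverse f (\<Psi> x 0 / r) - 0"
  proof (rule deriv_nonpos_antimono[OF y finv_\<Psi>_cont[OF x0 r] finv_\<Psi>_deriv[OF x0 _ r]])
    fix z assume z: "0 < z" "z < y"
    have "f1 (half_inverse f (\<Psi> x z / r)) > 0" using f1_pos[OF f.inverse_pos] \<Psi>_pos[OF x0 z(1)] r by simp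
    then show "u x z / f1 (half_inverse f (\<Psi> x z / r)) - 1 \<le> 0" using le[of z] z by simp
  qed auto
  then have "half_inverse f (\<Psi> x y / r) \<le> y / r" using r by (simp add: field_simps)
  moreover have "0 \<le> half_inverse f (\<Psi> x y / r)" using f.inverse(1) \<Psi>_nonneg[OF x0 y] r by simp
  ultimately have "f1 (half_inverse f (\<Psi> x y / r)) \<le> f1 (y / r)" by (intro f1_mono)
  then show ?thesis using le[OF y] by (simp add: r_def)
qed

section \<open>Concavity, the vertical velocity and the streamwise derivative\<close>

lemma uyy_nonpos: "0 \<le> x \<Longrightarrow> 0 < y \<Longrightarrow> uyy x y \<le> 0"
  using g_nonpos[OF _ \<Psi>_pos, of x x y] Y_\<Psi>[of x y] by (simp add: g_def)

lemma uy_nonneg: "0 \<le> x \<Longrightarrow> 0 < y \<Longrightarrow> 0 \<le> uy x y"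
  using p_nonneg[OF _ \<Psi>_pos, of x x y] Y_\<Psi>[of x y] by (simp add: p_def)

lemma u_concave: "0 \<le> x \<Longrightarrow> concave_from_zero (u x) (uy x) (uyy x)"
  by unfold_locales (use cont_u_slice u_wall u_dy uy_dy uyy_nonpos in auto)

lemma u_mono: assumes "0 \<le> x" "0 \<le> y" "y \<le> z" shows "u x y \<le> u x z"
  by (rule deriv_nonneg_mono[OF assms(3), of _ "uy x"])
     (use assms in \<open>auto intro!: u_dy uy_nonneg intro: continuous_on_subset[OF cont_u_slice]\<close>)

lemma \<Psi>_le: assumes "0 \<le> x" "0 < y" shows "\<Psi> x y \<le> y * u x y"
proof -
  obtain z where z: "0 < z" "z < y" "\<Psi> x y - \<Psi> x 0 = (y - 0) * u x z"
    by (rule mvt_open[OF assms(2), of "\<Psi> x" "u x"])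
       (use assms in \<open>auto intro!: \<Psi>_dy intro: continuous_on_subset[OF cont_\<Psi>_slice]\<close>)
  then show ?thesis using u_mono[of x z y] assms by simp
qed

lemma \<Psi>_le_y: assumes "0 \<le> x" "0 \<le> y" shows "\<Psi> x y \<le> y"
proof (cases "y = 0")
  case False
  then have "y * u x y \<le> y * 1" using u_le_one assms by (intro mult_left_mono) auto
  then show ?thesis using \<Psi>_le[of x y] assms False by linarith
qed simp

text \<open>Using \<open>\<Psi> x y \<le> y u\<close> rather than \<open>\<Psi> x y \<le> y\<close>
  retains a factor \<open>u\<close>, which together with \<open>y uy \<le> u\<close> bounds
  \<open>uyy / u^2\<close> up to the wall.\<close>

lemma uyy_lower: assumes "0 < x" "0 < y" shows "- (y * uy x y / (2 * x)) * u x y \<le> uyy x y"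
proof -
  have "- (\<Psi> x y * (2 * uy x y)) / (2 * x) \<le> 2 * uyy x y"
    using g_lower[OF assms(1) \<Psi>_pos, of x y] Y_\<Psi>[of x y] assms by (simp add: g_def p_def)
  moreover have "\<Psi> x y * uy x y / (2 * x) \<le> y * u x y * uy x y / (2 * x)"
    using \<Psi>_le[of x y] uy_nonneg[of x y] assms by (intro divide_right_mono mult_right_mono) auto
  ultimately show ?thesis using assms by (simp add: field_simps)
qed

lemma y_uy_le_u: "0 \<le> x \<Longrightarrow> 0 < y \<Longrightarrow> y * uy x y \<le> u x y"
  by (rule concave_from_zero.slope_le[OF u_concave])

lemma ux_wall: assumes "0 < x" shows "ux x 0 = 0"
proof -
  have "((\<lambda>s. 0) has_real_derivative ux x 0) (at x)"
    by (rule has_field_derivative_transform_within_open[OF u_dx[OF assms order_refl], of "{0<..}"])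
       (use assms u_wall in auto)
  then show ?thesis using DERIV_const DERIV_unique by blast
qed

text \<open>The divergence equation extends to the wall by continuity, where \<open>ux\<close>
  vanishes with \<open>u\<close>. Consequently \<open>v\<close> is small compared with
  \<open>y\<close>.\<close>

lemma vy_wall: assumes "0 < x" shows "vy x 0 = 0"
proof -
  have "\<forall>X>0. continuous_on (strip X) (\<lambda>(x,y). vy x y)" using sol unfolding oleinik_solution_def by simp
  then have "continuous_on quadrant (\<lambda>(x,y). vy x y)" by (simp add: continuous_on_quadrantI)
  then have c: "continuous_on {0..} (vy x)" "continuous_on {0..} (\<lambda>y. - ux x y)"
    using continuous_on_slice[of vy x] continuous_on_slice[OF cont_ux, of x] assms
    by (auto intro!: continuous_on_minus)
  have "vy x 0 \<le> - ux x 0" "- ux x 0 \<le> vy x 0"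
    by (rule le_at_zero_by_continuity[OF c], use divergence[OF assms] in simp)
       (rule le_at_zero_by_continuity[OF c(2,1)], use divergence[OF assms] in simp)
  then show ?thesis using ux_wall[OF assms] by simp
qed

text \<open>The quotient \<open>v / u\<close> has derivative \<open>- uyy / u\<^sup>2\<close>, which lies between \<open>0\<close> and \<open>1 / (2 x)\<close>.\<close>

lemma v_bounds:
  assumes x: "0 < x" and y: "0 < y" shows "0 \<le> v x y" "v x y / u x y \<le> y / (2 * x)"
proof -
  have upos: "0 < u x s" if "0 < s" for s using u_pos x that by simp
  have step: "0 \<le> v x y / u x y - v x \<epsilon> / u x \<epsilon>" "v x y / u x y - v x \<epsilon> / u x \<epsilon> \<le> y / (2 * x)"
    if \<epsilon>: "0 < \<epsilon>" "\<epsilon> < y" for \<epsilon>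
  proof -
    have der: "((\<lambda>y. v x y / u x y) has_real_derivative - uyy x s / (u x s)\<^sup>2) (at s)" if s: "0 < s" for s
    proof -
      have "((\<lambda>y. v x y / u x y) has_real_derivative (vy x s * u x s - v x s * uy x s) / (u x s * u x s)) (at s)"
        by (rule DERIV_divide[OF v_dy u_dy]) (use x s upos[of s] in auto)
      moreover have "vy x s * u x s - v x s * uy x s = - uyy x s"
        using momentum[OF x s] divergence[OF x s] by (simp add: algebra_simps)
      ultimately show ?thesis by (simp add: power2_eq_square)
    qed
    obtain z where z: "\<epsilon> < z" "z < y" "v x y / u x y - v x \<epsilon> / u x \<epsilon> = (y - \<epsilon>) * (- uyy x z / (u x z)\<^sup>2)"
    proof (rule mvt_open[OF \<epsilon>(2), of "\<lambda>y. v x y / u x y" "\<lambda>s. - uyy x s / (u x s)\<^sup>2"])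
      show "continuous_on {\<epsilon>..y} (\<lambda>y. v x y / u x y)"
        by (rule continuous_at_imp_continuous_on) (use \<epsilon> in \<open>auto intro!: DERIV_isCont der\<close>)
    qed (use der \<epsilon> in auto)
    have z0: "0 < z" using z \<epsilon> by simp
    have n: "0 \<le> - uyy x z / (u x z)\<^sup>2"
      using uyy_nonpos[of x z] x z0 by (intro divide_nonneg_nonneg) auto
    then show "0 \<le> v x y / u x y - v x \<epsilon> / u x \<epsilon>" unfolding z(3) using \<epsilon> by (intro mult_nonneg_nonneg) auto
    have "- uyy x z \<le> z * uy x z * u x z / (2 * x)" using uyy_lower[OF x z0] by simp
    also have "\<dots> \<le> u x z * u x z / (2 * x)"
      using y_uy_le_u[of x z] x z0 upos[OF z0] by (intro divide_right_mono mult_right_mono) auto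
    finally have "- uyy x z / (u x z)\<^sup>2 \<le> 1 / (2 * x)"
      using upos[OF z0] x by (simp add: field_simps power2_eq_square)
    then have "(y - \<epsilon>) * (- uyy x z / (u x z)\<^sup>2) \<le> y * (1 / (2 * x))"
      using n \<epsilon> by (intro mult_mono) auto
    then show "v x y / u x y - v x \<epsilon> / u x \<epsilon> \<le> y / (2 * x)" unfolding z(3) by simp
  qed
  \<comment> \<open>Here \<open>v / \<epsilon>\<close> tends to \<open>vy x 0 = 0\<close>, while
    concavity gives \<open>u x \<epsilon> \<ge> \<epsilon> u x 1\<close>.\<close>
  have lim: "((\<lambda>\<epsilon>. v x \<epsilon> / u x \<epsilon>) \<longlongrightarrow> 0) (at_right 0)"
  proof (rule Lim_null_comparison)
    have "((\<lambda>\<epsilon>. (v x \<epsilon> - v x 0) / (\<epsilon> - 0)) \<longlongrightarrow> vy x 0) (at 0 within {0..})"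
      using prandtl_flow.derivs_within(4)[OF prandtl_flow_axioms, of x 0] x
      by (simp add: has_field_derivative_iff)
    then have "((\<lambda>\<epsilon>. v x \<epsilon> / \<epsilon>) \<longlongrightarrow> 0) (at 0 within {0..})" using v_wall vy_wall x by simp
    then have "((\<lambda>\<epsilon>. v x \<epsilon> / \<epsilon>) \<longlongrightarrow> 0) (at_right 0)" by (rule tendsto_mono[rotated]) (auto intro: at_le)
    from tendsto_divide[OF tendsto_rabs[OF this] tendsto_const, of "u x 1"]
    show "((\<lambda>\<epsilon>. \<bar>v x \<epsilon> / \<epsilon>\<bar> / u x 1) \<longlongrightarrow> 0) (at_right 0)" using upos[of 1] by simp
    show "\<forall>\<^sub>F \<epsilon> in at_right 0. norm (v x \<epsilon> / u x \<epsilon>) \<le> \<bar>v x \<epsilon> / \<epsilon>\<bar> / u x 1"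
      unfolding eventually_at_right_field
    proof (intro exI[of _ 1] conjI allI impI)
      fix \<epsilon> :: real assume \<epsilon>: "0 < \<epsilon>" "\<epsilon> < 1"
      have "\<epsilon> * u x 1 \<le> 1 * u x \<epsilon>" by (rule concave_from_zero.ratio[OF u_concave]) (use x \<epsilon> in auto)
      then have "\<bar>v x \<epsilon>\<bar> / u x \<epsilon> \<le> \<bar>v x \<epsilon>\<bar> / (\<epsilon> * u x 1)"
        using \<epsilon> upos[of 1] upos[of \<epsilon>] by (intro divide_left_mono) auto
      then show "norm (v x \<epsilon> / u x \<epsilon>) \<le> \<bar>v x \<epsilon> / \<epsilon>\<bar> / u x 1" using \<epsilon> upos[of \<epsilon>] by simp
    qed simp
  qed
  have "((\<lambda>\<epsilon>. v x y / u x y - v x \<epsilon> / u x \<epsilon>) \<longlongrightarrow> v x y / u x y - 0) (at_right 0)"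
    by (intro tendsto_intros lim)
  then have lim': "((\<lambda>\<epsilon>. v x y / u x y - v x \<epsilon> / u x \<epsilon>) \<longlongrightarrow> v x y / u x y) (at_right 0)" by simp
  have "\<forall>\<^sub>F \<epsilon> in at_right 0. 0 \<le> v x y / u x y - v x \<epsilon> / u x \<epsilon>"
    "\<forall>\<^sub>F \<epsilon> in at_right 0. v x y / u x y - v x \<epsilon> / u x \<epsilon> \<le> y / (2 * x)"
    unfolding eventually_at_right_field using step y by blast+
  then have "0 \<le> v x y / u x y" "v x y / u x y \<le> y / (2 * x)"
    using tendsto_lowerbound[OF lim'] tendsto_upperbound[OF lim'] by auto
  then show "0 \<le> v x y" "v x y / u x y \<le> y / (2 * x)" using upos[OF y] by (auto simp: zero_le_divide_iff)
qed

text \<open>In \<open>u ux = uyy - v uy\<close> both terms on the right are at most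
  \<open>u y uy / (2 x)\<close> in absolute value, so the degenerate factor \<open>u\<close>
  cancels.\<close>

lemma ux_bound: assumes x: "0 < x" and y: "0 < y" shows "\<bar>ux x y\<bar> \<le> y * uy x y / x"
proof -
  have upos: "0 < u x y" using u_pos x y by simp
  have uyn: "0 \<le> uy x y" using uy_nonneg x y by simp
  have "v x y \<le> y / (2 * x) * u x y" using v_bounds(2)[OF x y] upos by (simp add: divide_le_eq)
  then have v: "0 \<le> v x y * uy x y" "v x y * uy x y \<le> y * uy x y / (2 * x) * u x y"
    using v_bounds(1)[OF x y] uyn mult_right_mono[of "v x y" "y / (2 * x) * u x y" "uy x y"] by (auto simp: mult_ac)
  have "u x y * ux x y = uyy x y - v x y * uy x y" using momentum[OF x y] by simp
  moreover have "- (y * uy x y / (2 * x) * u x y) \<le> uyy x y" "uyy x y \<le> 0"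
    using uyy_lower[OF x y] uyy_nonpos[of x y] x y by simp_all
  ultimately have "\<bar>u x y * ux x y\<bar> \<le> 2 * (y * uy x y / (2 * x) * u x y)"
    using v unfolding abs_le_iff by linarith
  also have "\<dots> = u x y * (y * uy x y / x)" using x by (simp add: field_simps)
  finally have "u x y * \<bar>ux x y\<bar> \<le> u x y * (y * uy x y / x)" using upos by (simp add: abs_mult)
  then show ?thesis using upos by (simp only: mult_le_cancel_left_pos)
qed

text \<open>Concavity bounds \<open>uy\<close> by chord slopes: inside the layer by the chord from
  the wall, outside by the chord from \<open>y / 2\<close>, over which \<open>u\<close> rises by at
  most \<open>1 - u x (y / 2)\<close>.\<close>

lemma uy_gaussian: "\<exists>K>0. \<exists>\<kappa>>0. \<forall>x\<ge>s0. \<forall>y>0. uy x y \<le> K / sqrt x * exp (- \<kappa> * y\<^sup>2 / x)"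
proof -
  obtain K where K: "K > 0" "\<And>z. z \<ge> 0 \<Longrightarrow> 1 - f1 z \<le> K * exp (- (C1 / 2) * z\<^sup>2)" using f1_gaussian by auto
  \<comment> \<open>From \<open>(C1 / 2) (y / 2)^2 / (x + s0) \<ge> C1 y^2 / (16 x)\<close>, valid
    since \<open>s0 \<le> x\<close>.\<close>
  define \<kappa> where "\<kappa> = C1 / 16"
  have \<kappa>: "\<kappa> > 0" using C1_pos by (simp add: \<kappa>_def)
  define K' where "K' = 2 * K + f2 0 * exp \<kappa>"
  have K': "K' > 0" using K(1) f2_pos[of 0] by (auto simp: K'_def intro: add_pos_pos)
  have "uy x y \<le> K' / sqrt x * exp (- \<kappa> * y\<^sup>2 / x)" if x: "x \<ge> s0" and y: "y > 0" for x y
  proof -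
    have x0: "x > 0" using x s0(1) by simp
    define r where "r = sqrt x"
    have r: "r > 0" "r\<^sup>2 = x" using x0 by (auto simp: r_def)
    show ?thesis
    proof (cases "y \<le> r")
      case True
      have "f1 (y / r) \<le> f2 0 * (y / r)"
      proof -
        obtain z where z: "0 < z" "z < y / r" "f1 (y / r) - f1 0 = (y / r - 0) * f2 z"
          by (rule mvt_open[of 0 "y / r" f1 f2])
             (use r y df1 in \<open>auto intro: continuous_on_subset[OF cont_f1]\<close>)
        have "(y / r) * f2 z \<le> (y / r) * f2 0" using f2_antimono[of 0 z] z r y by (intro mult_left_mono) auto
        then show ?thesis using z(3) at_zero by (simp add: mult.commute)
      qed
      then have "y * uy x y \<le> y * (f2 0 / r)"
        using y_uy_le_u[of x y] u_upper[OF x0, of y] x0 y by (simp add: r_def mult.commute)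
      then have "uy x y \<le> f2 0 / r" using y by (simp only: mult_le_cancel_left_pos)
      also have "\<dots> \<le> f2 0 * (exp \<kappa> * exp (- \<kappa> * y\<^sup>2 / x)) / r"
      proof -
        have "y\<^sup>2 \<le> r\<^sup>2" using True y by (intro power_mono) auto
        then have "y\<^sup>2 / x \<le> 1" using r x0 by simp
        then have "\<kappa> * (y\<^sup>2 / x) \<le> \<kappa> * 1" using \<kappa> by (intro mult_left_mono) auto
        then have "1 \<le> exp \<kappa> * exp (- \<kappa> * y\<^sup>2 / x)" by (simp flip: exp_add)
        then have "f2 0 * 1 \<le> f2 0 * (exp \<kappa> * exp (- \<kappa> * y\<^sup>2 / x))"
          using f2_pos[of 0] by (intro mult_left_mono) auto
        then show ?thesis using r by (intro divide_right_mono) auto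
      qed
      also have "\<dots> = (f2 0 * exp \<kappa>) / r * exp (- \<kappa> * y\<^sup>2 / x)" by simp
      also have "\<dots> \<le> K' / r * exp (- \<kappa> * y\<^sup>2 / x)"
        using K(1) r by (intro mult_right_mono divide_right_mono) (auto simp: K'_def)
      finally show ?thesis by (simp add: r_def)
    next
      case False
      have "(y / 2) * uy x y \<le> u x y - u x (y / 2)"
      proof -
        obtain z where z: "y / 2 < z" "z < y" "u x y - u x (y / 2) = (y - y / 2) * uy x z"
          by (rule concave_from_zero.mvt[OF u_concave, of x "y / 2" y]) (use x0 y in auto)
        have "(y / 2) * uy x y \<le> (y / 2) * uy x z"
          using concave_from_zero.slope_antimono[OF u_concave, of x z y] z x0 y by (intro mult_left_mono) auto
        then show ?thesis using z(3) by simp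
      qed
      also have "\<dots> \<le> 1 - f1 (y / 2 / sqrt (x + s0))"
        using u_le_one[of x y] u_lower[of x "y / 2"] x0 y by simp
      also have "\<dots> \<le> K * exp (- (C1 / 2) * (y / 2 / sqrt (x + s0))\<^sup>2)"
        using K(2) y x0 s0(1) by simp
      also have "\<dots> \<le> K * exp (- \<kappa> * y\<^sup>2 / x)"
      proof -
        have "y\<^sup>2 / (8 * x) \<le> (y / 2 / sqrt (x + s0))\<^sup>2"
        proof -
          have "y\<^sup>2 / (8 * x) \<le> y\<^sup>2 / (4 * (x + s0))" using x x0 s0(1) by (intro divide_left_mono) auto
          then show ?thesis using x0 s0(1) by (simp add: power_divide)
        qed
        then have "(C1 / 2) * (y\<^sup>2 / (8 * x)) \<le> (C1 / 2) * (y / 2 / sqrt (x + s0))\<^sup>2"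
          using C1_pos by (intro mult_left_mono) auto
        then show ?thesis using K(1) by (simp add: \<kappa>_def)
      qed
      finally have "uy x y \<le> (2 * K) / y * exp (- \<kappa> * y\<^sup>2 / x)" using y by (simp add: field_simps)
      also have "\<dots> \<le> K' / r * exp (- \<kappa> * y\<^sup>2 / x)"
        using False r K(1) f2_pos[of 0] by (intro mult_right_mono frac_le) (auto simp: K'_def)
      finally show ?thesis by (simp add: r_def)
    qed
  qed
  then show ?thesis using K' \<kappa> by blast
qed

text \<open>Powers of \<open>y / sqrt x\<close> are absorbed by halving the rate, once for each
  factor. The second estimate serves the transport term in the \<open>x\<close>-derivative of
  \<open>uy\<close>.\<close>

lemma y_uy_gaussian:
  "\<exists>K>0. \<exists>\<kappa>>0. \<forall>x\<ge>s0. \<forall>y>0. y * uy x y \<le> K * exp (- \<kappa> * y\<^sup>2 / x) \<and> y / x * (y * uy x y) \<le> K * exp (- \<kappa> * y\<^sup>2 / x)"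
proof -
  obtain K \<kappa> where K: "K > 0" "\<kappa> > 0" "\<And>x y. x \<ge> s0 \<Longrightarrow> y > 0 \<Longrightarrow> uy x y \<le> K / sqrt x * exp (- \<kappa> * y\<^sup>2 / x)"
    using uy_gaussian by blast
  define A where "A = 1 + 2 / \<kappa>"
  define B where "B = 1 + 2 / (\<kappa> / 2)"
  have AB: "A > 0" "B \<ge> 1" using K by (auto simp: A_def B_def add_pos_pos)
  have "y * uy x y \<le> (K * A * B) * exp (- (\<kappa> / 4) * y\<^sup>2 / x) \<and> y / x * (y * uy x y) \<le> (K * A * B) * exp (- (\<kappa> / 4) * y\<^sup>2 / x)"
    if x: "x \<ge> s0" and y: "y > 0" for x y
  proof -
    have x1: "x \<ge> 1" using x s0(1) by simp
    define \<xi> where "\<xi> = y / sqrt x"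
    have \<xi>: "\<xi> > 0" "\<xi>\<^sup>2 = y\<^sup>2 / x" using x1 y by (auto simp: \<xi>_def power_divide)
    have "y * uy x y \<le> y * (K / sqrt x * exp (- \<kappa> * y\<^sup>2 / x))" using K(3)[OF x y] y by (intro mult_left_mono) auto
    also have "\<dots> = K * (\<xi> * exp (- \<kappa> * \<xi>\<^sup>2))" by (simp add: \<xi>(2)) (simp add: \<xi>_def)
    also have "\<dots> \<le> K * (A * exp (- (\<kappa> / 2) * \<xi>\<^sup>2))"
      using gaussian_absorb[of \<kappa> \<xi>] K \<xi> by (intro mult_left_mono) (auto simp: A_def)
    finally have 1: "y * uy x y \<le> K * A * exp (- (\<kappa> / 2) * \<xi>\<^sup>2)" by simp
    have e: "exp (- (\<kappa> / 2) * \<xi>\<^sup>2) \<le> exp (- (\<kappa> / 4) * \<xi>\<^sup>2)" using K by simp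
    have KA: "K * A > 0" using K AB by simp
    have "K * A * exp (- (\<kappa> / 2) * \<xi>\<^sup>2) \<le> K * A * exp (- (\<kappa> / 4) * \<xi>\<^sup>2)"
      using KA e by (intro mult_left_mono) auto
    also have "\<dots> \<le> K * A * B * exp (- (\<kappa> / 4) * \<xi>\<^sup>2)"
      using KA AB by (intro mult_right_mono) (auto simp: mult_le_cancel_left1)
    finally have 2: "y * uy x y \<le> K * A * B * exp (- (\<kappa> / 4) * \<xi>\<^sup>2)" using 1 by simp
    have "y / x \<le> \<xi>"
    proof -
      have "sqrt x \<le> x" using x1 by (intro real_le_lsqrt) (auto simp: power2_eq_square mult_le_cancel_left1)
      then show ?thesis unfolding \<xi>_def using x1 y by (intro divide_left_mono) auto
    qed
    then have "y / x * (y * uy x y) \<le> \<xi> * (K * A * exp (- (\<kappa> / 2) * \<xi>\<^sup>2))"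
      by (rule mult_mono[OF _ 1]) (use \<xi> y x1 uy_nonneg[of x y] in auto)
    also have "\<dots> = K * A * (\<xi> * exp (- (\<kappa> / 2) * \<xi>\<^sup>2))" by simp
    also have "\<dots> \<le> K * A * (B * exp (- (\<kappa> / 2 / 2) * \<xi>\<^sup>2))"
      using gaussian_absorb[of "\<kappa> / 2" \<xi>] K \<xi> KA by (intro mult_left_mono) (auto simp: B_def)
    finally show ?thesis using 2 by (simp add: \<xi>(2) mult.assoc)
  qed
  moreover have "K * A * B > 0" "\<kappa> / 4 > 0" using K AB by auto
  ultimately show ?thesis by blast
qed

text \<open>The range \<open>y / sqrt (2 x) \<le> z\<close> contains every intermediate point
  between Blasius profiles shifted by at most \<open>s0 \<le> x\<close>.\<close>

lemma f2_rescaled_gaussian: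
  "\<exists>K>0. \<exists>\<kappa>>0. \<forall>x\<ge>1. \<forall>y>0. \<forall>z. y / sqrt (x + x) \<le> z \<longrightarrow>
     f2 z \<le> K * exp (- \<kappa> * y\<^sup>2 / x) \<and> y / sqrt x * f2 z \<le> K * exp (- \<kappa> * y\<^sup>2 / x)"
proof -
  obtain K where K: "K > 0" "\<And>z. z \<ge> 0 \<Longrightarrow> f2 z \<le> K * exp (- (C1 / 2) * z\<^sup>2)" using f2_gaussian by auto
  define \<kappa> where "\<kappa> = C1 / 4"
  define A where "A = 1 + 2 / \<kappa>"
  have \<kappa>: "\<kappa> > 0" "A \<ge> 1" using C1_pos by (auto simp: \<kappa>_def A_def)
  have "f2 z \<le> (K * A) * exp (- (\<kappa> / 2) * y\<^sup>2 / x) \<and> y / sqrt x * f2 z \<le> (K * A) * exp (- (\<kappa> / 2) * y\<^sup>2 / x)"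
    if x: "x \<ge> 1" and y: "y > 0" and z: "y / sqrt (x + x) \<le> z" for x y z
  proof -
    define \<xi> where "\<xi> = y / sqrt x"
    have \<xi>: "\<xi> > 0" "\<xi>\<^sup>2 = y\<^sup>2 / x" using x y by (auto simp: \<xi>_def power_divide)
    have z0: "0 \<le> y / sqrt (x + x)" using x y by simp
    have "y\<^sup>2 / (x + x) \<le> z\<^sup>2" using power_mono[OF z z0, of 2] x by (simp add: power_divide)
    then have "\<xi>\<^sup>2 / 2 \<le> z\<^sup>2" by (simp add: \<xi>)
    then have "(C1 / 2) * (\<xi>\<^sup>2 / 2) \<le> (C1 / 2) * z\<^sup>2" using C1_pos by (intro mult_left_mono) auto
    then have "exp (- (C1 / 2) * z\<^sup>2) \<le> exp (- \<kappa> * \<xi>\<^sup>2)" by (simp add: \<kappa>_def)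
    then have "K * exp (- (C1 / 2) * z\<^sup>2) \<le> K * exp (- \<kappa> * \<xi>\<^sup>2)" using K by (intro mult_left_mono) auto
    then have 1: "f2 z \<le> K * exp (- \<kappa> * \<xi>\<^sup>2)" using K(2)[of z] z z0 by linarith
    have "K * exp (- \<kappa> * \<xi>\<^sup>2) \<le> K * A * exp (- (\<kappa> / 2) * \<xi>\<^sup>2)"
    proof (rule mult_mono)
      show "exp (- \<kappa> * \<xi>\<^sup>2) \<le> exp (- (\<kappa> / 2) * \<xi>\<^sup>2)" using \<kappa> by simp
    qed (use K \<kappa> in auto)
    with 1 have 2: "f2 z \<le> K * A * exp (- (\<kappa> / 2) * \<xi>\<^sup>2)" by linarith
    have "\<xi> * f2 z \<le> \<xi> * (K * exp (- \<kappa> * \<xi>\<^sup>2))" using 1 \<xi> by (intro mult_left_mono) auto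
    also have "\<dots> = K * (\<xi> * exp (- \<kappa> * \<xi>\<^sup>2))" by simp
    also have "\<dots> \<le> K * (A * exp (- (\<kappa> / 2) * \<xi>\<^sup>2))"
      using gaussian_absorb[of \<kappa> \<xi>] K \<kappa> \<xi> by (intro mult_left_mono) (auto simp: A_def)
    finally have "\<xi> * f2 z \<le> K * A * exp (- (\<kappa> / 2) * \<xi>\<^sup>2)" by simp
    then show ?thesis using 2 by (simp add: \<xi>(2)) (simp add: \<xi>_def)
  qed
  moreover have "K * A > 0" "\<kappa> / 2 > 0" using K \<kappa> by auto
  ultimately show ?thesis by blast
qed

text \<open>Because \<open>0 < 1 \<le> s0\<close>, the reference flow with shift 1 lies between the
  same two barriers as \<open>u\<close>. Thus the velocity difference is at most the gap of the
  barriers, and each second derivative is separately \<open>O(1/x)\<close>; interpolation does the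
  rest.\<close>

lemma uy_minus_blasius:
  "\<exists>K>0. \<exists>\<kappa>>0. \<forall>x\<ge>s0. \<forall>y>0.
     \<bar>uy x y - f2 (y / sqrt (x + 1)) / sqrt (x + 1)\<bar> \<le> K / x * exp (- \<kappa> * y\<^sup>2 / x)"
proof -
  obtain K \<kappa>1 where K: "K > 0" "\<kappa>1 > 0" "\<And>x y. x \<ge> s0 \<Longrightarrow> y > 0 \<Longrightarrow> y * uy x y \<le> K * exp (- \<kappa>1 * y\<^sup>2 / x)"
    using y_uy_gaussian by blast
  obtain H \<kappa>2 where H: "H > 0" "\<kappa>2 > 0" "\<And>x y z. x \<ge> 1 \<Longrightarrow> y > 0 \<Longrightarrow> y / sqrt (x + x) \<le> z \<Longrightarrow>
      y / sqrt x * f2 z \<le> H * exp (- \<kappa>2 * y\<^sup>2 / x)"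
    using f2_rescaled_gaussian by blast
  define \<kappa> where "\<kappa> = min \<kappa>1 \<kappa>2"
  have \<kappa>: "\<kappa> > 0" "\<kappa> \<le> \<kappa>1" "\<kappa> \<le> \<kappa>2" using K H by (auto simp: \<kappa>_def)
  have "\<bar>uy x y - f2 (y / sqrt (x + 1)) / sqrt (x + 1)\<bar> \<le> (2 * (s0 * H) + (K + H)) / x * exp (- \<kappa> * y\<^sup>2 / x)"
    if x: "x \<ge> s0" and y: "y > 0" for x y
  proof -
    have x1: "x \<ge> 1" "x > 0" using x s0(1) by auto
    define r where "r = sqrt (x + 1)"
    have r: "r > 0" "r\<^sup>2 = x + 1" using x1 by (auto simp: r_def)
    have weaken: "exp (- \<kappa>1 * s\<^sup>2 / x) \<le> exp (- \<kappa> * y\<^sup>2 / x)" "exp (- \<kappa>2 * s\<^sup>2 / x) \<le> exp (- \<kappa> * y\<^sup>2 / x)"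
      if "y \<le> s" for s
    proof -
      have "y\<^sup>2 \<le> s\<^sup>2" using that y by (intro power_mono) auto
      then have "\<kappa> * y\<^sup>2 \<le> \<kappa>1 * s\<^sup>2" "\<kappa> * y\<^sup>2 \<le> \<kappa>2 * s\<^sup>2" using \<kappa> by (auto intro!: mult_mono)
      then show "exp (- \<kappa>1 * s\<^sup>2 / x) \<le> exp (- \<kappa> * y\<^sup>2 / x)" "exp (- \<kappa>2 * s\<^sup>2 / x) \<le> exp (- \<kappa> * y\<^sup>2 / x)"
        using x1 by (auto intro!: divide_right_mono)
    qed
    have G: "\<bar>u x s - f1 (s / r)\<bar> \<le> s0 * H / x * exp (- \<kappa> * y\<^sup>2 / x)" if s: "y \<le> s" for s
    proof -
      define a where "a = s / sqrt (x + s0)"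
      define b where "b = s / sqrt x"
      have s0': "s > 0" using s y by simp
      have ab: "0 < a" "a < b"
        unfolding a_def b_def using s0' x1 s0(1) by (auto intro!: divide_strict_left_mono)
      have "f1 a \<le> u x s" "u x s \<le> f1 b" using u_lower[of x s] u_upper[of x s] x1 s0' by (auto simp: a_def b_def)
      moreover have "f1 a \<le> f1 (s / r)" "f1 (s / r) \<le> f1 b"
        unfolding a_def b_def r_def using s0' x1 s0(1) by (auto intro!: f1_mono divide_left_mono)
      ultimately have diff: "\<bar>u x s - f1 (s / r)\<bar> \<le> f1 b - f1 a" by linarith
      obtain z where z: "a < z" "z < b" "f1 b - f1 a = (b - a) * f2 z"
        by (rule mvt_open[OF ab(2), of f1 f2]) (use ab df1 in \<open>auto intro: continuous_on_subset[OF cont_f1]\<close>)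
      \<comment> \<open>The relative gap of the similarity variables is at most
        \<open>s0 / x\<close>; this is where the rate \<open>1/x\<close> of the sandwich comes
        from.\<close>
      have "b - a \<le> s0 / x * b"
      proof -
        have le: "sqrt x \<le> sqrt (x + s0)" using s0(1) by simp
        have "sqrt (x + s0) \<le> sqrt x * (1 + s0 / x)"
        proof (rule real_le_lsqrt)
          have "x + s0 \<le> x * (1 + s0 / x) * (1 + s0 / x)"
            using x1 s0(1) by (simp add: field_simps)
          then show "x + s0 \<le> (sqrt x * (1 + s0 / x))\<^sup>2"
            using x1 by (simp add: power_mult_distrib) (simp add: power2_eq_square mult_ac)
        qed (use x1 s0(1) in auto)
        then have "s / sqrt (x + s0) \<ge> s / (sqrt x * (1 + s0 / x))"
          using s0' x1 s0(1) by (intro divide_left_mono) (auto intro!: mult_pos_pos add_pos_pos)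
        also have "s / (sqrt x * (1 + s0 / x)) = b / (1 + s0 / x)" by (simp add: b_def)
        finally have "b / (1 + s0 / x) \<le> a" by (simp add: a_def)
        moreover have "b - b / (1 + s0 / x) \<le> s0 / x * b"
        proof -
          define \<theta> where "\<theta> = s0 / x"
          have \<theta>: "\<theta> > 0" using x1 s0(1) by (simp add: \<theta>_def)
          have "b - b / (1 + \<theta>) = \<theta> * b / (1 + \<theta>)" using \<theta> by (simp add: field_simps)
          also have "\<dots> \<le> \<theta> * b / 1" using \<theta> ab by (intro divide_left_mono) auto
          finally show ?thesis by (simp add: \<theta>_def)
        qed
        ultimately show ?thesis by linarith
      qed
      then have "(b - a) * f2 z \<le> s0 / x * b * f2 z" using f2_pos[of z] z ab by (intro mult_right_mono) auto
      also have "\<dots> = s0 / x * (s / sqrt x * f2 z)" by (simp add: b_def)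
      also have "\<dots> \<le> s0 / x * (H * exp (- \<kappa>2 * s\<^sup>2 / x))"
      proof (intro mult_left_mono H(3)[OF x1(1) s0'])
        have "s / sqrt (x + x) \<le> a" unfolding a_def using s0' x x1 s0(1) by (intro divide_left_mono) auto
        then show "s / sqrt (x + x) \<le> z" using z by simp
      qed (use s0(1) x1 in auto)
      also have "\<dots> \<le> s0 / x * (H * exp (- \<kappa> * y\<^sup>2 / x))"
        using weaken(2)[OF s] H s0(1) x1 by (intro mult_left_mono) auto
      finally show ?thesis using z(3) diff by simp
    qed
    have G2: "\<bar>uyy x s - f3 (s / r) / r\<^sup>2\<bar> \<le> (K + H) / x * exp (- \<kappa> * y\<^sup>2 / x)" if s: "y < s" for s
    proof -
      have s0': "s > 0" using s y by simp
      have "\<bar>uyy x s\<bar> \<le> s * uy x s / (2 * x) * u x s"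
        using uyy_lower[of x s] uyy_nonpos[of x s] x1 s0' by simp
      also have "\<dots> \<le> s * uy x s / (2 * x) * 1"
        using u_le_one[of x s] uy_nonneg[of x s] x1 s0' by (intro mult_left_mono) auto
      also have "\<dots> = s * uy x s * (1 / (2 * x))" by simp
      also have "\<dots> \<le> K * exp (- \<kappa>1 * s\<^sup>2 / x) * (1 / x)"
        by (rule mult_mono[OF K(3)[OF x s0']]) (use K(1) x1 in \<open>auto intro!: divide_left_mono\<close>)
      also have "\<dots> \<le> K * exp (- \<kappa> * y\<^sup>2 / x) * (1 / x)"
        using weaken(1)[of s] s K x1 by (intro mult_right_mono mult_left_mono) auto
      finally have 1: "\<bar>uyy x s\<bar> \<le> K * exp (- \<kappa> * y\<^sup>2 / x) / x" by simp
      define z where "z = s / r"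
      have z: "z > 0" using s0' r by (simp add: z_def)
      have "\<bar>f3 z\<bar> = f z * f2 z / 2" using f3_eq[of z] f_nonneg[of z] f2_pos[of z] z by (simp add: abs_mult)
      also have "\<dots> \<le> z * f2 z" using f_le[of z] f_nonneg[of z] f2_pos[of z] z
        by (simp add: mult_le_cancel_right)
      also have "\<dots> \<le> s / sqrt x * f2 z"
        unfolding z_def r_def using f2_pos[of "s / sqrt (x + 1)"] s0' x1 by (intro mult_right_mono divide_left_mono) (auto simp: less_imp_le)
      also have "\<dots> \<le> H * exp (- \<kappa>2 * s\<^sup>2 / x)"
        by (rule H(3)[OF x1(1) s0']) (use s0' x1 in \<open>auto simp: z_def r_def intro!: divide_left_mono\<close>)
      also have "\<dots> \<le> H * exp (- \<kappa> * y\<^sup>2 / x)" using weaken(2)[of s] s H by (intro mult_left_mono) auto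
      finally have "\<bar>f3 z / r\<^sup>2\<bar> \<le> H * exp (- \<kappa> * y\<^sup>2 / x) / x"
        using r x1 H unfolding abs_divide by (intro frac_le) auto
      with 1 have "\<bar>uyy x s - f3 z / r\<^sup>2\<bar>
          \<le> K * exp (- \<kappa> * y\<^sup>2 / x) / x + H * exp (- \<kappa> * y\<^sup>2 / x) / x" by linarith
      then show ?thesis by (simp add: z_def add_divide_distrib distrib_right)
    qed
    have dr: "((\<lambda>s. s / r) has_real_derivative 1 / r) (at s)" for s
      by (rule DERIV_cdivide[OF DERIV_ident])
    have "\<bar>uy x y - f2 (y / r) / r\<bar> \<le> 2 * (s0 * H / x * exp (- \<kappa> * y\<^sup>2 / x)) + (K + H) / x * exp (- \<kappa> * y\<^sup>2 / x)"
    proof (rule interpolation_unit_step[where G = "\<lambda>s. u x s - f1 (s / r)" and ?G1.0 = "\<lambda>s. uy x s - f2 (s / r) / r"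
          and ?G2.0 = "\<lambda>s. uyy x s - f3 (s / r) / r\<^sup>2", OF y _ _ G[of y] G[of "y + 1"] G2])
      fix s assume s: "y \<le> s"
      have s0': "0 < s" "0 < s / r" using s y r by auto
      show "((\<lambda>s. u x s - f1 (s / r)) has_real_derivative uy x s - f2 (s / r) / r) (at s)"
        using DERIV_diff[OF u_dy DERIV_chain2[OF df1[OF s0'(2)] dr], of x] x1 s0' by simp
      show "((\<lambda>s. uy x s - f2 (s / r) / r) has_real_derivative uyy x s - f3 (s / r) / r\<^sup>2) (at s)"
        using DERIV_diff[OF uy_dy DERIV_cdivide[OF DERIV_chain2[OF df2[OF s0'(2)] dr], of r], of x] x1 s0'
        by (simp add: power2_eq_square)
    qed auto
    then show ?thesis by (simp add: r_def add_divide_distrib distrib_right)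
  qed
  moreover have "2 * (s0 * H) + (K + H) > 0" using K H s0(1) by (intro add_pos_pos) auto
  ultimately show ?thesis using \<kappa> by blast
qed


section \<open>Regularity in the streamwise variable\<close>

lemma p_gaussian: "\<exists>K>0. \<exists>\<kappa>>0. \<forall>x\<ge>s0. \<forall>t>0. p x t \<le> K / sqrt x * exp (- \<kappa> * t\<^sup>2 / x)"
proof -
  obtain K \<kappa> where K: "K > 0" "\<kappa> > 0" "\<And>x y. x \<ge> s0 \<Longrightarrow> y > 0 \<Longrightarrow> uy x y \<le> K / sqrt x * exp (- \<kappa> * y\<^sup>2 / x)"
    using uy_gaussian by blast
  have "p x t \<le> (2 * K) / sqrt x * exp (- \<kappa> * t\<^sup>2 / x)" if x: "x \<ge> s0" and t: "t > 0" for x t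
  proof -
    have x0: "x > 0" using x s0(1) by simp
    define y where "y = Y x t"
    have y: "y > 0" "t \<le> y" using Y_pos[of x t] \<Psi>_le_y[of x y] \<Psi>_Y[of x t] x0 t by (auto simp: y_def)
    have "\<kappa> * t\<^sup>2 \<le> \<kappa> * y\<^sup>2" using K y t by (intro mult_left_mono power_mono) auto
    then have "exp (- \<kappa> * y\<^sup>2 / x) \<le> exp (- \<kappa> * t\<^sup>2 / x)" using x0 by (simp add: divide_right_mono)
    then have "K / sqrt x * exp (- \<kappa> * y\<^sup>2 / x) \<le> K / sqrt x * exp (- \<kappa> * t\<^sup>2 / x)"
      using K x0 by (intro mult_left_mono) auto
    then show ?thesis using K(3)[OF x y(1)] by (simp add: p_def y_def)
  qed
  then show ?thesis using K by (intro exI[of _ "2 * K"] conjI exI[of _ \<kappa>]) auto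
qed

lemma g_abs_le: assumes "0 < x" "0 < t" shows "\<bar>g x t\<bar> \<le> t * p x t / (2 * x)" "\<bar>g x t\<bar> \<le> w x t / (2 * x)"
proof -
  show 1: "\<bar>g x t\<bar> \<le> t * p x t / (2 * x)" using g_lower[OF assms] g_nonpos[of x t] assms by simp
  also have "\<dots> \<le> w x t / (2 * x)" using p_le[of x t] assms by (intro divide_right_mono) auto
  finally show "\<bar>g x t\<bar> \<le> w x t / (2 * x)" .
qed

lemma w_antimono': "0 \<le> x \<Longrightarrow> x \<le> x' \<Longrightarrow> 0 \<le> t \<Longrightarrow> w x' t \<le> w x t"
  using w_antimono[of x "x' - x" t] by (cases "x = x'") auto

text \<open>Apply the local slope estimate to the difference quotient of \<open>w\<close> in
  \<open>x\<close>, on a parabolic cylinder adapted to the degeneracy. The quotient is bounded by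
  \<open>g\<close> through the mean value theorem, and the varying coefficient only contributes a
  source of size \<open>M / x\<close>.\<close>

lemma p_difference_pos:
  "\<exists>K>0. \<exists>\<kappa>>0. \<forall>x\<ge>2 * s0. \<forall>t>0. \<forall>h. 0 < h \<longrightarrow> h \<le> x \<longrightarrow>
     \<bar>p (x + h) t - p x t\<bar> \<le> h * (K / x * exp (- \<kappa> * t\<^sup>2 / x))"
proof -
  obtain K \<kappa>0 where K: "K > 0" "\<kappa>0 > 0" "\<And>x t. x \<ge> s0 \<Longrightarrow> t > 0 \<Longrightarrow> p x t \<le> K / sqrt x * exp (- \<kappa>0 * t\<^sup>2 / x)"
    using p_gaussian by blast
  define \<kappa> where "\<kappa> = \<kappa>0 / 8"
  have \<kappa>: "\<kappa> > 0" using K by (simp add: \<kappa>_def)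
  define O1 where "O1 = sqrt (\<Omega> 1)"
  have O1: "O1 > 0" using \<Omega>_pos[of 1] by (simp add: O1_def)
  \<comment> \<open>The bound \<open>1 / 2\<close> keeps the cylinder above height
    \<open>t / 2\<close>; the bound \<open>O1 / 4\<close> keeps its depth \<open>r^2 / a0\<close>
    within \<open>x / 2\<close>.\<close>
  define c where "c = min (1 / 2) (O1 / 4)"
  have c: "c > 0" "c \<le> 1 / 2" "c \<le> O1 / 4" using O1 by (auto simp: c_def)
  define H where "H = 15 * (3 * K) / c * (2 + 2 / \<kappa>)"
  have H: "H > 0" using K c \<kappa> by (auto simp: H_def intro!: mult_pos_pos divide_pos_pos add_pos_pos)
  have "\<bar>p (x + h) t - p x t\<bar> \<le> h * (H / x * exp (- (\<kappa> / 2) * t\<^sup>2 / x))"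
    if x: "x \<ge> 2 * s0" and t: "t > 0" and h: "0 < h" "h \<le> x" for x t h
  proof -
    have x1: "x \<ge> 1" "x > 0" "x \<ge> s0" using x s0(1) by auto
    define S where "S = sqrt x"
    have S: "S > 0" "S\<^sup>2 = x" "S \<ge> 1" using x1 by (auto simp: S_def)
    define \<xi> where "\<xi> = t / S"
    have \<xi>: "\<xi> > 0" "\<xi>\<^sup>2 = t\<^sup>2 / x" using t S by (auto simp: \<xi>_def power_divide)
    define m where "m = min \<xi> 1"
    have m: "0 < m" "m \<le> 1" "m \<le> \<xi>" using \<xi> by (auto simp: m_def)
    \<comment> \<open>By monotonicity in both variables, \<open>w\<close> is smallest at late
      \<open>x\<close> and low \<open>t\<close>, so this bounds the diffusion from below at all
      points used.\<close>
    define a0 where "a0 = sqrt (w (2 * x) (t / 2))"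
    have a0: "a0 > 0" "a0\<^sup>2 = w (2 * x) (t / 2)"
      using w_pos[of "2 * x" "t / 2"] w_nonneg x1 t by (auto simp: a0_def)
    \<comment> \<open>The true order is \<open>sqrt m\<close>; the cruder \<open>m^2\<close> matches
      the radius \<open>r = c S m\<close> and suffices.\<close>
    have a0_lower: "O1 / 2 * m\<^sup>2 \<le> a0"
    proof (rule power2_le_imp_le)
      have "m ^ 4 \<le> m" using power_decreasing[of 1 4 m] m by simp
      have "(O1 / 2 * m\<^sup>2)\<^sup>2 = \<Omega> 1 / 4 * m ^ 4"
        using \<Omega>_pos[of 1] by (simp add: O1_def power_mult_distrib power_divide)
      also have "\<dots> \<le> \<Omega> 1 / 4 * m" using \<open>m ^ 4 \<le> m\<close> \<Omega>_pos[of 1] by (intro mult_left_mono) auto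
      also have "\<dots> \<le> \<Omega> 1 * min (\<xi> / 4) 1"
      proof -
        have "m / 4 \<le> min (\<xi> / 4) 1" using m by simp
        then have "\<Omega> 1 * (m / 4) \<le> \<Omega> 1 * min (\<xi> / 4) 1" using \<Omega>_pos[of 1] by (intro mult_left_mono) auto
        then show ?thesis by simp
      qed
      also have "\<dots> \<le> \<Omega> (\<xi> / 4)" using \<Omega>_linear_lower[of "\<xi> / 4"] \<xi> by simp
      also have "\<dots> \<le> W s0 (2 * x) (t / 2)"
        unfolding W_def
      proof (rule \<Omega>_mono)
        have "sqrt (2 * x + s0) \<le> sqrt (4 * x)" using x1 by simp
        then have "sqrt (2 * x + s0) \<le> 2 * S" by (simp add: S_def real_sqrt_mult)
        then have "t / 2 / (2 * S) \<le> t / 2 / sqrt (2 * x + s0)"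
          using t x1 s0(1) S by (intro divide_left_mono) auto
        then show "\<xi> / 4 \<le> t / 2 / sqrt (2 * x + s0)" by (simp add: \<xi>_def)
      qed (use \<xi> in simp)
      also have "\<dots> \<le> a0\<^sup>2" unfolding a0(2) by (rule w_lower) (use x1 t in auto)
      finally show "(O1 / 2 * m\<^sup>2)\<^sup>2 \<le> a0\<^sup>2" .
    qed (use a0 in simp)
    define r where "r = c * S * m"
    have r: "r > 0" using c S m by (simp add: r_def)
    have rt: "r \<le> t / 2"
    proof -
      have "c * (S * m) \<le> 1 / 2 * (S * \<xi>)" using c m S by (intro mult_mono) auto
      then show ?thesis using S by (simp add: r_def \<xi>_def mult.assoc)
    qed
    have r2: "r\<^sup>2 \<le> a0 * x / 2"
    proof -
      have "c * c \<le> O1 / 4 * 1" using c by (intro mult_mono) auto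
      then have "c\<^sup>2 * (x * m\<^sup>2) \<le> O1 / 4 * (x * m\<^sup>2)" using x1 by (intro mult_right_mono) (auto simp: power2_eq_square)
      also have "\<dots> = (O1 / 2 * m\<^sup>2) * (x / 2)" by simp
      also have "\<dots> \<le> a0 * (x / 2)" using a0_lower x1 by (intro mult_right_mono) auto
      finally show ?thesis by (simp add: r_def power_mult_distrib S(2) mult_ac)
    qed
    have T: "r\<^sup>2 / a0 \<le> x / 2" using r2 a0 by (simp add: divide_le_eq mult_ac)
    define M where "M = 3 * K * t / (x * S) * exp (- \<kappa> * \<xi>\<^sup>2)"
    have M: "M > 0" using K t x1 S by (simp add: M_def)
    have gM: "\<bar>g y s\<bar> \<le> M" if y: "x / 2 \<le> y" "y \<le> 2 * x" and s: "t / 2 \<le> s" "s \<le> 3 * t / 2" for y s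
    proof -
      have y0: "y > 0" "y \<ge> s0" using y x x1 by auto
      have sp: "s > 0" using s t by simp
      have "p y s \<le> K / sqrt y * exp (- \<kappa>0 * s\<^sup>2 / y)" by (rule K(3)) fact+
      also have "\<dots> \<le> K * 2 / S * exp (- \<kappa> * \<xi>\<^sup>2)"
      proof (rule mult_mono)
        have "S / 2 \<le> sqrt y"
        proof (rule real_le_rsqrt)
          show "(S / 2)\<^sup>2 \<le> y" using y x1 by (simp add: power_divide S(2))
        qed
        then have "K / sqrt y \<le> K / (S / 2)" using K S y0 by (intro divide_left_mono) auto
        then show "K / sqrt y \<le> K * 2 / S" by simp
        have "(t / 2)\<^sup>2 / (2 * x) \<le> s\<^sup>2 / y"
          using y y0 s t x1 by (intro frac_le power_mono) auto
        then have "\<kappa>0 * ((t / 2)\<^sup>2 / (2 * x)) \<le> \<kappa>0 * (s\<^sup>2 / y)" using K by (intro mult_left_mono) auto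
        then show "exp (- \<kappa>0 * s\<^sup>2 / y) \<le> exp (- \<kappa> * \<xi>\<^sup>2)"
          by (simp add: \<kappa>_def \<xi>(2) power_divide)
      qed (use K S in auto)
      finally have py: "p y s \<le> K * 2 / S * exp (- \<kappa> * \<xi>\<^sup>2)" .
      have "\<bar>g y s\<bar> \<le> s * p y s / (2 * y)" by (rule g_abs_le(1)) fact+
      also have "\<dots> \<le> (3 * t / 2) * (K * 2 / S * exp (- \<kappa> * \<xi>\<^sup>2)) / x"
        using s sp t y x1 py p_nonneg[of y s] y0 K S by (intro frac_le mult_mono) auto
      also have "\<dots> = M" by (simp add: M_def mult_ac)
      finally show ?thesis .
    qed
    have "\<bar>(p (x + h) t - p x t) / h\<bar> \<le> M * (2 + 4 * (3 * a0) / a0) / r + M / x * r / a0"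
    proof (rule local_lipschitz_slope[where z = "\<lambda>y s. (w (y + h) s - w y s) / h" and zx = "\<lambda>y s. (g (y + h) s - g y s) / h"
          and ?z1.0 = "\<lambda>y s. (p (y + h) s - p y s) / h" and ?z2.0 = "\<lambda>y s. (q (y + h) s - q y s) / h"
          and a = "\<lambda>y s. sqrt (w (y + h) s)"])
      have "continuous_on ({x - r\<^sup>2 / a0..x} \<times> {t - r..t + r}) (\<lambda>a. (\<lambda>(y,s). w y s) (fst a + h, snd a))"
        by (rule continuous_on_compose2[OF cont_w])
           (use T rt h x1 t in \<open>auto intro!: continuous_intros simp: quadrant_def\<close>)
      moreover have "continuous_on ({x - r\<^sup>2 / a0..x} \<times> {t - r..t + r}) (\<lambda>(y,s). w y s)"
        by (rule continuous_on_subset[OF cont_w]) (use T rt x1 t in \<open>auto simp: quadrant_def\<close>)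
      ultimately show "continuous_on ({x - r\<^sup>2 / a0..x} \<times> {t - r..t + r}) (\<lambda>(y,s). (w (y + h) s - w y s) / h)"
        using h by (auto simp: split_def intro!: continuous_intros)
    next
      fix y s assume "x - r\<^sup>2 / a0 \<le> y" "y \<le> x" "t - r \<le> s" "s \<le> t + r"
      then have ys: "x / 2 \<le> y" "y \<le> x" "t / 2 \<le> s" "s \<le> 3 * t / 2" "0 < y" "0 < s" using T rt x1 t by auto
      obtain z where z: "y < z" "z < y + h" "w (y + h) s - w y s = (y + h - y) * g z s"
      proof (rule mvt_open[of y "y + h" "\<lambda>y. w y s" "\<lambda>y. g y s"])
        show "continuous_on {y..y + h} (\<lambda>y. w y s)"
          by (rule continuous_at_imp_continuous_on) (use ys in \<open>auto intro!: DERIV_isCont w_dx\<close>)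
      qed (use ys h in \<open>auto intro!: w_dx\<close>)
      then show "\<bar>(w (y + h) s - w y s) / h\<bar> \<le> M" using gM[of z s] ys h by simp
    next
      fix y s assume ys': "x - r\<^sup>2 / a0 < y" "y \<le> x" "t - r < s" "s < t + r"
      then have ys: "x / 2 \<le> y" "y \<le> x" "t / 2 \<le> s" "s \<le> 3 * t / 2" "0 < y" "0 < s" using T rt x1 t by auto
      have yh: "0 < y + h" "y + h \<le> 2 * x" "x / 2 \<le> y + h" using ys h by auto
      show "((\<lambda>y. (w (y + h) s - w y s) / h) has_real_derivative (g (y + h) s - g y s) / h) (at y)"
        using w_dx[of y s] w_dx[of "y + h" s] ys yh by (intro DERIV_cdivide DERIV_diff) (auto simp: DERIV_shift)
      show "((\<lambda>s. (w (y + h) s - w y s) / h) has_real_derivative (p (y + h) s - p y s) / h) (at s)"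
        by (intro DERIV_cdivide DERIV_diff w_dt) (use ys yh in auto)
      show "((\<lambda>s. (p (y + h) s - p y s) / h) has_real_derivative (q (y + h) s - q y s) / h) (at s)"
        by (intro DERIV_cdivide DERIV_diff p_dt) (use ys yh in auto)
      have "w (2 * x) (t / 2) \<le> w (y + h) (t / 2)" by (rule w_antimono') (use yh t in auto)
      also have "\<dots> \<le> w (y + h) s" by (rule w_mono) (use yh t ys in auto)
      finally have lo: "w (2 * x) (t / 2) \<le> w (y + h) s" .
      have "w (y + h) s \<le> w (x / 2) s" by (rule w_antimono') (use yh x1 ys in auto)
      also have "\<dots> \<le> w (x / 2) (3 * t / 2)" by (rule w_mono) (use ys x1 in auto)
      \<comment> \<open>A Harnack-type comparison: concavity trades the heights
        \<open>3 t / 2\<close> and \<open>t / 4\<close> at cost 6, and the dilation with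
        \<open>\<mu> = 4\<close> leads from \<open>(x / 2, t / 4)\<close> to
        \<open>(2 x, t / 2)\<close>. Hence the diffusion varies by a factor of at most 3.\<close>
      also have "\<dots> \<le> 6 * w (x / 2) (t / 4)"
        using w_ratio[of "x / 2" "t / 4" "3 * t / 2"] x1 t by (simp add: field_simps)
      also have "\<dots> \<le> 6 * w (2 * x) (t / 2)" using w_scaling[of 4 "x / 2" "t / 4"] x1 t by simp
      also have "\<dots> \<le> (3 * a0)\<^sup>2" using a0 w_nonneg[of "2 * x" "t / 2"] by (simp add: power_mult_distrib)
      finally have "sqrt (w (y + h) s) \<le> 3 * a0" using a0(1) by (intro real_le_lsqrt) (auto simp: w_nonneg)
      then show "a0 \<le> sqrt (w (y + h) s) \<and> sqrt (w (y + h) s) \<le> 3 * a0" using lo by (simp add: a0_def)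
      define a where "a = sqrt (w (y + h) s)"
      define b where "b = sqrt (w y s)"
      have ab: "a > 0" "b > 0" using w_pos ys yh by (auto simp: a_def b_def)
      have sq: "a\<^sup>2 = w (y + h) s" "b\<^sup>2 = w y s" using w_nonneg by (auto simp: a_def b_def)
      have geq: "g (y + h) s = a * q (y + h) s" "g y s = b * q y s" using g_eq ys yh by (auto simp: a_def b_def)
      have zM: "\<bar>w (y + h) s - w y s\<bar> \<le> h * M"
      proof -
        obtain z where z: "y < z" "z < y + h" "w (y + h) s - w y s = (y + h - y) * g z s"
        proof (rule mvt_open[of y "y + h" "\<lambda>y. w y s" "\<lambda>y. g y s"])
          show "continuous_on {y..y + h} (\<lambda>y. w y s)"
            by (rule continuous_at_imp_continuous_on) (use ys in \<open>auto intro!: DERIV_isCont w_dx\<close>)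
        qed (use ys h in \<open>auto intro!: w_dx\<close>)
        then show ?thesis using gM[of z s] ys h yh by (simp add: abs_mult)
      qed
      have qb: "\<bar>q y s\<bar> \<le> b / x"
      proof -
        have "\<bar>g y s\<bar> \<le> b\<^sup>2 / (2 * y)" using g_abs_le(2)[of y s] ys sq by simp
        also have "\<dots> \<le> b\<^sup>2 / x" using ys x1 by (intro divide_left_mono) auto
        finally show ?thesis using ab ys by (simp add: q_def b_def[symmetric] power2_eq_square field_simps)
      qed
      have "\<bar>a - b\<bar> * b \<le> \<bar>a - b\<bar> * (a + b)" using ab by (intro mult_left_mono) auto
      also have "\<dots> = \<bar>(a - b) * (a + b)\<bar>" using ab by (simp add: abs_mult)
      also have "\<dots> = \<bar>w (y + h) s - w y s\<bar>" unfolding sq[symmetric] by (simp add: power2_eq_square algebra_simps)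
      \<comment> \<open>The weight \<open>b\<close>, supplied by
        \<open>\<bar>q\<bar> \<le> b / x\<close>, compensates the singular slope of the square root
        near the wall.\<close>
      finally have abM: "\<bar>a - b\<bar> * b \<le> h * M" using zM by simp
      have "(g (y + h) s - g y s) / h - a * ((q (y + h) s - q y s) / h) = (a - b) * q y s / h"
        unfolding geq by (simp add: diff_divide_distrib left_diff_distrib right_diff_distrib)
      also have "\<bar>\<dots>\<bar> = \<bar>a - b\<bar> * \<bar>q y s\<bar> / h" using h by (simp add: abs_mult)
      also have "\<dots> \<le> \<bar>a - b\<bar> * (b / x) / h" using qb h by (intro divide_right_mono mult_left_mono) auto
      also have "\<dots> = (\<bar>a - b\<bar> * b) / (x * h)" by simp
      also have "\<dots> \<le> (h * M) / (x * h)" using abM x1 h by (intro divide_right_mono) auto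
      also have "\<dots> = M / x" using h by simp
      finally show "\<bar>(g (y + h) s - g y s) / h - sqrt (w (y + h) s) * ((q (y + h) s - q y s) / h)\<bar> \<le> M / x"
        by (simp add: a_def)
    qed (use r a0 M x1 in auto)
    also have "M * (2 + 4 * (3 * a0) / a0) / r + M / x * r / a0 \<le> 15 * M / r"
    proof -
      have "r * r \<le> r\<^sup>2 + r\<^sup>2" by (simp add: power2_eq_square)
      then have "r * r \<le> x * a0" using r2 by (simp add: mult.commute)
      then have "r / (x * a0) \<le> 1 / r" using x1 a0 r by (simp add: field_simps)
      then have "M * (r / (x * a0)) \<le> M * (1 / r)" using M by (intro mult_left_mono) auto
      moreover have "M * (2 + 4 * (3 * a0) / a0) / r = 14 * (M * (1 / r))" using a0 by simp
      moreover have "M / x * r / a0 = M * (r / (x * a0))" by simp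
      moreover have "15 * M / r = 15 * (M * (1 / r))" by simp
      ultimately show ?thesis by linarith
    qed
    also have "\<dots> \<le> H / x * exp (- (\<kappa> / 2) * \<xi>\<^sup>2)"
    proof -
      \<comment> \<open>The factor \<open>t\<close> in \<open>M\<close>, inherited from
        \<open>\<bar>g\<bar> \<le> t p / (2 x)\<close>, cancels the shrinking radius, so the bound
        stays uniform as \<open>t\<close> tends to 0.\<close>
      have "\<xi> / m \<le> 1 + \<xi>" using \<xi> by (auto simp: m_def min_def)
      have "M / r = (3 * K / c) / (x * S) * (\<xi> / m * exp (- \<kappa> * \<xi>\<^sup>2))"
        by (simp add: M_def r_def \<xi>_def mult_ac)
      also have "\<dots> \<le> (3 * K / c) / x * ((2 + 2 / \<kappa>) * exp (- (\<kappa> / 2) * \<xi>\<^sup>2))"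
      proof (rule mult_mono)
        show "(3 * K / c) / (x * S) \<le> (3 * K / c) / x"
          using K c x1 S by (intro divide_left_mono) (auto simp: mult_le_cancel_left1)
        have "\<xi> / m * exp (- \<kappa> * \<xi>\<^sup>2) \<le> (1 + \<xi>) * exp (- \<kappa> * \<xi>\<^sup>2)"
          using \<open>\<xi> / m \<le> 1 + \<xi>\<close> by (intro mult_right_mono) auto
        also have "\<dots> \<le> exp (- (\<kappa> / 2) * \<xi>\<^sup>2) + (1 + 2 / \<kappa>) * exp (- (\<kappa> / 2) * \<xi>\<^sup>2)"
        proof -
          have "exp (- \<kappa> * \<xi>\<^sup>2) \<le> exp (- (\<kappa> / 2) * \<xi>\<^sup>2)" using \<kappa> by simp
          moreover have "\<xi> * exp (- \<kappa> * \<xi>\<^sup>2) \<le> (1 + 2 / \<kappa>) * exp (- (\<kappa> / 2) * \<xi>\<^sup>2)"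
            by (rule gaussian_absorb) (use \<kappa> \<xi> in auto)
          ultimately show ?thesis unfolding distrib_right[of 1 \<xi>] by linarith
        qed
        finally show "\<xi> / m * exp (- \<kappa> * \<xi>\<^sup>2) \<le> (2 + 2 / \<kappa>) * exp (- (\<kappa> / 2) * \<xi>\<^sup>2)"
          by (simp add: algebra_simps)
      qed (use K c x1 \<xi> m in auto)
      finally show ?thesis by (simp add: H_def)
    qed
    finally have "\<bar>p (x + h) t - p x t\<bar> \<le> h * (H / x * exp (- (\<kappa> / 2) * \<xi>\<^sup>2))"
      using h by (simp add: divide_le_eq mult.commute)
    then show ?thesis by (simp add: \<xi>(2))
  qed
  moreover have "\<kappa> / 2 > 0" using \<kappa> by simp
  ultimately show ?thesis using H by blast
qed

lemma p_difference:
  "\<exists>K>0. \<exists>\<kappa>>0. \<forall>x\<ge>2 * s0. \<forall>t\<ge>0. \<forall>h. 0 < h \<longrightarrow> h \<le> x \<longrightarrow>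
     \<bar>p (x + h) t - p x t\<bar> \<le> h * (K / x * exp (- \<kappa> * t\<^sup>2 / x))"
proof -
  obtain K \<kappa> where K: "K > 0" "\<kappa> > 0" "\<And>x t h. x \<ge> 2 * s0 \<Longrightarrow> t > 0 \<Longrightarrow> 0 < h \<Longrightarrow> h \<le> x \<Longrightarrow>
     \<bar>p (x + h) t - p x t\<bar> \<le> h * (K / x * exp (- \<kappa> * t\<^sup>2 / x))"
    using p_difference_pos by blast
  have "\<bar>p (x + h) t - p x t\<bar> \<le> h * (K / x * exp (- \<kappa> * t\<^sup>2 / x))"
    if x: "x \<ge> 2 * s0" and t: "t \<ge> 0" and h: "0 < h" "h \<le> x" for x t h
  proof (cases "t = 0")
    case True
    have x0: "x > 0" using x s0(1) by simp
    have "\<bar>p (x + h) 0 - p x 0\<bar> \<le> h * (K / x * exp (- \<kappa> * 0\<^sup>2 / x))"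
      by (rule le_at_zero_by_continuity)
         (use x0 K(3)[OF x _ h] h in \<open>auto intro!: continuous_intros continuous_on_slice[OF cont_p]\<close>)
    then show ?thesis using True by simp
  qed (use K(3)[OF x _ h] t in auto)
  then show ?thesis using K by blast
qed


section \<open>Hoelder continuity in x\<close>

lemma p_lipschitz_x:
  "\<exists>L>0. \<forall>x x' t. 2 * s0 \<le> x \<longrightarrow> 2 * s0 \<le> x' \<longrightarrow> \<bar>x' - x\<bar> \<le> 2 \<longrightarrow> 0 \<le> t \<longrightarrow> \<bar>p x' t - p x t\<bar> \<le> L * \<bar>x' - x\<bar>"
proof -
  obtain K \<kappa> where K: "K > 0" "\<kappa> > 0" and diff: "\<forall>x\<ge>2 * s0. \<forall>t\<ge>0. \<forall>h. 0 < h \<longrightarrow> h \<le> x \<longrightarrow>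
     \<bar>p (x + h) t - p x t\<bar> \<le> h * (K / x * exp (- \<kappa> * t\<^sup>2 / x))"
    using p_difference by metis
  have up: "\<bar>p x' t - p x t\<bar> \<le> K * (x' - x)" if x: "2 * s0 \<le> x" "x < x'" "x' - x \<le> 2" "0 \<le> t" for x x' t
  proof -
    have x1: "x \<ge> 2" using x s0(1) by simp
    have "K / x * exp (- \<kappa> * t\<^sup>2 / x) \<le> K * 1"
      using K x1 by (intro mult_mono) (auto simp: divide_le_eq mult_le_cancel_left1)
    then have "(x' - x) * (K / x * exp (- \<kappa> * t\<^sup>2 / x)) \<le> (x' - x) * K" using x by (intro mult_left_mono) auto
    then show ?thesis using diff[rule_format, of x t "x' - x"] x x1 by (simp add: mult.commute)
  qed
  have "\<bar>p x' t - p x t\<bar> \<le> K * \<bar>x' - x\<bar>"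
    if "2 * s0 \<le> x" "2 * s0 \<le> x'" "\<bar>x' - x\<bar> \<le> 2" "0 \<le> t" for x x' t
    using up[of x x' t] up[of x' x t] that by (cases x x' rule: linorder_cases) (auto simp: abs_minus_commute)
  then show ?thesis using K by blast
qed

text \<open>The Lipschitz form of \<open>g_t = p_x\<close>, without either derivative existing:
  mixed differences of \<open>w\<close> can be evaluated in either order.\<close>

lemma g_lipschitz_t:
  "\<exists>L>0. \<forall>x s t. 2 * s0 \<le> x \<longrightarrow> 0 < s \<longrightarrow> s < t \<longrightarrow> \<bar>g x t - g x s\<bar> \<le> L * (t - s)"
proof -
  obtain L where L: "L > 0" "\<And>x x' t. 2 * s0 \<le> x \<Longrightarrow> 2 * s0 \<le> x' \<Longrightarrow> \<bar>x' - x\<bar> \<le> 2 \<Longrightarrow> 0 \<le> t \<Longrightarrow> \<bar>p x' t - p x t\<bar> \<le> L * \<bar>x' - x\<bar>"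
    using p_lipschitz_x by blast
  have "\<bar>g x t - g x s\<bar> \<le> L * (t - s)" if x: "2 * s0 \<le> x" and s: "0 < s" "s < t" for x s t
  proof -
    have x0: "x > 0" using x s0(1) by simp
    have r: "at_right (0::real) \<le> at 0" by (simp add: at_le)
    have lim: "((\<lambda>h. (w (x + h) r - w x r) / h) \<longlongrightarrow> g x r) (at_right 0)" if "0 < r" for r
      using w_dx[OF x0 that] tendsto_mono[OF r] unfolding DERIV_def by blast
    have "((\<lambda>h. \<bar>(w (x + h) t - w x t) / h - (w (x + h) s - w x s) / h\<bar>) \<longlongrightarrow> \<bar>g x t - g x s\<bar>) (at_right 0)"
      using s by (intro tendsto_intros lim) auto
    then show ?thesis
    proof (rule tendsto_upperbound)
      show "\<forall>\<^sub>F h in at_right 0. \<bar>(w (x + h) t - w x t) / h - (w (x + h) s - w x s) / h\<bar> \<le> L * (t - s)"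
        unfolding eventually_at_right_field
      proof (intro exI[of _ 1] conjI allI impI)
        fix h :: real assume h: "0 < h" "h < 1"
        obtain z where z: "s < z" "z < t"
          "(w (x + h) t - w x t) - (w (x + h) s - w x s) = (t - s) * (p (x + h) z - p x z)"
        proof (rule mvt_open[OF s(2), of "\<lambda>t. w (x + h) t - w x t" "\<lambda>t. p (x + h) t - p x t"])
          have der: "((\<lambda>t. w (x + h) t - w x t) has_real_derivative p (x + h) r - p x r) (at r)" if "0 < r" for r
            using x0 h that by (auto intro!: DERIV_diff w_dt)
          then show "\<And>r. s < r \<Longrightarrow> ((\<lambda>t. w (x + h) t - w x t) has_real_derivative p (x + h) r - p x r) (at r)"
            using s by simp
          show "continuous_on {s..t} (\<lambda>t. w (x + h) t - w x t)"
            by (rule continuous_at_imp_continuous_on) (use s in \<open>auto intro!: DERIV_isCont[OF der]\<close>)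
        qed auto
        have "\<bar>(t - s) * (p (x + h) z - p x z)\<bar> \<le> (t - s) * (L * h)"
          unfolding abs_mult using L(2)[of x "x + h" z] x h s z by (intro mult_mono) auto
        then have "\<bar>((w (x + h) t - w x t) - (w (x + h) s - w x s)) / h\<bar> \<le> L * (t - s)"
          unfolding z(3) using h by (simp add: divide_le_eq mult_ac)
        then show "\<bar>(w (x + h) t - w x t) / h - (w (x + h) s - w x s) / h\<bar> \<le> L * (t - s)"
          by (simp add: diff_divide_distrib)
      qed simp
    qed simp
  qed
  then show ?thesis using L by blast
qed

text \<open>The singular factor \<open>1 / sqrt w\<close> recombines with \<open>g\<close> into
  \<open>q\<close>, which is bounded by 1 for \<open>x \<ge> 1\<close>; hence the coefficient
  \<open>sqrt w\<close> is Lipschitz in \<open>x\<close> up to the wall.\<close>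

lemma sqrt_w_dx: assumes "0 < x" "0 < t" shows "((\<lambda>s. sqrt (w s t)) has_real_derivative q x t / 2) (at x)"
proof -
  have "((\<lambda>s. sqrt (w s t)) has_real_derivative inverse (sqrt (w x t)) / 2 * g x t) (at x)"
  proof (rule DERIV_chain2[where f = sqrt and g = "\<lambda>s. w s t" and x = x])
    show "(sqrt has_real_derivative inverse (sqrt (w x t)) / 2) (at (w x t))"
      using w_pos[of x t] assms by (intro DERIV_real_sqrt) auto
  qed (rule w_dx[OF assms])
  moreover have "inverse (sqrt (w x t)) / 2 * g x t = q x t / 2" by (simp add: q_def field_simps)
  ultimately show ?thesis by (simp only:)
qed

lemma q_abs_le: assumes "1 \<le> x" "0 < t" shows "\<bar>q x t\<bar> \<le> sqrt (w x t)"
proof -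
  have x0: "0 < x" using assms by simp
  have "\<bar>g x t\<bar> \<le> w x t / (2 * x)" by (rule g_abs_le(2)[OF x0 assms(2)])
  also have "\<dots> \<le> w x t / 1" using assms w_nonneg by (intro divide_left_mono) auto
  also have "\<dots> = sqrt (w x t) * sqrt (w x t)" by (simp add: w_nonneg)
  finally show ?thesis using w_pos[of x t] assms by (simp add: q_def divide_le_eq)
qed

lemma q_abs_le_one: assumes "1 \<le> x" "0 < t" shows "\<bar>q x t\<bar> \<le> 1"
proof -
  have "sqrt (w x t) \<le> 1" using w_le_one[of x t] assms by simp
  then show ?thesis using q_abs_le[OF assms] by linarith
qed

lemma sqrt_w_mvt:
  assumes "0 < a" "a < b" "0 < t"
  obtains \<xi> where "a < \<xi>" "\<xi> < b" "sqrt (w b t) - sqrt (w a t) = (b - a) * (q \<xi> t / 2)"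
proof (rule mvt_open[OF assms(2), of "\<lambda>s. sqrt (w s t)" "\<lambda>s. q s t / 2"])
  show "continuous_on {a..b} (\<lambda>s. sqrt (w s t))"
    by (rule continuous_at_imp_continuous_on) (use assms in \<open>auto intro!: DERIV_isCont[OF sqrt_w_dx]\<close>)
qed (use assms sqrt_w_dx in auto)

lemma w_mvt_x:
  assumes "0 < a" "a < b" "0 < t"
  obtains \<xi> where "a < \<xi>" "\<xi> < b" "w b t - w a t = (b - a) * g \<xi> t"
proof (rule mvt_open[OF assms(2), of "\<lambda>s. w s t" "\<lambda>s. g s t"])
  show "continuous_on {a..b} (\<lambda>s. w s t)"
    by (rule continuous_at_imp_continuous_on) (use assms in \<open>auto intro!: DERIV_isCont[OF w_dx]\<close>)
qed (use assms w_dx in auto)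

lemma p_mvt_t:
  assumes "0 \<le> x" "0 < s" "s < t"
  obtains \<zeta> where "s < \<zeta>" "\<zeta> < t" "p x t - p x s = (t - s) * q x \<zeta>"
proof (rule mvt_open[OF assms(3), of "p x" "q x"])
  show "continuous_on {s..t} (p x)"
    by (rule continuous_at_imp_continuous_on) (use assms in \<open>auto intro!: DERIV_isCont[OF p_dt]\<close>)
qed (use assms p_dt in auto)

text \<open>Lipschitz dependence of \<open>p\<close> on \<open>x\<close> and of \<open>q\<close> on \<open>t\<close> are traded against each other:
  \<open>q\<close> is compared with the difference quotient of \<open>p\<close> of step \<open>sqrt \<bar>x' - x\<bar>\<close>.\<close>

lemma q_holder_x:
  assumes "0 < X" "0 < T"
  shows "\<exists>C>0. \<forall>x x' t. 2 * s0 \<le> x \<longrightarrow> x \<le> X \<longrightarrow> 2 * s0 \<le> x' \<longrightarrow> x' \<le> X \<longrightarrow> \<bar>x' - x\<bar> \<le> 1 \<longrightarrow> 0 < t \<longrightarrow> t \<le> T \<longrightarrow>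
           \<bar>q x' t - q x t\<bar> \<le> C / t * sqrt \<bar>x' - x\<bar> \<and> \<bar>g x' t - g x t\<bar> \<le> C / t * sqrt \<bar>x' - x\<bar>"
proof -
  obtain L1 where L1: "L1 > 0" "\<And>x x' t. 2 * s0 \<le> x \<Longrightarrow> 2 * s0 \<le> x' \<Longrightarrow> \<bar>x' - x\<bar> \<le> 2 \<Longrightarrow> 0 \<le> t \<Longrightarrow> \<bar>p x' t - p x t\<bar> \<le> L1 * \<bar>x' - x\<bar>"
    using p_lipschitz_x by blast
  obtain L2 where L2: "L2 > 0" "\<And>x s t. 2 * s0 \<le> x \<Longrightarrow> 0 < s \<Longrightarrow> s < t \<Longrightarrow> \<bar>g x t - g x s\<bar> \<le> L2 * (t - s)"
    using g_lipschitz_t by blast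
  obtain c where c: "c > 0" "\<And>x t. 0 \<le> x \<Longrightarrow> x \<le> X \<Longrightarrow> 0 \<le> t \<Longrightarrow> c * min t 1 \<le> w x t"
    using w_linear_lower[OF assms(1)] by blast
  obtain M where M: "M > 0" "\<And>x y. 0 \<le> x \<Longrightarrow> x \<le> X \<Longrightarrow> 0 \<le> y \<Longrightarrow> \<bar>uy x y\<bar> \<le> M"
    using bounded_on_strip[OF assms(1)] by blast
  define c2 where "c2 = sqrt c / (1 + T)"
  have c2: "c2 > 0" using c assms by (simp add: c2_def)
  \<comment> \<open>A linear lower bound, weaker than the order \<open>sqrt t\<close> near the wall,
    but it yields the uniform weight \<open>1 / t\<close> on the whole range up to
    \<open>T\<close>.\<close>
  have root: "c2 * t \<le> sqrt (w x t)" if "0 \<le> x" "x \<le> X" "0 < t" "t \<le> T" for x t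
  proof (rule real_le_rsqrt)
    have "t * t \<le> min t 1 * (1 + T)\<^sup>2"
    proof -
      have "t * t \<le> t * (1 + T)" using that by (intro mult_left_mono) auto
      also have "\<dots> \<le> (min t 1 * (1 + T)) * (1 + T)"
      proof (rule mult_right_mono)
        show "t \<le> min t 1 * (1 + T)" using that by (auto simp: min_def algebra_simps)
      qed (use assms in simp)
      finally show ?thesis by (simp add: power2_eq_square mult.assoc)
    qed
    then have "c * (t * t) \<le> c * (min t 1 * (1 + T)\<^sup>2)" using c(1) by (intro mult_left_mono) auto
    then have "(c2 * t)\<^sup>2 \<le> c * min t 1"
      using assms c(1) by (simp add: c2_def power_mult_distrib power_divide divide_le_eq) (simp add: power2_eq_square mult_ac)
    also have "\<dots> \<le> w x t" using c(2)[of x t] that by simp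
    finally show "(c2 * t)\<^sup>2 \<le> w x t" .
  qed
  define C2 where "C2 = (L2 + 2 * M) / c2"
  have C2: "C2 > 0" using L2 M c2 by (simp add: C2_def)
  have qlip: "\<bar>q x s - q x t\<bar> \<le> C2 / t * (s - t)"
    if x: "2 * s0 \<le> x" "x \<le> X" and t: "0 < t" "t \<le> T" and s: "t < s" for x s t
  proof -
    have x1: "x \<ge> 1" "x > 0" using x s0(1) by auto
    define a where "a = sqrt (w x s)"
    define b where "b = sqrt (w x t)"
    have ab: "b > 0" "b \<le> a" using w_pos[of x t] w_mono[of x t s] x1 t s by (auto simp: a_def b_def)
    have sq: "a\<^sup>2 = w x s" "b\<^sup>2 = w x t" using w_nonneg by (auto simp: a_def b_def)
    have bt: "c2 * t \<le> b" using root[of x t] x1 x t by (simp add: b_def)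
    have gb: "\<bar>g x t\<bar> \<le> b * b"
    proof -
      have "\<bar>g x t\<bar> \<le> w x t / (2 * x)" by (rule g_abs_le(2)) fact+
      also have "\<dots> \<le> w x t / 1" using x1 w_nonneg by (intro divide_left_mono) auto
      finally show ?thesis using sq by (simp add: power2_eq_square)
    qed
    obtain \<zeta> where \<zeta>: "t < \<zeta>" "\<zeta> < s" "w x s - w x t = (s - t) * p x \<zeta>"
      using concave_from_zero.mvt[OF w_concave, of x t s] x1 t s by auto
    have "\<bar>p x \<zeta>\<bar> \<le> 2 * M" using M(2)[of x "Y x \<zeta>"] Y_nonneg[of x \<zeta>] x1 x \<zeta> t by (simp add: p_def abs_mult)
    then have "(s - t) * p x \<zeta> \<le> (s - t) * (2 * M)" using s by (intro mult_left_mono) auto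
    then have a2: "a\<^sup>2 - b\<^sup>2 \<le> (s - t) * (2 * M)" using \<zeta>(3) sq by simp
    have "(a - b) * b \<le> (a - b) * (a + b)" using ab by (intro mult_left_mono) auto
    also have "\<dots> = a\<^sup>2 - b\<^sup>2" by (simp add: power2_eq_square algebra_simps)
    finally have amb: "a - b \<le> (s - t) * (2 * M) / b" using a2 ab by (simp add: le_divide_eq)
    have "q x s - q x t = (g x s - g x t) / a + g x t * (1 / a - 1 / b)"
      by (simp add: q_def a_def b_def diff_divide_distrib algebra_simps)
    then have "\<bar>q x s - q x t\<bar> \<le> \<bar>(g x s - g x t) / a\<bar> + \<bar>g x t * (1 / a - 1 / b)\<bar>"
      by (simp only: abs_triangle_ineq)
    also have "\<bar>(g x s - g x t) / a\<bar> \<le> L2 * (s - t) / b"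
      unfolding abs_divide using L2(2)[of x t s] x t s ab L2(1) by (intro frac_le) auto
    also have "\<bar>g x t * (1 / a - 1 / b)\<bar> \<le> a - b"
    proof -
      have "\<bar>1 / a - 1 / b\<bar> = (a - b) / (a * b)" using ab by (simp add: field_simps abs_if)
      then have "\<bar>g x t * (1 / a - 1 / b)\<bar> \<le> (b * b) * ((a - b) / (a * b))"
        unfolding abs_mult using gb ab by (intro mult_mono) auto
      also have "\<dots> = b / a * (a - b)" using ab by simp
      also have "\<dots> \<le> 1 * (a - b)" using ab by (intro mult_right_mono) auto
      finally show ?thesis by simp
    qed
    also note amb
    also have "L2 * (s - t) / b + (s - t) * (2 * M) / b = (L2 + 2 * M) * (s - t) / b"
      by (simp add: algebra_simps flip: add_divide_distrib)
    also have "\<dots> \<le> (L2 + 2 * M) * (s - t) / (c2 * t)"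
      using bt c2 t s L2 M ab by (intro divide_left_mono) (auto intro!: mult_nonneg_nonneg)
    finally show ?thesis by (simp add: C2_def)
  qed
  define C where "C = 2 * L1 * T + 2 * C2"
  have C: "C > 0" using L1 C2 assms by (simp add: C_def add_pos_pos)
  have qh: "\<bar>q x' t - q x t\<bar> \<le> C / t * sqrt \<bar>x' - x\<bar>"
    if x: "2 * s0 \<le> x" "x \<le> X" "2 * s0 \<le> x'" "x' \<le> X" "\<bar>x' - x\<bar> \<le> 1" and t: "0 < t" "t \<le> T" for x x' t
  proof (cases "x' = x")
    case False
    \<comment> \<open>With this step the error \<open>L1 \<bar>x' - x\<bar> / \<epsilon>\<close>
      from \<open>p\<close> and the error \<open>C2 \<epsilon> / t\<close> from \<open>q\<close> are
      both proportional to \<open>\<epsilon>\<close>.\<close>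
    define \<epsilon> where "\<epsilon> = sqrt \<bar>x' - x\<bar>"
    have \<epsilon>: "\<epsilon> > 0" "\<epsilon> * \<epsilon> = \<bar>x' - x\<bar>" using False by (auto simp: \<epsilon>_def)
    have xx: "0 \<le> x" "0 \<le> x'" using x s0(1) by auto
    have approx: "\<bar>(p y (t + \<epsilon>) - p y t) - \<epsilon> * q y t\<bar> \<le> \<epsilon> * (C2 / t * \<epsilon>)" if y: "2 * s0 \<le> y" "y \<le> X" for y
    proof -
      obtain \<zeta> where \<zeta>: "t < \<zeta>" "\<zeta> < t + \<epsilon>" "p y (t + \<epsilon>) - p y t = (t + \<epsilon> - t) * q y \<zeta>"
        by (rule p_mvt_t[of y t "t + \<epsilon>"]) (use y s0(1) t \<epsilon> in auto)
      have "\<bar>q y \<zeta> - q y t\<bar> \<le> C2 / t * (\<zeta> - t)" by (rule qlip) (use y t \<zeta> in auto)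
      also have "\<dots> \<le> C2 / t * \<epsilon>" using \<zeta> C2 t by (intro mult_left_mono) auto
      finally have "\<epsilon> * \<bar>q y \<zeta> - q y t\<bar> \<le> \<epsilon> * (C2 / t * \<epsilon>)" using \<epsilon> by (intro mult_left_mono) auto
      moreover have "\<bar>(p y (t + \<epsilon>) - p y t) - \<epsilon> * q y t\<bar> = \<epsilon> * \<bar>q y \<zeta> - q y t\<bar>"
        using \<epsilon> by (simp add: \<zeta>(3) abs_mult flip: right_diff_distrib)
      ultimately show ?thesis by simp
    qed
    have "\<bar>p x' s - p x s\<bar> \<le> L1 * (\<epsilon> * \<epsilon>)" if "0 \<le> s" for s
      using L1(2)[of x x' s] x that \<epsilon> by simp
    from this[of "t + \<epsilon>"] this[of t] approx[of x] approx[of x'] x t \<epsilon>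
    have "\<bar>\<epsilon> * q x' t - \<epsilon> * q x t\<bar> \<le> 2 * (L1 * (\<epsilon> * \<epsilon>)) + 2 * (\<epsilon> * (C2 / t * \<epsilon>))" by linarith
    moreover have "\<bar>\<epsilon> * q x' t - \<epsilon> * q x t\<bar> = \<epsilon> * \<bar>q x' t - q x t\<bar>"
      using \<epsilon> by (simp add: abs_mult flip: right_diff_distrib)
    moreover have "2 * (L1 * (\<epsilon> * \<epsilon>)) + 2 * (\<epsilon> * (C2 / t * \<epsilon>)) = \<epsilon> * ((2 * L1 + 2 * C2 / t) * \<epsilon>)"
      by (simp add: algebra_simps)
    ultimately have "\<epsilon> * \<bar>q x' t - q x t\<bar> \<le> \<epsilon> * ((2 * L1 + 2 * C2 / t) * \<epsilon>)" by simp
    then have "\<bar>q x' t - q x t\<bar> \<le> (2 * L1 + 2 * C2 / t) * \<epsilon>" using \<epsilon> by (simp only: mult_le_cancel_left_pos)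
    also have "\<dots> \<le> C / t * \<epsilon>"
    proof (rule mult_right_mono)
      have "L1 * t \<le> L1 * T" using t L1 by (intro mult_left_mono) auto
      then have "(2 * L1 * t + 2 * C2) / t \<le> C / t" using t by (intro divide_right_mono) (auto simp: C_def)
      then show "2 * L1 + 2 * C2 / t \<le> C / t" using t by (simp add: add_divide_distrib)
    qed (use \<epsilon> in simp)
    finally show ?thesis by (simp add: \<epsilon>_def)
  qed simp
  have gh: "\<bar>g x' t - g x t\<bar> \<le> (C + T) / t * sqrt \<bar>x' - x\<bar>"
    if x: "2 * s0 \<le> x" "x \<le> X" "2 * s0 \<le> x'" "x' \<le> X" "\<bar>x' - x\<bar> \<le> 1" and t: "0 < t" "t \<le> T" for x x' t
  proof -
    have x1: "x \<ge> 1" "x' \<ge> 1" using x s0(1) by auto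
    define k where "k = \<bar>x' - x\<bar>"
    have k01: "0 \<le> k" "k \<le> 1" using x by (auto simp: k_def)
    then have "k\<^sup>2 \<le> k" by (simp add: power2_eq_square mult_left_le)
    then have k: "0 \<le> k" "k \<le> sqrt k" using k01 by (auto intro: real_le_rsqrt)
    have low: "\<bar>sqrt (w b t) - sqrt (w a t)\<bar> \<le> b - a" if ab: "1 \<le> a" "a < b" for a b
    proof -
      obtain \<xi> where \<xi>: "a < \<xi>" "\<xi> < b" "sqrt (w b t) - sqrt (w a t) = (b - a) * (q \<xi> t / 2)"
        by (rule sqrt_w_mvt[of a b t]) (use ab t in auto)
      have "\<bar>(b - a) * (q \<xi> t / 2)\<bar> \<le> (b - a) * 1"
        unfolding abs_mult using q_abs_le_one[of \<xi> t] \<xi> ab t by (intro mult_mono) auto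
      then show ?thesis by (simp add: \<xi>(3))
    qed
    have s: "\<bar>sqrt (w x' t) - sqrt (w x t)\<bar> \<le> k"
      using low[of x x'] low[of x' x] x1 by (cases x x' rule: linorder_cases) (auto simp: k_def abs_minus_commute)
    have "g x' t - g x t = sqrt (w x' t) * (q x' t - q x t) + (sqrt (w x' t) - sqrt (w x t)) * q x t"
      using g_eq[of x t] g_eq[of x' t] x1 t by (simp add: algebra_simps)
    then have "\<bar>g x' t - g x t\<bar> \<le> \<bar>sqrt (w x' t) * (q x' t - q x t)\<bar> + \<bar>(sqrt (w x' t) - sqrt (w x t)) * q x t\<bar>"
      by (simp only: abs_triangle_ineq)
    also have "\<bar>sqrt (w x' t) * (q x' t - q x t)\<bar> \<le> 1 * (C / t * sqrt k)"
      unfolding abs_mult using qh[OF x t] w_le_one[of x' t] x1 t w_nonneg by (intro mult_mono) (auto simp: k_def)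
    also have "\<bar>(sqrt (w x' t) - sqrt (w x t)) * q x t\<bar> \<le> sqrt k * 1"
      unfolding abs_mult using s k q_abs_le_one[of x t] x1 t by (intro mult_mono) auto
    also have "sqrt k * 1 \<le> T / t * sqrt k"
      using t k by (simp add: field_simps mult_right_mono)
    finally show ?thesis by (simp add: k_def add_divide_distrib distrib_right)
  qed
  show ?thesis
  proof (intro exI[of _ "C + T"] conjI allI impI)
    show "0 < C + T" using C assms by simp
    fix x x' t assume x: "2 * s0 \<le> x" "x \<le> X" "2 * s0 \<le> x'" "x' \<le> X" "\<bar>x' - x\<bar> \<le> 1" and t: "0 < t" "t \<le> T"
    show "\<bar>g x' t - g x t\<bar> \<le> (C + T) / t * sqrt \<bar>x' - x\<bar>" by (rule gh[OF x t])
    have "C / t * sqrt \<bar>x' - x\<bar> \<le> (C + T) / t * sqrt \<bar>x' - x\<bar>"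
      using t assms by (intro mult_right_mono divide_right_mono) auto
    then show "\<bar>q x' t - q x t\<bar> \<le> (C + T) / t * sqrt \<bar>x' - x\<bar>" using qh[OF x t] by linarith
  qed
qed

section \<open>Second differences in the streamwise variable\<close>

definition sd :: "(real \<Rightarrow> real \<Rightarrow> real) \<Rightarrow> real \<Rightarrow> real \<Rightarrow> real \<Rightarrow> real" where
  "sd h k x t = h (x + k) t + h (x - k) t - 2 * h x t"

lemma sd_derivs:
  assumes "0 < k" "k < x" "0 < t"
  shows "((\<lambda>x. sd w k x t) has_real_derivative sd g k x t) (at x)"
    "(sd w k x has_real_derivative sd p k x t) (at t)" "(sd p k x has_real_derivative sd q k x t) (at t)"
proof -
  have "((\<lambda>x. w (x + k) t) has_real_derivative g (x + k) t) (at x)"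
    using w_dx[of "x + k" t] assms by (simp add: DERIV_shift)
  moreover have "((\<lambda>x. w (x - k) t) has_real_derivative g (x - k) t) (at x)"
    using DERIV_shift[of "\<lambda>x. w x t" "g (x - k) t" x "- k"] w_dx[of "x - k" t] assms by simp
  ultimately show "((\<lambda>x. sd w k x t) has_real_derivative sd g k x t) (at x)"
    unfolding sd_def using assms by (auto intro!: DERIV_diff DERIV_add DERIV_cmult w_dx)
  show "(sd w k x has_real_derivative sd p k x t) (at t)" "(sd p k x has_real_derivative sd q k x t) (at t)"
    unfolding sd_def[abs_def] using assms by (auto intro!: DERIV_diff DERIV_add DERIV_cmult w_dt p_dt)
qed

text \<open>By the mean value theorem \<open>sd w\<close> is \<open>k\<close> times an increment of
  \<open>g\<close>, and Hoelder continuity gives the extra \<open>sqrt k\<close>. The residual has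
  the same size because \<open>sqrt w\<close> obeys the analogous bound, with \<open>q / 2\<close>
  in place of \<open>g\<close>.\<close>

lemma sd_bounds:
  assumes "0 < X" "0 < T"
  shows "\<exists>C>0. \<forall>x k t. 2 * s0 \<le> x - k \<longrightarrow> x + k \<le> X \<longrightarrow> 0 < k \<longrightarrow> k \<le> 1 / 2 \<longrightarrow> 0 < t \<longrightarrow> t \<le> T \<longrightarrow>
     \<bar>sd w k x t\<bar> \<le> C / t * (k * sqrt k) \<and> \<bar>sd g k x t - sqrt (w x t) * sd q k x t\<bar> \<le> C / t * (k * sqrt k)"
proof -
  obtain C where C: "C > 0" "\<And>x x' t. 2 * s0 \<le> x \<Longrightarrow> x \<le> X \<Longrightarrow> 2 * s0 \<le> x' \<Longrightarrow> x' \<le> X \<Longrightarrow> \<bar>x' - x\<bar> \<le> 1 \<Longrightarrow> 0 < t \<Longrightarrow> t \<le> T \<Longrightarrow>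
           \<bar>q x' t - q x t\<bar> \<le> C / t * sqrt \<bar>x' - x\<bar> \<and> \<bar>g x' t - g x t\<bar> \<le> C / t * sqrt \<bar>x' - x\<bar>"
    using q_holder_x[OF assms] by blast
  have "\<bar>sd w k x t\<bar> \<le> (2 * C) / t * (k * sqrt k) \<and> \<bar>sd g k x t - sqrt (w x t) * sd q k x t\<bar> \<le> (2 * C) / t * (k * sqrt k)"
    if x: "2 * s0 \<le> x - k" "x + k \<le> X" and k: "0 < k" "k \<le> 1 / 2" and t: "0 < t" "t \<le> T" for x k t
  proof -
    have x1: "x - k \<ge> 1" using x s0(1) by simp
    define B where "B = C / t * sqrt k"
    have B: "B > 0" using C t k by (simp add: B_def)
    have hold: "\<bar>q \<xi> t - q \<eta> t\<bar> \<le> 2 * B \<and> \<bar>g \<xi> t - g \<eta> t\<bar> \<le> 2 * B"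
      if "x - k \<le> \<eta>" "\<eta> \<le> x + k" "x - k \<le> \<xi>" "\<xi> \<le> x + k" for \<xi> \<eta>
    proof -
      have "\<bar>\<xi> - \<eta>\<bar> \<le> 2 * k" using that by auto
      also have "2 * k \<le> 4 * k" using k by simp
      finally have "sqrt \<bar>\<xi> - \<eta>\<bar> \<le> sqrt (4 * k)" by simp
      then have "C / t * sqrt \<bar>\<xi> - \<eta>\<bar> \<le> C / t * (2 * sqrt k)"
        using C t by (intro mult_left_mono) (auto simp: real_sqrt_mult)
      moreover have "\<bar>q \<xi> t - q \<eta> t\<bar> \<le> C / t * sqrt \<bar>\<xi> - \<eta>\<bar> \<and> \<bar>g \<xi> t - g \<eta> t\<bar> \<le> C / t * sqrt \<bar>\<xi> - \<eta>\<bar>"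
        using that x k t by (intro C(2)) auto
      moreover have "C / t * (2 * sqrt k) = 2 * B" by (simp add: B_def)
      ultimately show ?thesis by linarith
    qed
    have near: "\<bar>q y t - q x t\<bar> \<le> B" if "y = x + k \<or> y = x - k" for y
    proof -
      have "\<bar>q y t - q x t\<bar> \<le> C / t * sqrt \<bar>y - x\<bar>" using that x k t x1 by (intro C(2)[THEN conjunct1]) auto
      then show ?thesis using that k by (auto simp: B_def)
    qed
    obtain a1 where a1: "x < a1" "a1 < x + k" "w (x + k) t - w x t = (x + k - x) * g a1 t"
      by (rule w_mvt_x[of x "x + k" t]) (use x1 k t in auto)
    obtain a2 where a2: "x - k < a2" "a2 < x" "w x t - w (x - k) t = (x - (x - k)) * g a2 t"
      by (rule w_mvt_x[of "x - k" x t]) (use x1 k t in auto)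
    have "sd w k x t = k * (g a1 t - g a2 t)" using a1(3) a2(3) by (simp add: sd_def algebra_simps)
    also have "\<bar>\<dots>\<bar> \<le> k * (2 * B)"
      unfolding abs_mult using hold[of a2 a1] a1 a2 k by (intro mult_mono) auto
    finally have 1: "\<bar>sd w k x t\<bar> \<le> (2 * C) / t * (k * sqrt k)" by (simp add: B_def mult_ac)
    define \<sigma> where "\<sigma> y = sqrt (w y t)" for y
    obtain b1 where b1: "x < b1" "b1 < x + k" "\<sigma> (x + k) - \<sigma> x = (x + k - x) * (q b1 t / 2)"
      unfolding \<sigma>_def by (rule sqrt_w_mvt[of x "x + k" t]) (use x1 k t in auto)
    obtain b2 where b2: "x - k < b2" "b2 < x" "\<sigma> x - \<sigma> (x - k) = (x - (x - k)) * (q b2 t / 2)"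
      unfolding \<sigma>_def by (rule sqrt_w_mvt[of "x - k" x t]) (use x1 k t in auto)
    have q1: "\<bar>q y t\<bar> \<le> 1" if "x - k \<le> y" for y using q_abs_le_one[of y t] that x1 t by simp
    have geq: "g y t = \<sigma> y * q y t" if "x - k \<le> y" for y using g_eq[of y t] that x1 t by (simp add: \<sigma>_def)
    \<comment> \<open>The discrete product rule for \<open>g = \<sigma> q\<close>: two products of
      first differences, of size \<open>k\<close> and \<open>sqrt k\<close>, and one second
      difference of \<open>\<sigma>\<close>.\<close>
    have "sd g k x t - \<sigma> x * sd q k x t
        = (\<sigma> (x + k) - \<sigma> x) * (q (x + k) t - q x t) + (\<sigma> (x - k) - \<sigma> x) * (q (x - k) t - q x t)
          + (\<sigma> (x + k) + \<sigma> (x - k) - 2 * \<sigma> x) * q x t"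
      using geq[of x] geq[of "x + k"] geq[of "x - k"] k by (simp add: sd_def algebra_simps)
    moreover have "\<bar>(\<sigma> (x + k) - \<sigma> x) * (q (x + k) t - q x t)\<bar> \<le> (k / 2) * B"
      unfolding abs_mult
    proof (rule mult_mono)
      have "k * \<bar>q b1 t\<bar> \<le> k * 1" using q1[of b1] b1 k by (intro mult_left_mono) auto
      then show "\<bar>\<sigma> (x + k) - \<sigma> x\<bar> \<le> k / 2" unfolding b1(3) using k by (simp add: abs_mult)
    qed (use near k in auto)
    moreover have "\<bar>(\<sigma> (x - k) - \<sigma> x) * (q (x - k) t - q x t)\<bar> \<le> (k / 2) * B"
      unfolding abs_mult
    proof (rule mult_mono)
      have "\<bar>\<sigma> (x - k) - \<sigma> x\<bar> = \<bar>\<sigma> x - \<sigma> (x - k)\<bar>" by (rule abs_minus_commute)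
      moreover have "k * \<bar>q b2 t\<bar> \<le> k * 1" using q1[of b2] b2 k by (intro mult_left_mono) auto
      ultimately show "\<bar>\<sigma> (x - k) - \<sigma> x\<bar> \<le> k / 2" unfolding b2(3) using k by (simp add: abs_mult)
    qed (use near k in auto)
    moreover have "\<bar>(\<sigma> (x + k) + \<sigma> (x - k) - 2 * \<sigma> x) * q x t\<bar> \<le> (k * B) * 1"
      unfolding abs_mult
    proof (rule mult_mono)
      have "\<sigma> (x + k) + \<sigma> (x - k) - 2 * \<sigma> x = (k / 2) * (q b1 t - q b2 t)" using b1(3) b2(3) by (simp add: algebra_simps)
      also have "\<bar>\<dots>\<bar> \<le> (k / 2) * (2 * B)"
        unfolding abs_mult using hold[of b2 b1] b1 b2 k by (intro mult_mono) auto
      finally show "\<bar>\<sigma> (x + k) + \<sigma> (x - k) - 2 * \<sigma> x\<bar> \<le> k * B" by simp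
    qed (use q1[of x] k B in auto)
    ultimately have "\<bar>sd g k x t - \<sigma> x * sd q k x t\<bar> \<le> 2 * (k * B)" by linarith
    then have "\<bar>sd g k x t - \<sigma> x * sd q k x t\<bar> \<le> (2 * C) / t * (k * sqrt k)" by (simp add: B_def mult_ac)
    with 1 show ?thesis by (simp add: \<sigma>_def)
  qed
  then show ?thesis using C(1) by (intro exI[of _ "2 * C"]) auto
qed

lemma cont_sd_w:
  assumes "k \<le> a" "0 \<le> c" "0 < k" shows "continuous_on ({a..b} \<times> {c..d}) (\<lambda>(x,t). sd w k x t)"
proof -
  have sh: "continuous_on ({a..b} \<times> {c..d}) (\<lambda>r. w (fst r + h) (snd r))" if "- k \<le> h" for h
  proof -
    have "continuous_on ({a..b} \<times> {c..d}) (\<lambda>r. (\<lambda>(x,t). w x t) (fst r + h, snd r))"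
      by (rule continuous_on_compose2[OF cont_w])
         (use assms that in \<open>auto intro!: continuous_intros simp: quadrant_def\<close>)
    then show ?thesis by simp
  qed
  have "continuous_on ({a..b} \<times> {c..d}) (\<lambda>r. w (fst r + k) (snd r) + w (fst r + (- k)) (snd r) - 2 * w (fst r + 0) (snd r))"
    by (intro continuous_on_diff continuous_on_add continuous_on_mult_left sh) (use assms in auto)
  then show ?thesis by (simp add: sd_def split_def)
qed

text \<open>At a fixed height off the wall the diffusion is bounded below, so the slope estimate
  applies to \<open>sd w\<close> on a cylinder independent of \<open>k\<close> and passes the order
  \<open>k sqrt k\<close> on to \<open>sd p\<close>.\<close>

lemma p_differentiable_interior:
  assumes x: "2 * s0 + 2 < x" and t: "0 < t"
  shows "\<exists>D. ((\<lambda>s. p s t) has_real_derivative D) (at x)"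
proof -
  have X: "0 < x + 1" "0 < 2 * t" using x t s0(1) by auto
  obtain C where C: "C > 0" "\<And>y k r. 2 * s0 \<le> y - k \<Longrightarrow> y + k \<le> x + 1 \<Longrightarrow> 0 < k \<Longrightarrow> k \<le> 1 / 2 \<Longrightarrow> 0 < r \<Longrightarrow> r \<le> 2 * t \<Longrightarrow>
     \<bar>sd w k y r\<bar> \<le> C / r * (k * sqrt k) \<and> \<bar>sd g k y r - sqrt (w y r) * sd q k y r\<bar> \<le> C / r * (k * sqrt k)"
    using sd_bounds[OF X] by blast
  define a0 where "a0 = sqrt (w (x + 1) (t / 2))"
  have a0: "a0 > 0" "a0 \<le> 1" using w_pos[of "x + 1" "t / 2"] w_le_one[of "x + 1" "t / 2"] X t by (auto simp: a0_def)
  define r where "r = min (t / 2) (a0 / 2)"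
  have r: "r > 0" "r \<le> t / 2" "r \<le> a0 / 2" using a0 t by (auto simp: r_def)
  have "r * r \<le> a0 / 2 * 1" using r a0 by (intro mult_mono) auto
  then have T: "r\<^sup>2 / a0 \<le> 1 / 2" using a0 by (simp add: power2_eq_square divide_le_eq)
  define K where "K = (C / (t / 2)) * (2 + 4 * 1 / a0) / r + (C / (t / 2)) * r / a0"
  have main: "\<bar>sd p k y t\<bar> \<le> K * (k * sqrt k)" if y: "\<bar>y - x\<bar> < 1 / 4" and k: "0 < k" "k < 1 / 4" for y k
  proof -
    define m where "m = C / (t / 2) * (k * sqrt k)"
    have m: "m > 0" using C t k by (simp add: m_def)
    have bnd: "\<bar>sd w k z s\<bar> \<le> m" "\<bar>sd g k z s - sqrt (w z s) * sd q k z s\<bar> \<le> m"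
      if z: "y - 1 / 2 \<le> z" "z \<le> y" and s: "t / 2 \<le> s" "s \<le> 3 * t / 2" for z s
    proof -
      have y': "y < x + 1 / 4" "x - 1 / 4 < y" using y by (auto simp: abs_if split: if_splits)
      have "C / s * (k * sqrt k) \<le> m"
        unfolding m_def using C s t k by (intro mult_right_mono divide_left_mono) auto
      moreover have "\<bar>sd w k z s\<bar> \<le> C / s * (k * sqrt k) \<and> \<bar>sd g k z s - sqrt (w z s) * sd q k z s\<bar> \<le> C / s * (k * sqrt k)"
        by (rule C(2)) (use z s y' k x t in auto)
      ultimately show "\<bar>sd w k z s\<bar> \<le> m" "\<bar>sd g k z s - sqrt (w z s) * sd q k z s\<bar> \<le> m" by linarith+
    qed
    have yx: "y - 1 / 2 > k" "y < x + 1 / 4" using y k x s0(1) by (auto simp: abs_if split: if_splits)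
    have "\<bar>sd p k y t\<bar> \<le> m * (2 + 4 * 1 / a0) / r + m * r / a0"
    proof (rule local_lipschitz_slope[where z = "sd w k" and zx = "sd g k" and ?z1.0 = "sd p k" and ?z2.0 = "sd q k"
          and a = "\<lambda>y s. sqrt (w y s)", OF r(1) a0(1) m])
      show "continuous_on ({y - r\<^sup>2 / a0..y} \<times> {t - r..t + r}) (\<lambda>(x, t). sd w k x t)"
      proof (rule cont_sd_w)
        show "k \<le> y - r\<^sup>2 / a0" using yx T by linarith
      qed (use r k t in auto)
      show "\<bar>sd w k z s\<bar> \<le> m" if "y - r\<^sup>2 / a0 \<le> z" "z \<le> y" "t - r \<le> s" "s \<le> t + r" for z s
      proof (rule bnd)
        show "y - 1 / 2 \<le> z" using that T by linarith
      qed (use that r in auto)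
      fix z s assume zs: "y - r\<^sup>2 / a0 < z" "z \<le> y" "t - r < s" "s < t + r"
      have z2: "y - 1 / 2 \<le> z" using zs T by linarith
      have zs': "k < z" "0 < s" "z \<le> x + 1" "t / 2 \<le> s" "0 \<le> z" using z2 zs yx r t k by auto
      show "((\<lambda>z. sd w k z s) has_real_derivative sd g k z s) (at z)"
        "(sd w k z has_real_derivative sd p k z s) (at s)" "(sd p k z has_real_derivative sd q k z s) (at s)"
        using sd_derivs[OF k(1) zs'(1,2)] by auto
      show "\<bar>sd g k z s - sqrt (w z s) * sd q k z s\<bar> \<le> m" by (rule bnd) (use z2 zs r in auto)
      have "w (x + 1) (t / 2) \<le> w z (t / 2)" by (rule w_antimono') (use zs' t in auto)
      also have "\<dots> \<le> w z s" by (rule w_mono) (use zs' t in auto)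
      finally show "a0 \<le> sqrt (w z s) \<and> sqrt (w z s) \<le> 1" using w_le_one[of z s] zs' by (simp add: a0_def)
    qed (use m in simp)
    also have "\<dots> = K * (k * sqrt k)" by (simp add: K_def m_def algebra_simps add_divide_distrib)
    finally show ?thesis .
  qed
  show ?thesis
  proof (rule second_difference_differentiable[of "1/2" "1/4" x _ K])
    have "continuous_on {x - 2 * (1 / 4)..x + 2 * (1 / 4)} (\<lambda>s. (\<lambda>(x,t). p x t) (s, t))"
      by (rule continuous_on_compose2[OF cont_p])
         (use x t s0(1) in \<open>auto intro!: continuous_intros simp: quadrant_def\<close>)
    then show "continuous_on {x - 2 * (1 / 4)..x + 2 * (1 / 4)} (\<lambda>s. p s t)" by simp
    show "\<bar>p (y + k) t + p (y - k) t - 2 * p y t\<bar> \<le> K * k powr (1 + 1 / 2)"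
      if "\<bar>y - x\<bar> < 1 / 4" "0 < k" "k < 1 / 4" for y k
    proof -
      have "k powr (1 + 1 / 2) = k powr 1 * k powr (1 / 2)" by (rule powr_add)
      also have "\<dots> = k * sqrt k" using that by (simp add: powr_half_sqrt)
      finally have "k powr (1 + 1 / 2) = k * sqrt k" .
      then show ?thesis using main[OF that] by (simp add: sd_def)
    qed
  qed auto
qed


text \<open>The barrier \<open>K k sqrt k sqrt t\<close> for the time-localised second difference \<open>(y - (x - 1)) sd w k y t\<close>:
  its concavity in \<open>t\<close> beats the residual of size \<open>k sqrt k / t\<close>.\<close>

lemma sd_w_near_wall:
  assumes x: "2 * s0 + 2 < x"
  shows "\<exists>K>0. \<forall>y k t. \<bar>y - x\<bar> < 1 / 4 \<longrightarrow> 0 < k \<longrightarrow> k < 1 / 4 \<longrightarrow> 0 < t \<longrightarrow> t \<le> 1 \<longrightarrow>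
           \<bar>sd w k y t\<bar> \<le> K * (k * sqrt k) * sqrt t"
proof -
  have X: "0 < x + 1" "(0::real) < 1" using x s0(1) by auto
  obtain C where C: "C > 0" "\<And>y k r. 2 * s0 \<le> y - k \<Longrightarrow> y + k \<le> x + 1 \<Longrightarrow> 0 < k \<Longrightarrow> k \<le> 1 / 2 \<Longrightarrow> 0 < r \<Longrightarrow> r \<le> 1 \<Longrightarrow>
     \<bar>sd w k y r\<bar> \<le> C / r * (k * sqrt k) \<and> \<bar>sd g k y r - sqrt (w y r) * sd q k y r\<bar> \<le> C / r * (k * sqrt k)"
    using sd_bounds[OF X] by blast
  obtain c where c: "c > 0" "\<And>y t. 0 \<le> y \<Longrightarrow> y \<le> x + 1 \<Longrightarrow> 0 \<le> t \<Longrightarrow> c * min t 1 \<le> w y t"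
    using w_linear_lower[OF X(1)] by blast
  \<comment> \<open>The concavity of the barrier contributes at least
    \<open>K sqrt c / (4 s) \<ge> (3 C + 1) / s\<close>, against \<open>C / s\<close> from
    differentiating the cutoff and \<open>2 C / s\<close> from the residual;
    \<open>K \<ge> 2 C\<close> settles the side \<open>t = 1\<close>.\<close>
  define K where "K = (12 * C + 4) / sqrt c + 2 * C"
  have K: "K > 0" "2 * C \<le> K" "12 * C + 4 \<le> K * sqrt c"
  proof -
    show "K > 0" "2 * C \<le> K" using C(1) c(1) by (auto simp: K_def add_pos_pos)
    have "(12 * C + 4) / sqrt c * sqrt c = 12 * C + 4" using c(1) by simp
    then have "K * sqrt c = 12 * C + 4 + 2 * C * sqrt c"
      unfolding K_def distrib_right[of "(12 * C + 4) / sqrt c"] by simp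
    moreover have "0 \<le> 2 * C * sqrt c" using C(1) c(1) by simp
    ultimately show "12 * C + 4 \<le> K * sqrt c" by linarith
  qed
  \<comment> \<open>The cutoff \<open>y - a\<close> vanishes at the start \<open>y = a\<close>,
    where no bound of the barrier's form is known for the second difference.\<close>
  define a where "a = x - 1"
  \<comment> \<open>The sign \<open>e\<close> treats upper and lower bounds at once.\<close>
  have main: "e * (y - a) * sd w k y t \<le> K * (k * sqrt k) * sqrt t"
    if e: "\<bar>e\<bar> = 1" and y: "a \<le> y" "y \<le> x + 1 / 4" and k: "0 < k" "k < 1 / 4" and t: "0 \<le> t" "t \<le> 1" for e y k t
  proof -
    define \<kappa> where "\<kappa> = k * sqrt k"
    have \<kappa>: "\<kappa> > 0" using k by (simp add: \<kappa>_def)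
    have bnd: "\<bar>sd w k z s\<bar> \<le> C / s * \<kappa>" "\<bar>sd g k z s - sqrt (w z s) * sd q k z s\<bar> \<le> C / s * \<kappa>"
      if "a \<le> z" "z \<le> x + 1 / 4" "0 < s" "s \<le> 1" for z s
      using C(2)[of z k s] that k x by (auto simp: a_def \<kappa>_def)
    have "e * (y - a) * sd w k y t - K * \<kappa> * sqrt t \<le> 0"
    proof (rule rectangle_max_principle[where F = "\<lambda>y t. e * (y - a) * sd w k y t - K * \<kappa> * sqrt t"
          and Fx = "\<lambda>y t. e * sd w k y t + e * (y - a) * sd g k y t"
          and ?F1.0 = "\<lambda>y t. e * (y - a) * sd p k y t - K * \<kappa> * (inverse (sqrt t) / 2)"
          and ?F2.0 = "\<lambda>y t. e * (y - a) * sd q k y t + K * \<kappa> * (1 / (4 * t * sqrt t))"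
          and ?x1.0 = a and ?x2.0 = "x + 1 / 4" and \<alpha> = 0 and \<beta> = 1])
      have "continuous_on ({a..x + 1 / 4} \<times> {0..1}) (\<lambda>r. sd w k (fst r) (snd r))"
        using cont_sd_w[of k a 0 "x + 1 / 4" 1] k x s0(1) by (simp add: a_def split_def)
      then show "continuous_on ({a..x + 1 / 4} \<times> {0..1}) (\<lambda>(y, t). e * (y - a) * sd w k y t - K * \<kappa> * sqrt t)"
        unfolding split_def by (intro continuous_intros)
      show "e * (a - a) * sd w k a s - K * \<kappa> * sqrt s \<le> 0" if "0 \<le> s" for s using that K \<kappa> by simp
      show "e * (z - a) * sd w k z 0 - K * \<kappa> * sqrt 0 \<le> 0" if "a \<le> z" for z
        using w_wall[of "z + k"] w_wall[of "z - k"] w_wall[of z] that k x s0(1) by (simp add: sd_def a_def)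
      show "e * (z - a) * sd w k z 1 - K * \<kappa> * sqrt 1 \<le> 0" if z: "a \<le> z" "z \<le> x + 1 / 4" for z
      proof -
        have "\<bar>e * (z - a) * sd w k z 1\<bar> \<le> 2 * (C / 1 * \<kappa>)"
          unfolding abs_mult e using bnd(1)[of z 1] z C(1) \<kappa> by (intro mult_mono) (auto simp: a_def)
        also have "\<dots> \<le> K * \<kappa>" using K(2) \<kappa> by simp
        finally show ?thesis by simp
      qed
      fix z s :: real assume zs: "a < z" "z \<le> x + 1 / 4" "0 < s" "s < 1"
      have kz: "k < z" using zs k x s0(1) by (simp add: a_def)
      note sdd = sd_derivs[OF k(1) kz zs(3)]
      show "((\<lambda>z. e * (z - a) * sd w k z s - K * \<kappa> * sqrt s) has_real_derivative e * sd w k z s + e * (z - a) * sd g k z s) (at z)"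
        by (rule derivative_eq_intros sdd refl)+ (simp add: algebra_simps)
      have rt: "(sqrt has_real_derivative inverse (sqrt s) / 2) (at s)"
        by (rule DERIV_real_sqrt) (use zs in simp)
      show "(((\<lambda>s. e * (z - a) * sd w k z s - K * \<kappa> * sqrt s)) has_real_derivative e * (z - a) * sd p k z s - K * \<kappa> * (inverse (sqrt s) / 2)) (at s)"
        by (intro DERIV_diff DERIV_cmult sdd rt)
      have "((\<lambda>s. inverse (sqrt s) / 2) has_real_derivative - 1 / (4 * s * sqrt s)) (at s)"
        using zs by (auto intro!: derivative_eq_intros simp: field_simps)
      from DERIV_diff[OF DERIV_cmult[OF sdd(3), of "e * (z - a)"] DERIV_cmult[OF this, of "K * \<kappa>"]]
      show "((\<lambda>s. e * (z - a) * sd p k z s - K * \<kappa> * (inverse (sqrt s) / 2)) has_real_derivative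
              e * (z - a) * sd q k z s + K * \<kappa> * (1 / (4 * s * sqrt s))) (at s)" by simp
      define \<sigma> where "\<sigma> = sqrt (w z s)"
      assume Fx: "0 \<le> e * sd w k z s + e * (z - a) * sd g k z s"
        and F2: "e * (z - a) * sd q k z s + K * \<kappa> * (1 / (4 * s * sqrt s)) \<le> 0"
      have "sqrt c * sqrt s \<le> \<sigma>"
        using c(2)[of z s] zs x s0(1) by (simp add: \<sigma>_def a_def flip: real_sqrt_mult)
      then have \<sigma>: "sqrt c * sqrt s \<le> \<sigma>" "0 \<le> \<sigma>" using c(1) zs by (auto simp: \<sigma>_def w_nonneg)
      have 1: "e * sd w k z s \<le> C / s * \<kappa>"
        using bnd(1)[of z s] zs abs_ge_self[of "e * sd w k z s"] e by (simp add: abs_mult)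
      have 2: "e * (z - a) * (sd g k z s - \<sigma> * sd q k z s) \<le> 2 * (C / s * \<kappa>)"
      proof -
        have "\<bar>e * (z - a) * (sd g k z s - \<sigma> * sd q k z s)\<bar> \<le> 2 * (C / s * \<kappa>)"
          unfolding abs_mult e using bnd(2)[of z s] zs C(1) \<kappa> by (intro mult_mono) (auto simp: a_def \<sigma>_def)
        then show ?thesis by simp
      qed
      have 3: "\<sigma> * (e * (z - a) * sd q k z s) \<le> - ((3 * C + 1) / s * \<kappa>)"
      proof -
        have "\<sigma> * (e * (z - a) * sd q k z s) \<le> \<sigma> * - (K * \<kappa> * (1 / (4 * s * sqrt s)))"
          using F2 \<sigma> by (intro mult_left_mono) auto
        also have "\<dots> = - (\<sigma> * (K * \<kappa> / (4 * s * sqrt s)))" by simp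
        also have "\<dots> \<le> - (sqrt c * sqrt s * (K * \<kappa> / (4 * s * sqrt s)))"
          using \<sigma>(1) K \<kappa> zs by (intro le_imp_neg_le mult_right_mono) auto
        also have "sqrt c * sqrt s * (K * \<kappa> / (4 * s * sqrt s)) = (K * sqrt c) * (\<kappa> / (4 * s))"
          using zs by simp
        also have "- ((K * sqrt c) * (\<kappa> / (4 * s))) \<le> - ((12 * C + 4) * (\<kappa> / (4 * s)))"
          using K(3) \<kappa> zs by (intro le_imp_neg_le mult_right_mono) auto
        also have "(12 * C + 4) * (\<kappa> / (4 * s)) = (3 * C + 1) / s * \<kappa>" using zs by (simp add: field_simps)
        finally show ?thesis .
      qed
      have "e * (z - a) * sd g k z s = e * (z - a) * (sd g k z s - \<sigma> * sd q k z s) + \<sigma> * (e * (z - a) * sd q k z s)"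
        by (simp add: algebra_simps)
      then have "0 \<le> C / s * \<kappa> + 2 * (C / s * \<kappa>) - (3 * C + 1) / s * \<kappa>" using 1 2 3 Fx by linarith
      also have "\<dots> = - (\<kappa> / s)" using zs by (simp add: field_simps)
      finally have "\<kappa> / s \<le> 0" by simp
      moreover have "\<kappa> / s > 0" using \<kappa> zs by simp
      ultimately show False by linarith
    qed (use y t in auto)
    then show ?thesis by (simp add: \<kappa>_def)
  qed
  have "\<bar>sd w k y t\<bar> \<le> (2 * K) * (k * sqrt k) * sqrt t"
    if y: "\<bar>y - x\<bar> < 1 / 4" and k: "0 < k" "k < 1 / 4" and t: "0 < t" "t \<le> 1" for y k t
  proof -
    have ya: "a \<le> y" "y \<le> x + 1 / 4" "1 / 2 \<le> y - a" using y by (auto simp: a_def abs_if split: if_splits)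
    have "(y - a) * \<bar>sd w k y t\<bar> \<le> K * (k * sqrt k) * sqrt t"
      using main[of 1 y k t] main[of "-1" y k t] ya k t by (cases "sd w k y t \<ge> 0") (auto simp: algebra_simps)
    moreover have "1 / 2 * \<bar>sd w k y t\<bar> \<le> (y - a) * \<bar>sd w k y t\<bar>" using ya by (intro mult_right_mono) auto
    ultimately show ?thesis by simp
  qed
  then show ?thesis using K(1) by (intro exI[of _ "2 * K"]) auto
qed

text \<open>The slope estimate degenerates here, so \<open>p y 0\<close> is read off from
  \<open>w y t / t\<close>. The barrier costs \<open>k^(3/2) t^(-1/2)\<close> and the expansion of
  \<open>w\<close> costs \<open>t^(3/2)\<close>; the choice \<open>t = k^(3/4)\<close> makes both
  equal to \<open>k^(9/8)\<close>.\<close>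

lemma p_differentiable_wall:
  assumes x: "2 * s0 + 2 < x"
  shows "\<exists>D. ((\<lambda>s. p s 0) has_real_derivative D) (at x)"
proof -
  obtain K where K: "K > 0" "\<And>y k t. \<bar>y - x\<bar> < 1 / 4 \<Longrightarrow> 0 < k \<Longrightarrow> k < 1 / 4 \<Longrightarrow> 0 < t \<Longrightarrow> t \<le> 1 \<Longrightarrow>
           \<bar>sd w k y t\<bar> \<le> K * (k * sqrt k) * sqrt t"
    using sd_w_near_wall[OF x] by blast
  have x1: "0 < x + 1" using x s0(1) by simp
  obtain M where M: "M > 0" "\<And>y t. 0 \<le> y \<Longrightarrow> y \<le> x + 1 \<Longrightarrow> 0 \<le> t \<Longrightarrow> w y t \<le> M * t"
    using w_strip_bounds[OF x1] by auto
  \<comment> \<open>The remainder gains a factor \<open>sqrt t\<close> over a usual second-order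
    one, since \<open>\<bar>q\<bar> \<le> sqrt w\<close> vanishes at the wall.\<close>
  have taylor: "\<bar>w y t - t * p y 0\<bar> \<le> t * (t * sqrt (M * t))" if y: "1 \<le> y" "y \<le> x + 1" and t: "0 < t" for y t
  proof -
    have y0: "0 \<le> y" using y by simp
    obtain z where z: "0 < z" "z < t" "w y t - w y 0 = (t - 0) * p y z"
      using concave_from_zero.mvt[OF w_concave[OF y0] order_refl t] .
    obtain r where r: "0 < r" "r < z" "p y z - p y 0 = (z - 0) * q y r"
    proof (rule mvt_open[of 0 z "p y" "q y"])
      show "continuous_on {0..z} (p y)" by (rule continuous_on_subset[OF continuous_on_slice[OF cont_p y0]]) auto
    qed (use z y0 p_dt in auto)
    have "\<bar>q y r\<bar> \<le> sqrt (w y r)" by (rule q_abs_le) (use y r in auto)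
    also have "\<dots> \<le> sqrt (M * t)"
    proof -
      have "w y r \<le> M * r" using M(2)[of y r] y0 y r by simp
      also have "\<dots> \<le> M * t" using M(1) r z by (intro mult_left_mono) auto
      finally show ?thesis by simp
    qed
    finally have "z * \<bar>q y r\<bar> \<le> t * sqrt (M * t)" using z by (intro mult_mono) auto
    then have "\<bar>p y z - p y 0\<bar> \<le> t * sqrt (M * t)" using r(3) z by (simp add: abs_mult)
    then have "t * \<bar>p y z - p y 0\<bar> \<le> t * (t * sqrt (M * t))" using t by (intro mult_left_mono) auto
    moreover have "w y t - t * p y 0 = t * (p y z - p y 0)" using z(3) w_wall[OF y0] by (simp add: algebra_simps)
    ultimately show ?thesis using t by (simp add: abs_mult)
  qed
  show ?thesis
  proof (rule second_difference_differentiable[of "1/8" "1/4" x _ "K + 4 * sqrt M"])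
    have "continuous_on {x - 2 * (1 / 4)..x + 2 * (1 / 4)} (\<lambda>s. (\<lambda>(x,t). p x t) (s, 0))"
      by (rule continuous_on_compose2[OF cont_p])
         (use x s0(1) in \<open>auto intro!: continuous_intros simp: quadrant_def\<close>)
    then show "continuous_on {x - 2 * (1 / 4)..x + 2 * (1 / 4)} (\<lambda>s. p s 0)" by simp
    show "\<bar>p (y + k) 0 + p (y - k) 0 - 2 * p y 0\<bar> \<le> (K + 4 * sqrt M) * k powr (1 + 1 / 8)"
      if y: "\<bar>y - x\<bar> < 1 / 4" and k: "0 < k" "k < 1 / 4" for y k
    proof -
      define t where "t = k powr (3 / 4)"
      have t: "0 < t" "t \<le> 1" using k by (auto simp: t_def powr_le1)
      have rt: "sqrt t = k powr (3 / 8)" by (simp add: t_def powr_powr flip: powr_half_sqrt)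
      have rk: "k * sqrt k = k powr (3 / 2)"
      proof -
        have "k powr (1 + 1 / 2) = k powr 1 * k powr (1 / 2)" by (rule powr_add)
        then show ?thesis using k by (simp add: powr_half_sqrt)
      qed
      have e1: "k * sqrt k * sqrt t = t * k powr (1 + 1 / 8)"
        unfolding rk rt unfolding t_def by (simp flip: powr_add)
      have e2: "t * sqrt t = k powr (1 + 1 / 8)"
        unfolding rt unfolding t_def by (simp flip: powr_add)
      have yb: "1 \<le> y - k" "y + k \<le> x + 1" using y k x s0(1) by (auto simp: abs_if split: if_splits)
      have "\<bar>t * (p (y + k) 0 + p (y - k) 0 - 2 * p y 0)\<bar> \<le> \<bar>sd w k y t\<bar> + 4 * (t * (t * sqrt (M * t)))"
      proof -
        have "t * (p (y + k) 0 + p (y - k) 0 - 2 * p y 0) = sd w k y t - (w (y + k) t - t * p (y + k) 0)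
                - (w (y - k) t - t * p (y - k) 0) + 2 * (w y t - t * p y 0)"
          by (simp add: sd_def algebra_simps)
        moreover have "\<bar>w (y + k) t - t * p (y + k) 0\<bar> \<le> t * (t * sqrt (M * t))"
          "\<bar>w (y - k) t - t * p (y - k) 0\<bar> \<le> t * (t * sqrt (M * t))"
          "\<bar>w y t - t * p y 0\<bar> \<le> t * (t * sqrt (M * t))"
          using taylor yb k t by auto
        moreover have "\<bar>S - A - B + 2 * C\<bar> \<le> \<bar>S\<bar> + 4 * m" if "\<bar>A\<bar> \<le> m" "\<bar>B\<bar> \<le> m" "\<bar>C\<bar> \<le> m" for S A B C m :: real
          using that by (smt (verit))
        ultimately show ?thesis by metis
      qed
      also have "\<dots> \<le> K * (k * sqrt k) * sqrt t + 4 * (t * (t * sqrt (M * t)))"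
        using K(2)[OF y k t] by simp
      also have "\<dots> = K * (k * sqrt k * sqrt t) + 4 * sqrt M * (t * (t * sqrt t))"
        by (simp add: real_sqrt_mult)
      also have "\<dots> = t * ((K + 4 * sqrt M) * k powr (1 + 1 / 8))"
        unfolding e1 e2 by (simp add: algebra_simps)
      finally have "t * \<bar>p (y + k) 0 + p (y - k) 0 - 2 * p y 0\<bar> \<le> t * ((K + 4 * sqrt M) * k powr (1 + 1 / 8))"
        using t by (simp only: abs_mult abs_of_pos)
      then show ?thesis using t by (simp only: mult_le_cancel_left_pos)
    qed
  qed auto
qed

section \<open>The mixed derivative and the collected bounds\<close>

lemma p_dx:
  "\<exists>K>0. \<exists>\<kappa>>0. \<forall>x>2 * s0 + 2. \<forall>t\<ge>0. \<exists>D. ((\<lambda>s. p s t) has_real_derivative D) (at x) \<and> \<bar>D\<bar> \<le> K / x * exp (- \<kappa> * t\<^sup>2 / x)"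
proof -
  obtain K \<kappa> where K: "K > 0" "\<kappa> > 0" and diff: "\<forall>x\<ge>2 * s0. \<forall>t\<ge>0. \<forall>h. 0 < h \<longrightarrow> h \<le> x \<longrightarrow>
     \<bar>p (x + h) t - p x t\<bar> \<le> h * (K / x * exp (- \<kappa> * t\<^sup>2 / x))"
    using p_difference by metis
  have "\<exists>D. ((\<lambda>s. p s t) has_real_derivative D) (at x) \<and> \<bar>D\<bar> \<le> K / x * exp (- \<kappa> * t\<^sup>2 / x)"
    if x: "x > 2 * s0 + 2" and t: "t \<ge> 0" for x t
  proof -
    obtain D where D: "((\<lambda>s. p s t) has_real_derivative D) (at x)"
      using p_differentiable_wall[OF x] p_differentiable_interior[OF x, of t] t by (cases "t = 0") auto
    have "at_right (0::real) \<le> at 0" by (simp add: at_le)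
    then have "((\<lambda>h. (p (x + h) t - p x t) / h) \<longlongrightarrow> D) (at_right 0)"
      using D unfolding DERIV_def by (rule tendsto_mono)
    then have "((\<lambda>h. \<bar>(p (x + h) t - p x t) / h\<bar>) \<longlongrightarrow> \<bar>D\<bar>) (at_right 0)" by (rule tendsto_rabs)
    then have "\<bar>D\<bar> \<le> K / x * exp (- \<kappa> * t\<^sup>2 / x)"
    proof (rule tendsto_upperbound)
      show "\<forall>\<^sub>F h in at_right 0. \<bar>(p (x + h) t - p x t) / h\<bar> \<le> K / x * exp (- \<kappa> * t\<^sup>2 / x)"
        unfolding eventually_at_right_field
      proof (intro exI[of _ 1] conjI allI impI)
        fix h :: real assume h: "0 < h" "h < 1"
        have "\<bar>p (x + h) t - p x t\<bar> \<le> h * (K / x * exp (- \<kappa> * t\<^sup>2 / x))"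
          using diff[rule_format, of x t h] x t h s0(1) by simp
        then show "\<bar>(p (x + h) t - p x t) / h\<bar> \<le> K / x * exp (- \<kappa> * t\<^sup>2 / x)"
          using h unfolding abs_divide by (simp only: abs_of_pos pos_divide_le_eq mult.commute)
      qed simp
    qed simp
    then show ?thesis using D by blast
  qed
  then show ?thesis using K by blast
qed

text \<open>Differentiate \<open>uy s y = p s (\<Psi> s y) / 2\<close>: the derivative is
  \<open>(D - q v) / 2\<close>, with \<open>D\<close> the \<open>x\<close>-derivative of
  \<open>p\<close> at fixed stream value. At \<open>y = 0\<close> the stream value is constantly 0
  and only \<open>D\<close> remains.\<close>

lemma uy_dx:
  "\<exists>K>0. \<exists>\<kappa>>0. \<forall>x>2 * s0 + 2. \<forall>y\<ge>0. \<exists>d. ((\<lambda>s. uy s y) has_real_derivative d) (at x) \<and> \<bar>d\<bar> \<le> K / x * exp (- \<kappa> * y\<^sup>2 / x)"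
proof -
  obtain K1 \<kappa>1 where K1: "K1 > 0" "\<kappa>1 > 0" and pdx: "\<forall>x>2 * s0 + 2. \<forall>t\<ge>0. \<exists>D. ((\<lambda>s. p s t) has_real_derivative D) (at x) \<and> \<bar>D\<bar> \<le> K1 / x * exp (- \<kappa>1 * t\<^sup>2 / x)"
    using p_dx by metis
  obtain K2 \<kappa>2 where K2: "K2 > 0" "\<kappa>2 > 0" and yuy: "\<forall>x\<ge>s0. \<forall>y>0. y * uy x y \<le> K2 * exp (- \<kappa>2 * y\<^sup>2 / x) \<and> y / x * (y * uy x y) \<le> K2 * exp (- \<kappa>2 * y\<^sup>2 / x)"
    using y_uy_gaussian by metis
  obtain \<beta> where \<beta>: "\<beta> > 0" "\<And>x y. x \<ge> 0 \<Longrightarrow> y \<ge> 0 \<Longrightarrow> y - \<beta> * sqrt (x + s0) \<le> \<Psi> x y"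
    using \<Psi>_lower by blast
  define \<kappa> where "\<kappa> = min (\<kappa>1 / 2) \<kappa>2"
  have \<kappa>: "\<kappa> > 0" "\<kappa> \<le> \<kappa>1 / 2" "\<kappa> \<le> \<kappa>2" using K1 K2 by (auto simp: \<kappa>_def)
  define K where "K = K1 * exp (2 * \<kappa>1 * \<beta>\<^sup>2) + K2"
  have K: "K > 0" using K1 K2 by (simp add: K_def add_pos_pos)
  have "\<exists>d. ((\<lambda>s. uy s y) has_real_derivative d) (at x) \<and> \<bar>d\<bar> \<le> K / x * exp (- \<kappa> * y\<^sup>2 / x)"
    if x: "x > 2 * s0 + 2" and y: "y \<ge> 0" for x y
  proof -
    have x1: "x > 1" "x > 0" "x \<ge> s0" "x \<ge> 0" using x s0(1) by auto
    define E where "E = exp (- \<kappa> * y\<^sup>2 / x)"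
    define t where "t = \<Psi> x y"
    have t: "t \<ge> 0" using \<Psi>_nonneg x1 y by (simp add: t_def)
    obtain D where D: "((\<lambda>s. p s t) has_real_derivative D) (at x)" "\<bar>D\<bar> \<le> K1 / x * exp (- \<kappa>1 * t\<^sup>2 / x)"
      using pdx x t by blast
    \<comment> \<open>Squaring \<open>y \<le> t + \<beta> sqrt (x + s0)\<close> costs half of the
      rate; the term of order \<open>x\<close> becomes the constant factor
      \<open>exp (2 \<kappa>1 \<beta>^2)\<close>.\<close>
    have DE: "\<bar>D\<bar> \<le> K1 * exp (2 * \<kappa>1 * \<beta>\<^sup>2) / x * E"
    proof -
      have "y \<le> t + \<beta> * sqrt (x + s0)" using \<beta>(2)[of x y] x1 y by (simp add: t_def)
      then have "y\<^sup>2 \<le> (t + \<beta> * sqrt (x + s0))\<^sup>2" using y by (intro power_mono) auto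
      also have "\<dots> \<le> 2 * t\<^sup>2 + 2 * (\<beta> * sqrt (x + s0))\<^sup>2"
        using zero_le_power2[of "t - \<beta> * sqrt (x + s0)"] by (simp add: power2_sum power2_diff)
      also have "(\<beta> * sqrt (x + s0))\<^sup>2 = \<beta>\<^sup>2 * (x + s0)" using x1 s0(1) by (simp add: power_mult_distrib)
      also have "2 * t\<^sup>2 + 2 * (\<beta>\<^sup>2 * (x + s0)) \<le> 2 * t\<^sup>2 + 2 * (\<beta>\<^sup>2 * (2 * x))"
        using x1 by (intro add_left_mono mult_left_mono) auto
      finally have "y\<^sup>2 / 2 \<le> t\<^sup>2 + 2 * \<beta>\<^sup>2 * x" by simp
      then have "\<kappa>1 * (y\<^sup>2 / 2) \<le> \<kappa>1 * (t\<^sup>2 + 2 * \<beta>\<^sup>2 * x)" using K1 by (intro mult_left_mono) auto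
      moreover have "\<kappa> * y\<^sup>2 \<le> \<kappa>1 / 2 * y\<^sup>2" using \<kappa> by (intro mult_right_mono) auto
      ultimately have "\<kappa> * y\<^sup>2 \<le> \<kappa>1 * (t\<^sup>2 + 2 * \<beta>\<^sup>2 * x)" by simp
      then have "\<kappa> * y\<^sup>2 / x \<le> \<kappa>1 * (t\<^sup>2 + 2 * \<beta>\<^sup>2 * x) / x" using x1 by (intro divide_right_mono) auto
      also have "\<dots> = \<kappa>1 * t\<^sup>2 / x + 2 * \<kappa>1 * \<beta>\<^sup>2" using x1 by (simp add: field_simps)
      finally have "- \<kappa>1 * t\<^sup>2 / x \<le> 2 * \<kappa>1 * \<beta>\<^sup>2 + - \<kappa> * y\<^sup>2 / x" by simp
      then have "exp (- \<kappa>1 * t\<^sup>2 / x) \<le> exp (2 * \<kappa>1 * \<beta>\<^sup>2) * E" by (simp only: E_def exp_le_cancel_iff flip: exp_add)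
      then have "K1 / x * exp (- \<kappa>1 * t\<^sup>2 / x) \<le> K1 / x * (exp (2 * \<kappa>1 * \<beta>\<^sup>2) * E)"
        using K1 x1 by (intro mult_left_mono) auto
      then show ?thesis using D(2) by simp
    qed
    have E0: "E > 0" by (simp add: E_def)
    show ?thesis
    proof (cases "y = 0")
      case True
      have "((\<lambda>s. p s 0 / 2) has_real_derivative D / 2) (at x)"
        using D(1) True by (intro DERIV_cdivide) (simp add: t_def)
      then have "((\<lambda>s. uy s y) has_real_derivative D / 2) (at x)"
        by (rule has_field_derivative_transform_within_open[of _ _ _ "{0<..}"])
           (use x1 Y_wall True in \<open>auto simp: p_def\<close>)
      moreover have "\<bar>D / 2\<bar> \<le> K / x * E"
      proof -
        have "K1 * exp (2 * \<kappa>1 * \<beta>\<^sup>2) / x * E \<le> K / x * E"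
          using K2 x1 E0 by (intro mult_right_mono divide_right_mono) (auto simp: K_def)
        then have "\<bar>D\<bar> \<le> K / x * E" using DE by linarith
        moreover have "\<bar>D / 2\<bar> \<le> \<bar>D\<bar>" by simp
        ultimately show ?thesis by linarith
      qed
      ultimately show ?thesis by (auto simp: E_def)
    next
      case False
      then have y0: "y > 0" using y by simp
      have t0: "t > 0" using \<Psi>_pos x1 y0 by (simp add: t_def)
      have cq: "continuous_on ({0<..} \<times> {0<..}) (\<lambda>(s,r). q s r)"
      proof -
        have "continuous_on ({0<..} \<times> {0<..}) (\<lambda>(s,r). g s r)" "continuous_on ({0<..} \<times> {0<..}) (\<lambda>(s,r). w s r)"
          by (rule continuous_on_subset[OF cont_g] continuous_on_subset[OF cont_w]; auto simp: quadrant_def)+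
        moreover have "sqrt (w s r) \<noteq> 0" if "0 < s" "0 < r" for s r using w_pos[of s r] that by simp
        ultimately show ?thesis unfolding q_def split_def by (intro continuous_intros) auto
      qed
      have "((\<lambda>s. p s (\<Psi> s y)) has_real_derivative D * 1 + q x (\<Psi> x y) * (- v x y)) (at x)"
        by (rule chain_rule_two_variables[OF _ _ _ p_dt cq DERIV_ident \<Psi>_dx])
           (use x1 y t0 D(1) in \<open>auto simp: t_def\<close>)
      then have "((\<lambda>s. p s (\<Psi> s y) / 2) has_real_derivative (D * 1 + q x t * (- v x y)) / 2) (at x)"
        unfolding t_def by (rule DERIV_cdivide)
      then have der: "((\<lambda>s. uy s y) has_real_derivative (D * 1 + q x t * (- v x y)) / 2) (at x)"
        by (rule has_field_derivative_transform_within_open[of _ _ _ "{0<..}"])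
           (use x1 Y_\<Psi> y in \<open>auto simp: p_def\<close>)
      \<comment> \<open>In \<open>q v\<close> the factor \<open>1 / u\<close> from \<open>q\<close>
        is attached to \<open>v\<close>, because \<open>v / u\<close> is bounded by
        \<open>y / (2 x)\<close>.\<close>
      have qv: "\<bar>q x t * v x y\<bar> \<le> K2 / x * E"
      proof -
        have up: "u x y > 0" using u_pos x1 y0 by simp
        have "\<bar>q x t * v x y\<bar> = 2 * (\<bar>uyy x y\<bar> * (v x y / u x y))"
          using x1 y y0 t v_bounds(1)[of x y] up u_eq_sqrt_w[of x y]
          by (simp add: q_def g_def t_def Y_\<Psi> abs_mult)
        also have "\<dots> \<le> 2 * ((y * uy x y / (2 * x)) * (y / (2 * x)))"
        proof (intro mult_left_mono mult_mono)
          have n: "0 \<le> y * uy x y / (2 * x)" using uy_nonneg[of x y] x1 y0 by simp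
          have "\<bar>uyy x y\<bar> \<le> y * uy x y / (2 * x) * u x y"
            using uyy_lower[of x y] uyy_nonpos[of x y] x1 y0 by simp
          also have "\<dots> \<le> y * uy x y / (2 * x) * 1" using n u_le_one[of x y] x1 y by (intro mult_left_mono) auto
          finally show "\<bar>uyy x y\<bar> \<le> y * uy x y / (2 * x)" by simp
          show "v x y / u x y \<le> y / (2 * x)" using v_bounds(2) x1 y0 by simp
          show "0 \<le> v x y / u x y" using v_bounds(1)[of x y] x1 y0 up by simp
          show "0 \<le> y * uy x y / (2 * x)" by (rule n)
        qed simp
        also have "\<dots> = (1 / (2 * x)) * (y / x * (y * uy x y))" by simp
        also have "\<dots> \<le> (1 / x) * (K2 * exp (- \<kappa>2 * y\<^sup>2 / x))"
        proof (rule mult_mono)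
          show "y / x * (y * uy x y) \<le> K2 * exp (- \<kappa>2 * y\<^sup>2 / x)" using yuy x1 y0 by blast
        qed (use x1 y0 uy_nonneg[of x y] in \<open>auto intro!: divide_left_mono\<close>)
        also have "\<dots> \<le> (1 / x) * (K2 * E)"
        proof (intro mult_left_mono)
          have "\<kappa> * y\<^sup>2 \<le> \<kappa>2 * y\<^sup>2" using \<kappa> by (intro mult_right_mono) auto
          then show "exp (- \<kappa>2 * y\<^sup>2 / x) \<le> E" using x1 by (simp add: E_def divide_right_mono)
        qed (use K2 x1 in auto)
        finally show ?thesis by simp
      qed
      have "(D * 1 + q x t * (- v x y)) / 2 = (D - q x t * v x y) / 2" by simp
      moreover have "\<bar>(D - z) / 2\<bar> \<le> \<bar>D\<bar> + \<bar>z\<bar>" for z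
        using abs_triangle_ineq4[of D z] abs_ge_zero[of "D - z"] unfolding abs_divide by simp
      ultimately have "\<bar>(D * 1 + q x t * (- v x y)) / 2\<bar> \<le> \<bar>D\<bar> + \<bar>q x t * v x y\<bar>" by metis
      also have "\<dots> \<le> K1 * exp (2 * \<kappa>1 * \<beta>\<^sup>2) / x * E + K2 / x * E" using DE qv by linarith
      also have "\<dots> = K / x * E" by (simp add: K_def add_divide_distrib distrib_right)
      finally show ?thesis using der by (auto simp: E_def)
    qed
  qed
  then show ?thesis using K \<kappa> by blast
qed

lemma gaussian_weaken:
  fixes K K' \<kappa> \<kappa>' x y :: real
  assumes "z \<le> K / x * exp (- \<kappa> * y\<^sup>2 / x)" "0 \<le> K" "K \<le> K'" "\<kappa>' \<le> \<kappa>" "0 < x"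
  shows "z \<le> K' / x * exp (- \<kappa>' * y\<^sup>2 / x)"
proof -
  have "\<kappa>' * y\<^sup>2 \<le> \<kappa> * y\<^sup>2" using assms by (intro mult_right_mono) auto
  then have "exp (- \<kappa> * y\<^sup>2 / x) \<le> exp (- \<kappa>' * y\<^sup>2 / x)" using assms by (simp add: divide_right_mono)
  then have "K / x * exp (- \<kappa> * y\<^sup>2 / x) \<le> K' / x * exp (- \<kappa>' * y\<^sup>2 / x)"
    using assms by (intro mult_mono divide_right_mono) auto
  then show ?thesis using assms(1) by linarith
qed

text \<open>The bounds on \<open>uyy\<close>, \<open>uy\<close> and \<open>ux\<close> are proved off
  the wall and extended to \<open>y = 0\<close> by continuity. The mixed derivative needs no such
  extension: its existence at the wall was shown directly.\<close>

lemma all_bounds: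
  "\<exists>K>0. \<exists>\<kappa>>0. \<forall>x>2 * s0 + 2. \<forall>y\<ge>0.
     uyy x y \<le> 0 \<and> - uyy x y \<le> K / x * exp (- \<kappa> * y\<^sup>2 / x) \<and>
     \<bar>uy x y - f2 (y / sqrt (x + 1)) / sqrt (x + 1)\<bar> \<le> K / x * exp (- \<kappa> * y\<^sup>2 / x) \<and>
     \<bar>ux x y\<bar> \<le> K / x * exp (- \<kappa> * y\<^sup>2 / x) \<and>
     (\<exists>d. ((\<lambda>s. uy s y) has_real_derivative d) (at x) \<and> \<bar>d\<bar> \<le> K / x * exp (- \<kappa> * y\<^sup>2 / x))"
proof -
  obtain K1 \<kappa>1 where K1: "K1 > 0" "\<kappa>1 > 0" and b1: "\<forall>x>2 * s0 + 2. \<forall>y\<ge>0. \<exists>d. ((\<lambda>s. uy s y) has_real_derivative d) (at x) \<and> \<bar>d\<bar> \<le> K1 / x * exp (- \<kappa>1 * y\<^sup>2 / x)"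
    using uy_dx by metis
  obtain K2 \<kappa>2 where K2: "K2 > 0" "\<kappa>2 > 0" and b2: "\<forall>x\<ge>s0. \<forall>y>0. y * uy x y \<le> K2 * exp (- \<kappa>2 * y\<^sup>2 / x) \<and> y / x * (y * uy x y) \<le> K2 * exp (- \<kappa>2 * y\<^sup>2 / x)"
    using y_uy_gaussian by metis
  obtain K3 \<kappa>3 where K3: "K3 > 0" "\<kappa>3 > 0" and b3: "\<forall>x\<ge>s0. \<forall>y>0. \<bar>uy x y - f2 (y / sqrt (x + 1)) / sqrt (x + 1)\<bar> \<le> K3 / x * exp (- \<kappa>3 * y\<^sup>2 / x)"
    using uy_minus_blasius by metis
  define K where "K = K1 + K2 + K3"
  define \<kappa> where "\<kappa> = min \<kappa>1 (min \<kappa>2 \<kappa>3)"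
  have K: "K > 0" "0 \<le> K1" "0 \<le> K2" "0 \<le> K3" "K1 \<le> K" "K2 \<le> K" "K3 \<le> K"
    using K1 K2 K3 by (auto simp: K_def)
  have \<kappa>: "\<kappa> > 0" "\<kappa> \<le> \<kappa>1" "\<kappa> \<le> \<kappa>2" "\<kappa> \<le> \<kappa>3" using K1 K2 K3 by (auto simp: \<kappa>_def)
  have "uyy x y \<le> 0 \<and> - uyy x y \<le> K / x * exp (- \<kappa> * y\<^sup>2 / x) \<and>
     \<bar>uy x y - f2 (y / sqrt (x + 1)) / sqrt (x + 1)\<bar> \<le> K / x * exp (- \<kappa> * y\<^sup>2 / x) \<and>
     \<bar>ux x y\<bar> \<le> K / x * exp (- \<kappa> * y\<^sup>2 / x) \<and>
     (\<exists>d. ((\<lambda>s. uy s y) has_real_derivative d) (at x) \<and> \<bar>d\<bar> \<le> K / x * exp (- \<kappa> * y\<^sup>2 / x))"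
    if x: "x > 2 * s0 + 2" and y: "y \<ge> 0" for x y
  proof -
    have x1: "x > 0" "x \<ge> s0" "x \<ge> 0" using x s0(1) by auto
    have pos: "uyy x y \<le> 0" "- uyy x y \<le> K / x * exp (- \<kappa> * y\<^sup>2 / x)"
      "\<bar>uy x y - f2 (y / sqrt (x + 1)) / sqrt (x + 1)\<bar> \<le> K / x * exp (- \<kappa> * y\<^sup>2 / x)"
      "\<bar>ux x y\<bar> \<le> K / x * exp (- \<kappa> * y\<^sup>2 / x)" if y: "y > 0" for y
    proof -
      have un: "0 \<le> y * uy x y" using uy_nonneg[of x y] x1 y by simp
      have "y * uy x y / x \<le> K2 * exp (- \<kappa>2 * y\<^sup>2 / x) / x"
        using b2 x1 y by (intro divide_right_mono) auto
      then have "y * uy x y / x \<le> K2 / x * exp (- \<kappa>2 * y\<^sup>2 / x)" by simp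
      then have yu: "y * uy x y / x \<le> K / x * exp (- \<kappa> * y\<^sup>2 / x)"
        by (rule gaussian_weaken) (use K \<kappa> x1 in auto)
      have "- uyy x y \<le> y * uy x y / (2 * x) * u x y" using uyy_lower[of x y] x1 y by simp
      also have "\<dots> \<le> y * uy x y / (2 * x) * 1"
        using un u_le_one[of x y] x1 y by (intro mult_left_mono) auto
      also have "\<dots> \<le> y * uy x y / x" using un x1 by (simp add: divide_left_mono)
      finally show "- uyy x y \<le> K / x * exp (- \<kappa> * y\<^sup>2 / x)" using yu by linarith
      show "uyy x y \<le> 0" using uyy_nonpos x1 y by simp
      show "\<bar>ux x y\<bar> \<le> K / x * exp (- \<kappa> * y\<^sup>2 / x)" using ux_bound[of x y] x1 y yu by linarith
      show "\<bar>uy x y - f2 (y / sqrt (x + 1)) / sqrt (x + 1)\<bar> \<le> K / x * exp (- \<kappa> * y\<^sup>2 / x)"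
        by (rule gaussian_weaken[of _ K3 x \<kappa>3 y]) (use b3 K \<kappa> x1 y in auto)
    qed
    have cont: "continuous_on {0..} (uyy x)" "continuous_on {0..} (uy x)" "continuous_on {0..} (ux x)"
      using continuous_on_slice[OF cont_uyy] continuous_on_slice[OF cont_uy] continuous_on_slice[OF cont_ux] x1 by auto
    have contE: "continuous_on {0..} (\<lambda>y. K / x * exp (- \<kappa> * y\<^sup>2 / x))" by (intro continuous_intros) (use x1 in auto)
    have contf: "continuous_on {0..} (\<lambda>y. f2 (y / sqrt (x + 1)) / sqrt (x + 1))"
      by (intro continuous_intros continuous_on_compose2[OF cont_f2]) (use x1 in auto)
    have wall: "uyy x 0 \<le> 0" "- uyy x 0 \<le> K / x * exp (- \<kappa> * 0\<^sup>2 / x)"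
      "\<bar>uy x 0 - f2 (0 / sqrt (x + 1)) / sqrt (x + 1)\<bar> \<le> K / x * exp (- \<kappa> * 0\<^sup>2 / x)"
      "\<bar>ux x 0\<bar> \<le> K / x * exp (- \<kappa> * 0\<^sup>2 / x)"
      by (rule le_at_zero_by_continuity[OF cont(1) continuous_on_const pos(1)]
          le_at_zero_by_continuity[OF continuous_on_minus[OF cont(1)] contE pos(2)]
          le_at_zero_by_continuity[OF continuous_on_rabs[OF continuous_on_diff[OF cont(2) contf]] contE pos(3)]
          le_at_zero_by_continuity[OF continuous_on_rabs[OF cont(3)] contE pos(4)]; assumption)+
    have "\<exists>d. ((\<lambda>s. uy s y) has_real_derivative d) (at x) \<and> \<bar>d\<bar> \<le> K / x * exp (- \<kappa> * y\<^sup>2 / x)"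
      using b1[rule_format, OF x y] gaussian_weaken[of _ K1 x \<kappa>1 y K \<kappa>] K \<kappa> x1 by blast
    then show ?thesis using pos[of y] wall y by (cases "y = 0") auto
  qed
  then show ?thesis using K(1) \<kappa>(1) by blast
qed

end

theorem theorem1p5:
  fixes u0 u0' u0'' :: "real \<Rightarrow> real"
    and u v ux uy uyy vy :: "real \<Rightarrow> real \<Rightarrow> real"
    and f f1 f2 f3 :: "real \<Rightarrow> real"
    and C1 C2 C4 C5 C6 C7 :: real
  assumes datum: "oleinik_datum u0 u0' u0''"
    and sol: "oleinik_solution u0 u v ux uy uyy vy"
    and bl: "blasius f f1 f2 f3"
    and C1_pos: "C1 > 0"
    and asym1: "(\<lambda>z. 1 - f1 z) \<in> \<Theta>[at_top](\<lambda>z. exp (- C1 * z\<^sup>2 - C2 * z) / z)"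
    and asym2: "f2 \<in> \<Theta>[at_top](\<lambda>z. exp (- C1 * z\<^sup>2 - C2 * z))"
    and C4: "C4 > 0" and C5: "C5 > 0" and C6: "C6 > 0" and C7: "C7 > 0"
    and C5_gt: "C5 > C1" and C7_gt: "C7 > C1"
    and decay: "\<forall>y\<ge>0. \<bar>u0 y - 1\<bar> \<le> C4 * exp (- C5 * y\<^sup>2)"
    and concave: "\<forall>y\<ge>0. - C6 * exp (- C7 * y\<^sup>2) \<le> u0'' y \<and> u0'' y \<le> 0"
  shows "\<exists>C c N. C > 0 \<and> c > 0 \<and> N > 0 \<and>
    (\<forall>x>N. \<forall>y\<ge>0.
       - C / (x + 1) * exp (- c * y\<^sup>2 / (x + 1)) \<le> uyy x y \<and> uyy x y \<le> 0 \<and>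
       \<bar>uy x y - f2 (y / sqrt (x + 1)) / sqrt (x + 1)\<bar>
          \<le> C / (x + 1) powr (3/4) * ln (x + exp 1) * exp (- c * y\<^sup>2 / (x + 1)) \<and>
       \<bar>ux x y\<bar> \<le> C / (x + 1) * exp (- c * y\<^sup>2 / (x + 1)) \<and>
       (\<exists>w. ((\<lambda>s. uy s y) has_real_derivative w) (at x) \<and>
            \<bar>w\<bar> \<le> C / (x + 1) powr (3/4) * exp (- c * y\<^sup>2 / (x + 1))))"
proof -
  interpret prandtl u0 u0' u0'' u v ux uy uyy vy f f1 f2 f3 C1 C2 C4 C5
    by unfold_locales (use assms in auto)
  obtain K \<kappa> where K: "K > 0" "\<kappa> > 0" and bounds: "\<forall>x>2 * s0 + 2. \<forall>y\<ge>0.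
     uyy x y \<le> 0 \<and> - uyy x y \<le> K / x * exp (- \<kappa> * y\<^sup>2 / x) \<and>
     \<bar>uy x y - f2 (y / sqrt (x + 1)) / sqrt (x + 1)\<bar> \<le> K / x * exp (- \<kappa> * y\<^sup>2 / x) \<and>
     \<bar>ux x y\<bar> \<le> K / x * exp (- \<kappa> * y\<^sup>2 / x) \<and>
     (\<exists>d. ((\<lambda>s. uy s y) has_real_derivative d) (at x) \<and> \<bar>d\<bar> \<le> K / x * exp (- \<kappa> * y\<^sup>2 / x))"
    using all_bounds by metis
  show ?thesis
  proof (rule exI[of _ "2 * K"], rule exI[of _ \<kappa>], rule exI[of _ "2 * s0 + 2"], intro conjI allI impI)
    show "2 * K > 0" "\<kappa> > 0" "2 * s0 + 2 > 0" using K s0(1) by auto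
    fix x y :: real assume x: "x > 2 * s0 + 2" and y: "y \<ge> 0"
    have x1: "x \<ge> 1" using x s0(1) by simp
    define E where "E = exp (- \<kappa> * y\<^sup>2 / (x + 1))"
    have E: "E > 0" by (simp add: E_def)
    have "\<kappa> * y\<^sup>2 / (x + 1) \<le> \<kappa> * y\<^sup>2 / x" using K x1 by (intro divide_left_mono) auto
    then have "exp (- \<kappa> * y\<^sup>2 / x) \<le> E" by (simp add: E_def)
    \<comment> \<open>Passing from \<open>x\<close> to \<open>x + 1\<close> costs the factor 2, as
      \<open>x \<ge> 1\<close>.\<close>
    moreover have "K / x \<le> 2 * K / (x + 1)" using K x1 by (simp add: field_simps)
    ultimately have B1: "K / x * exp (- \<kappa> * y\<^sup>2 / x) \<le> 2 * K / (x + 1) * E"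
      using K x1 by (intro mult_mono) auto
    \<comment> \<open>The rate \<open>1/x\<close> is relaxed to the power 3/4, and then to the
      version with the logarithm, which is at least 1.\<close>
    have "(x + 1) powr (3/4) \<le> (x + 1) powr 1" using x1 by (intro powr_mono) auto
    then have "2 * K / (x + 1) \<le> 2 * K / (x + 1) powr (3/4)"
      using K x1 by (intro divide_left_mono) auto
    then have "2 * K / (x + 1) * E \<le> 2 * K / (x + 1) powr (3/4) * E" using E by (intro mult_right_mono) auto
    with B1 have B2: "K / x * exp (- \<kappa> * y\<^sup>2 / x) \<le> 2 * K / (x + 1) powr (3/4) * E" by linarith
    have "ln (exp 1) \<le> ln (x + exp 1)" using x1 by (intro ln_mono) (auto intro: add_nonneg_pos)
    then have "2 * K / (x + 1) powr (3/4) * 1 \<le> 2 * K / (x + 1) powr (3/4) * ln (x + exp 1)"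
      using K by (intro mult_left_mono) auto
    then have "2 * K / (x + 1) powr (3/4) * E \<le> 2 * K / (x + 1) powr (3/4) * ln (x + exp 1) * E"
      using E by (intro mult_right_mono) auto
    with B2 have B3: "K / x * exp (- \<kappa> * y\<^sup>2 / x) \<le> 2 * K / (x + 1) powr (3/4) * ln (x + exp 1) * E" by linarith
    note b = bounds[rule_format, OF x y]
    show "- (2 * K) / (x + 1) * exp (- \<kappa> * y\<^sup>2 / (x + 1)) \<le> uyy x y"
      using b B1 by (simp add: E_def)
    show "uyy x y \<le> 0" using b by simp
    show "\<bar>uy x y - f2 (y / sqrt (x + 1)) / sqrt (x + 1)\<bar>
        \<le> 2 * K / (x + 1) powr (3/4) * ln (x + exp 1) * exp (- \<kappa> * y\<^sup>2 / (x + 1))"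
      using b B3 unfolding E_def by linarith
    show "\<bar>ux x y\<bar> \<le> 2 * K / (x + 1) * exp (- \<kappa> * y\<^sup>2 / (x + 1))"
      using b B1 unfolding E_def by linarith
    show "\<exists>w. ((\<lambda>s. uy s y) has_real_derivative w) (at x) \<and>
        \<bar>w\<bar> \<le> 2 * K / (x + 1) powr (3/4) * exp (- \<kappa> * y\<^sup>2 / (x + 1))"
      using b B2 unfolding E_def by (meson order_trans)
  qed
qed

end
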